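(* Let $(M,\langle\cdot,\cdot\rangle^*,dv_M)$ be a subriemannian manifold of dimension $m+1$ with background volume form, having isometric translations $\Psi_a$ near $p_0\in M$, transversal to a hypersurface $\Sigma$ passing through $p_0$; assume $\dim\xi$ is constant, equal to $m+1-l$, near $p_0$. Take a system of translation-isometric coordinates $x^1,\dots,x^{m+1}$ in a neighborhood $V$ of $p_0$ such that $x^{m+1}=0$ on $\Sigma$. Let $u,v:\Sigma\cap V\to\mathbb{R}$ be ($C^\infty$) functions defining graphs $\{(x^1,\dots,x^m,u(x^1,\dots,x^m))\}\subset V$ and $\{(x^1,\dots,x^m,v(x^1,\dots,x^m))\}\subset V$ such that $|d(u-x^{m+1})|_*\neq0$ and $|d(v-x^{m+1})|_*\ne0$. Assume: (1) $v\ge u$ on $\Sigma\cap V$ and $v(0,\dots,0)=u(0,\dots,0)=0$; (2) for some $p\ge0$, $H_p(v)\le H_p(u)$ on $\Sigma\cap V$. Moreover, assume that near $p_0$ the rank condition holds: $\operatorname{rank}\mathcal{L}(X_1,\dots,X_{m-l})\ge m$ for any local sections $X_1,\dots,X_{m-l}$ of $\xi$ which are linearly independent wherever defined. Then $v\equiv u$ in a neighborhood of $p_0\in\Sigma$.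
   Context: A subriemannian manifold is a $C^\infty$ manifold $M$ with a (smooth) nonnegative definite inner product $\langle\cdot,\cdot\rangle^*$ on $T^*M$ (possibly degenerate); $|\omega|_*:=(\langle\omega,\omega\rangle^* )^{1/2}$. A background volume form $dv_M$ is a nowhere vanishing $(m+1)$-form. For a 1-form $\omega$, $\omega\lrcorner dv_M$ is the $m$-form with $\eta\wedge(\omega\lrcorner dv_M)=\langle\eta,\omega\rangle^*dv_M$ for all 1-forms $\eta$. $G:T^*M\to TM$ is defined by $\omega(G(\eta))=\langle\omega,\eta\rangle^*$, and $\xi:=\operatorname{Range}(G)$. Isometric translations near $p_0$: a one-parameter family of local diffeomorphisms $\Psi_a$, $a\in(-\delta,\delta)$ ($\delta>0$ small), in a small neighborhood $U$ of $p_0$, with $\Psi_0=\mathrm{Id}$, $\Psi_{a+b}=\Psi_a\circ\Psi_b$ wherever defined, $\langle\Psi_a^*\omega,\Psi_a^*\eta\rangle^*=\langle\omega,\eta\rangle^*$ for $\omega,\eta\in T^*U$, and $\Psi_a^*(dv_M)=dv_M$. They are transversal to $\Sigma$ if $\frac{d}{da}\Psi_a(x)|_{a=0}\notin T_x\Sigma$ for all $x\in\Sigma$. Translation-isometric coordinates in a neighborhood $V$ of $p_0$ (they exist under transversality) are local coordinates $x^1,\dots,x^{m+1}$ such that $\Sigma=\{x^{m+1}=0\}$ in $V$, $p_0$ is the origin, $x^j\circ\Psi_a=x^j$ ($1\le j\le m$) and $x^{m+1}\circ\Psi_a=x^{m+1}+a$ whenever both points lie in $V$, and the density $A$ in $dv_M=A\,dx^1\wedge\dots\wedge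 dx^{m+1}$ satisfies $A\circ\Psi_a=A$. For a function $u$ of $(x^1,\dots,x^m)$ put $\phi=u(x^1,\dots,x^m)-x^{m+1}$; where $|d\phi|_*\ne0$ let $H_{\phi,p}$ be defined by $d\big(\frac{d\phi}{|d\phi|_*^{1-p}}\lrcorner dv_M\big)=H_{\phi,p}\,dv_M$, and set $H_p(u)(x^1,\dots,x^m):=H_{\phi,p}(x^1,\dots,x^m,u(x^1,\dots,x^m))$. $\mathcal{L}(X_1,\dots,X_r)$ is the smallest $C^\infty$-module of vector fields containing the $C^\infty$ vector fields $X_1,\dots,X_r$ and closed under Lie bracket; its rank at $q$ is the dimension of the span of $\{Z(q):Z\in\mathcal{L}(X_1,\dots,X_r)\}$. *)

theory Defs
  imports "HOL-Analysis.Analysis"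
begin

section \<open>Smooth maps between Euclidean spaces\<close>

text \<open>Meant for open \<open>S\<close> only: the derivatives are taken in the ambient space.\<close>

fun C_k_on :: "nat \<Rightarrow> 'a::real_normed_vector set \<Rightarrow> ('a \<Rightarrow> 'b::real_normed_vector) \<Rightarrow> bool" where
  "C_k_on 0 S f \<longleftrightarrow> continuous_on S f"
| "C_k_on (Suc k) S f \<longleftrightarrow>
     (\<forall>x\<in>S. f differentiable (at x)) \<and> (\<forall>v. C_k_on k S (\<lambda>x. frechet_derivative f (at x) v))"

definition smooth_on :: "'a::real_normed_vector set \<Rightarrow> ('a \<Rightarrow> 'b::real_normed_vector) \<Rightarrow> bool" where
  "smooth_on S f \<longleftrightarrow> (\<forall>k. C_k_on k S f)"


section \<open>Smooth manifolds\<close>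

text \<open>The manifold is the whole type \<open>'a\<close>, modelled on the Euclidean space \<open>'e\<close>. A chart is a
  pair of its domain and its coordinate map; the coordinate map is arbitrary off the domain. A
  smooth structure is a maximal smooth atlas, so that its elements are all the local coordinate
  systems.\<close>

type_synonym ('a, 'e) chart = "'a set \<times> ('a \<Rightarrow> 'e)"

abbreviation chart_inv :: "('a, 'e) chart \<Rightarrow> 'e \<Rightarrow> 'a" where
  "chart_inv c \<equiv> inv_into (fst c) (snd c)"

definition is_chart :: "('a::topological_space, 'e::euclidean_space) chart \<Rightarrow> bool" where
  "is_chart c \<longleftrightarrow> open (fst c) \<and> open (snd c ` fst c) \<and>
     homeomorphism (fst c) (snd c ` fst c) (snd c) (chart_inv c)"

definition smooth_compatible ::
  "('a::topological_space, 'e::euclidean_space) chart \<Rightarrow> ('a, 'e) chart \<Rightarrow> bool" where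
  "smooth_compatible c c' \<longleftrightarrow>
     smooth_on (snd c ` (fst c \<inter> fst c')) (snd c' \<circ> chart_inv c) \<and>
     smooth_on (snd c' ` (fst c \<inter> fst c')) (snd c \<circ> chart_inv c')"

definition smooth_structure ::
  "('a::{t2_space, second_countable_topology}, 'e::euclidean_space) chart set \<Rightarrow> bool" where
  "smooth_structure M \<longleftrightarrow>
     (\<forall>c\<in>M. is_chart c) \<and>
     \<Union>(fst ` M) = UNIV \<and>
     (\<forall>c\<in>M. \<forall>c'\<in>M. smooth_compatible c c') \<and>
     (\<forall>c. is_chart c \<and> (\<forall>c'\<in>M. smooth_compatible c c') \<longrightarrow> c \<in> M)"

definition smooth_map ::
  "('a::topological_space, 'e::euclidean_space) chart set \<Rightarrow> 'a set \<Rightarrow> ('a \<Rightarrow> 'a) \<Rightarrow> bool" where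
  "smooth_map M W f \<longleftrightarrow> continuous_on W f \<and>
     (\<forall>c\<in>M. \<forall>c'\<in>M. smooth_on (snd c ` (fst c \<inter> W \<inter> f -` fst c')) (snd c' \<circ> f \<circ> chart_inv c))"

definition smooth_function ::
  "('a::topological_space, 'e::euclidean_space) chart set \<Rightarrow> 'a set \<Rightarrow> ('a \<Rightarrow> real) \<Rightarrow> bool" where
  "smooth_function M W f \<longleftrightarrow> (\<forall>c\<in>M. smooth_on (snd c ` (fst c \<inter> W)) (f \<circ> chart_inv c))"

definition local_diffeomorphism ::
  "('a::topological_space, 'e::euclidean_space) chart set \<Rightarrow> 'a set \<Rightarrow> ('a \<Rightarrow> 'a) \<Rightarrow> bool" where
  "local_diffeomorphism M U f \<longleftrightarrow>
     (\<forall>q\<in>U. \<exists>W. open W \<and> q \<in> W \<and> W \<subseteq> U \<and> open (f ` W) \<and> inj_on f W \<and>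
        smooth_map M W f \<and> smooth_map M (f ` W) (inv_into W f))"

text \<open>The differential at \<open>q\<close> of a map \<open>f\<close>, with respect to a chart \<open>c\<close> at \<open>q\<close> and a chart
  \<open>c'\<close> at \<open>f q\<close>. For \<open>f = id\<close> it is the Jacobian of the change of coordinates.\<close>

definition chart_diff ::
  "('a, 'e::euclidean_space) chart \<Rightarrow> ('a, 'e) chart \<Rightarrow> ('a \<Rightarrow> 'a) \<Rightarrow> 'a \<Rightarrow> 'e \<Rightarrow> 'e" where
  "chart_diff c c' f q = frechet_derivative (snd c' \<circ> f \<circ> chart_inv c) (at (snd c q))"


section \<open>Subriemannian manifolds\<close>

text \<open>Tensor fields are families of components, one for each chart, which transform
  accordingly. A covector is given in a chart by its component vector \<open>\<omega> :: 'e\<close>; it is paired with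
  tangent vectors by the Euclidean inner product of components, and its pullback along a
  differential \<open>L\<close> is \<open>adjoint L \<omega>\<close>. Thus \<open>g c q \<omega> \<eta>\<close> is the inner product at \<open>q\<close> of the
  covectors with components \<open>\<omega>\<close> and \<open>\<eta>\<close> in the chart \<open>c\<close>.\<close>

type_synonym ('a, 'e) cometric = "('a, 'e) chart \<Rightarrow> 'a \<Rightarrow> 'e \<Rightarrow> 'e \<Rightarrow> real"

definition preserves_cometric ::
  "('a, 'e::euclidean_space) chart set \<Rightarrow> ('a, 'e) cometric \<Rightarrow> ('a \<Rightarrow> 'a) \<Rightarrow> 'a \<Rightarrow> bool" where
  "preserves_cometric M g f q \<longleftrightarrow>
     (\<forall>c\<in>M. \<forall>c'\<in>M. q \<in> fst c \<longrightarrow> f q \<in> fst c' \<longrightarrow>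
        (\<forall>\<omega> \<eta>. g c q (adjoint (chart_diff c c' f q) \<omega>) (adjoint (chart_diff c c' f q) \<eta>)
              = g c' (f q) \<omega> \<eta>))"

definition subriemannian_manifold ::
  "('a::{t2_space, second_countable_topology}, 'e::euclidean_space) chart set \<Rightarrow>
    ('a, 'e) cometric \<Rightarrow> bool" where
  "subriemannian_manifold M g \<longleftrightarrow> smooth_structure M \<and>
     (\<forall>c\<in>M. \<forall>q\<in>fst c. bilinear (g c q) \<and>
        (\<forall>\<omega> \<eta>. g c q \<omega> \<eta> = g c q \<eta> \<omega>) \<and> (\<forall>\<omega>. 0 \<le> g c q \<omega> \<omega>)) \<and>
     (\<forall>c\<in>M. \<forall>\<omega> \<eta>. smooth_on (snd c ` fst c) (\<lambda>z. g c (chart_inv c z) \<omega> \<eta>)) \<and>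
     (\<forall>q. preserves_cometric M g id q)"

definition conorm :: "('a, 'e) cometric \<Rightarrow> ('a, 'e) chart \<Rightarrow> 'a \<Rightarrow> 'e \<Rightarrow> real" where
  "conorm g c q \<omega> = sqrt (g c q \<omega> \<omega>)"

text \<open>\<open>sharp\<close> is the map \<open>G\<close> from covectors to vectors, and \<open>horizontal\<close> is \<open>\<xi>\<close>, both in terms
  of components in \<open>c\<close>.\<close>

definition sharp ::
  "('a, 'e::euclidean_space) cometric \<Rightarrow> ('a, 'e) chart \<Rightarrow> 'a \<Rightarrow> 'e \<Rightarrow> 'e" where
  "sharp g c q \<eta> = (THE v. \<forall>\<omega>. \<omega> \<bullet> v = g c q \<omega> \<eta>)"

definition horizontal ::
  "('a, 'e::euclidean_space) cometric \<Rightarrow> ('a, 'e) chart \<Rightarrow> 'a \<Rightarrow> 'e set" where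
  "horizontal g c q = range (sharp g c q)"


section \<open>Differential forms\<close>

text \<open>A \<open>k\<close>-form at a point of \<open>'e\<close> is an alternating multilinear function of lists of \<open>k\<close>
  vectors, extended by 0 to lists of other lengths.\<close>

definition alternating_form :: "nat \<Rightarrow> ('e::real_vector list \<Rightarrow> real) \<Rightarrow> bool" where
  "alternating_form k \<alpha> \<longleftrightarrow>
     (\<forall>vs. length vs \<noteq> k \<longrightarrow> \<alpha> vs = 0) \<and>
     (\<forall>vs i. length vs = k \<and> i < k \<longrightarrow> linear (\<lambda>v. \<alpha> (vs[i := v]))) \<and>
     (\<forall>vs i j. length vs = k \<and> i < j \<and> j < k \<and> vs ! i = vs ! j \<longrightarrow> \<alpha> vs = 0)"

definition omit_nth :: "nat \<Rightarrow> 'b list \<Rightarrow> 'b list" where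
  "omit_nth i vs = take i vs @ drop (Suc i) vs"

text \<open>The wedge product \<open>\<eta> \<and> \<alpha>\<close> of a covector and a form, without normalising factors, and
  the matching exterior derivative.\<close>

definition wedge1 :: "'e::real_inner \<Rightarrow> ('e list \<Rightarrow> real) \<Rightarrow> 'e list \<Rightarrow> real" where
  "wedge1 \<eta> \<alpha> vs = (\<Sum>i<length vs. (-1) ^ i * (\<eta> \<bullet> vs ! i) * \<alpha> (omit_nth i vs))"

definition ext_deriv ::
  "('e::euclidean_space \<Rightarrow> 'e list \<Rightarrow> real) \<Rightarrow> 'e \<Rightarrow> 'e list \<Rightarrow> real" where
  "ext_deriv \<alpha> z vs =
     (\<Sum>i<length vs. (-1) ^ i * frechet_derivative (\<lambda>y. \<alpha> y (omit_nth i vs)) (at z) (vs ! i))"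

text \<open>\<open>coord_form [e\<^sub>1, \<dots>, e\<^sub>n]\<close> is \<open>dx\<^sup>1 \<and> \<dots> \<and> dx\<^sup>n\<close> for the coordinates \<open>x\<^sup>i = e\<^sub>i \<bullet> x\<close>; the
  innermost factor is the 0-form 1.\<close>

definition coord_form :: "'e::real_inner list \<Rightarrow> 'e list \<Rightarrow> real" where
  "coord_form es = foldr wedge1 es (\<lambda>vs. if vs = [] then 1 else 0)"

type_synonym ('a, 'e) form_field = "('a, 'e) chart \<Rightarrow> 'a \<Rightarrow> 'e list \<Rightarrow> real"

definition preserves_form ::
  "('a, 'e::euclidean_space) chart set \<Rightarrow> ('a, 'e) form_field \<Rightarrow> ('a \<Rightarrow> 'a) \<Rightarrow> 'a \<Rightarrow> bool" where
  "preserves_form M dv f q \<longleftrightarrow>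
     (\<forall>c\<in>M. \<forall>c'\<in>M. q \<in> fst c \<longrightarrow> f q \<in> fst c' \<longrightarrow>
        (\<forall>vs. dv c' (f q) (map (chart_diff c c' f q) vs) = dv c q vs))"

definition volume_form ::
  "('a, 'e::euclidean_space) chart set \<Rightarrow> ('a, 'e) form_field \<Rightarrow> bool" where
  "volume_form M dv \<longleftrightarrow>
     (\<forall>c\<in>M. \<forall>q\<in>fst c. alternating_form DIM('e) (dv c q) \<and> (\<exists>vs. dv c q vs \<noteq> 0)) \<and>
     (\<forall>c\<in>M. \<forall>vs. smooth_on (snd c ` fst c) (\<lambda>z. dv c (chart_inv c z) vs)) \<and>
     (\<forall>q. preserves_form M dv id q)"

text \<open>The contraction of \<open>dv\<close> with the covector \<open>\<omega>\<close>; it is unique since \<open>\<eta>\<close> ranges over all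
  covectors.\<close>

definition interior_form ::
  "('a, 'e::euclidean_space) cometric \<Rightarrow> ('a, 'e) form_field \<Rightarrow> ('a, 'e) chart \<Rightarrow>
    'a \<Rightarrow> 'e \<Rightarrow> 'e list \<Rightarrow> real" where
  "interior_form g dv c q \<omega> =
     (THE \<alpha>. alternating_form (DIM('e) - 1) \<alpha> \<and>
        (\<forall>\<eta>. wedge1 \<eta> \<alpha> = (\<lambda>vs. g c q \<eta> \<omega> * dv c q vs)))"


section \<open>Hypersurfaces and isometric translations\<close>

definition hypersurface ::
  "('a::topological_space, 'b::euclidean_space \<times> real) chart set \<Rightarrow> 'a set \<Rightarrow> bool" where
  "hypersurface M S \<longleftrightarrow>
     (\<forall>q\<in>S. \<exists>c\<in>M. q \<in> fst c \<and> S \<inter> fst c = {r \<in> fst c. snd (snd c r) = 0})"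

definition tangent_space_of ::
  "'a set \<Rightarrow> ('a, 'e::euclidean_space) chart \<Rightarrow> 'a \<Rightarrow> 'e set" where
  "tangent_space_of S c q =
     {v. \<exists>\<gamma> \<epsilon>. 0 < \<epsilon> \<and> \<gamma> 0 = q \<and> \<gamma> ` {-\<epsilon><..<\<epsilon>} \<subseteq> S \<inter> fst c \<and>
         smooth_on {-\<epsilon><..<\<epsilon>} (snd c \<circ> \<gamma>) \<and> v = vector_derivative (snd c \<circ> \<gamma>) (at (0::real))}"

definition isometric_translations ::
  "('a::topological_space, 'e::euclidean_space) chart set \<Rightarrow> ('a, 'e) cometric \<Rightarrow>
    ('a, 'e) form_field \<Rightarrow> (real \<Rightarrow> 'a \<Rightarrow> 'a) \<Rightarrow> real \<Rightarrow> 'a set \<Rightarrow> 'a \<Rightarrow> bool" where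
  "isometric_translations M g dv \<Psi> \<delta> U p0 \<longleftrightarrow>
     0 < \<delta> \<and> open U \<and> p0 \<in> U \<and>
     continuous_on ({-\<delta><..<\<delta>} \<times> U) (\<lambda>(a, q). \<Psi> a q) \<and>
     (\<forall>c\<in>M. \<forall>c'\<in>M.
        smooth_on {(a, z). a \<in> {-\<delta><..<\<delta>} \<and> z \<in> snd c ` (fst c \<inter> U) \<and> \<Psi> a (chart_inv c z) \<in> fst c'}
          (\<lambda>(a, z). snd c' (\<Psi> a (chart_inv c z)))) \<and>
     (\<forall>a\<in>{-\<delta><..<\<delta>}. local_diffeomorphism M U (\<Psi> a)) \<and>
     (\<forall>q\<in>U. \<Psi> 0 q = q) \<and>
     (\<forall>a\<in>{-\<delta><..<\<delta>}. \<forall>b\<in>{-\<delta><..<\<delta>}. \<forall>q\<in>U.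
        a + b \<in> {-\<delta><..<\<delta>} \<and> \<Psi> b q \<in> U \<longrightarrow> \<Psi> (a + b) q = \<Psi> a (\<Psi> b q)) \<and>
     (\<forall>a\<in>{-\<delta><..<\<delta>}. \<forall>q\<in>U. \<Psi> a q \<in> U \<longrightarrow>
        preserves_cometric M g (\<Psi> a) q \<and> preserves_form M dv (\<Psi> a) q)"

definition transversal_translations ::
  "('a, 'e::euclidean_space) chart set \<Rightarrow> (real \<Rightarrow> 'a \<Rightarrow> 'a) \<Rightarrow> 'a set \<Rightarrow> 'a set \<Rightarrow> bool" where
  "transversal_translations M \<Psi> U S \<longleftrightarrow>
     (\<forall>q\<in>S \<inter> U. \<forall>c\<in>M. q \<in> fst c \<longrightarrow>
        vector_derivative (\<lambda>a. snd c (\<Psi> a q)) (at 0) \<notin> tangent_space_of S c q)"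

text \<open>Coordinates \<open>c\<close> with values in \<open>'b \<times> real\<close>; the \<open>real\<close> component is the last coordinate
  \<open>x\<^sup>m\<^sup>+\<^sup>1\<close>.\<close>

definition translation_isometric_coordinates ::
  "('a::topological_space, 'b::euclidean_space \<times> real) chart set \<Rightarrow> ('a, 'b \<times> real) form_field \<Rightarrow>
    (real \<Rightarrow> 'a \<Rightarrow> 'a) \<Rightarrow> real \<Rightarrow> 'a set \<Rightarrow> 'a \<Rightarrow> 'a set \<Rightarrow> ('a, 'b \<times> real) chart \<Rightarrow> bool" where
  "translation_isometric_coordinates M dv \<Psi> \<delta> U p0 S c \<longleftrightarrow>
     c \<in> M \<and> p0 \<in> fst c \<and> snd c p0 = 0 \<and>
     S \<inter> fst c = {q \<in> fst c. snd (snd c q) = 0} \<and>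
     (\<forall>a\<in>{-\<delta><..<\<delta>}. \<forall>q\<in>U \<inter> fst c. \<Psi> a q \<in> fst c \<longrightarrow>
        fst (snd c (\<Psi> a q)) = fst (snd c q) \<and> snd (snd c (\<Psi> a q)) = snd (snd c q) + a) \<and>
     (\<exists>es A. distinct es \<and> set es = Basis \<and>
        (\<forall>q\<in>fst c. \<forall>vs. dv c q vs = A q * coord_form es vs) \<and>
        (\<forall>a\<in>{-\<delta><..<\<delta>}. \<forall>q\<in>U \<inter> fst c. \<Psi> a q \<in> fst c \<longrightarrow> A (\<Psi> a q) = A q))"


section \<open>The \<open>p\<close>-mean curvature of a graph\<close>

definition covec_diff :: "('e::euclidean_space \<Rightarrow> real) \<Rightarrow> 'e \<Rightarrow> 'e" where
  "covec_diff \<phi> z = (\<Sum>b\<in>Basis. frechet_derivative \<phi> (at z) b *\<^sub>R b)"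

text \<open>Here \<open>\<phi>\<close> is a function of the coordinates of the chart \<open>c\<close>, not of points. The value is
  meaningful where \<open>\<phi>\<close> is smooth and \<open>|d\<phi>|\<^sub>* \<noteq> 0\<close>, an open condition.\<close>

definition p_mean_curvature ::
  "('a, 'e::euclidean_space) cometric \<Rightarrow> ('a, 'e) form_field \<Rightarrow> ('a, 'e) chart \<Rightarrow>
    real \<Rightarrow> ('e \<Rightarrow> real) \<Rightarrow> 'e \<Rightarrow> real" where
  "p_mean_curvature g dv c p \<phi> z =
     (THE h. \<forall>vs. ext_deriv
        (\<lambda>y. interior_form g dv c (chart_inv c y)
           ((1 / conorm g c (chart_inv c y) (covec_diff \<phi> y) powr (1 - p)) *\<^sub>R covec_diff \<phi> y))
        z vs = h * dv c (chart_inv c z) vs)"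

definition graph_function :: "('b \<Rightarrow> real) \<Rightarrow> 'b \<times> real \<Rightarrow> real" where
  "graph_function u z = u (fst z) - snd z"

definition graph_p_mean_curvature ::
  "('a, 'b::euclidean_space \<times> real) cometric \<Rightarrow> ('a, 'b \<times> real) form_field \<Rightarrow>
    ('a, 'b \<times> real) chart \<Rightarrow> real \<Rightarrow> ('b \<Rightarrow> real) \<Rightarrow> 'b \<Rightarrow> real" where
  "graph_p_mean_curvature g dv c p u y =
     p_mean_curvature g dv c p (graph_function u) (y, u y)"

text \<open>Nonvanishing of \<open>|d(u - x\<^sup>m\<^sup>+\<^sup>1)|\<^sub>*\<close> is required at the points of the graph only; by
  continuity it then holds near the graph.\<close>

definition nonsingular_graph ::
  "('a, 'b::euclidean_space \<times> real) cometric \<Rightarrow> ('a, 'b \<times> real) chart \<Rightarrow>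
    'b set \<Rightarrow> ('b \<Rightarrow> real) \<Rightarrow> bool" where
  "nonsingular_graph g c D u \<longleftrightarrow> smooth_on D u \<and>
     (\<forall>y\<in>D. (y, u y) \<in> snd c ` fst c \<and>
        conorm g c (chart_inv c (y, u y)) (covec_diff (graph_function u) (y, u y)) \<noteq> 0)"


section \<open>Lie algebras of vector fields and the rank condition\<close>

type_synonym ('a, 'e) vfield = "('a, 'e) chart \<Rightarrow> 'a \<Rightarrow> 'e"

definition vector_field ::
  "('a::topological_space, 'e::euclidean_space) chart set \<Rightarrow> 'a set \<Rightarrow> ('a, 'e) vfield \<Rightarrow> bool" where
  "vector_field M W X \<longleftrightarrow>
     (\<forall>c\<in>M. smooth_on (snd c ` (fst c \<inter> W)) (\<lambda>z. X c (chart_inv c z))) \<and>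
     (\<forall>c\<in>M. \<forall>c'\<in>M. \<forall>q\<in>W \<inter> fst c \<inter> fst c'. X c' q = chart_diff c c' id q (X c q))"

definition lie_bracket ::
  "('a, 'e::euclidean_space) vfield \<Rightarrow> ('a, 'e) vfield \<Rightarrow> ('a, 'e) vfield" where
  "lie_bracket X Y c q =
     frechet_derivative (\<lambda>z. Y c (chart_inv c z)) (at (snd c q)) (X c q) -
     frechet_derivative (\<lambda>z. X c (chart_inv c z)) (at (snd c q)) (Y c q)"

text \<open>Elements are relevant on \<open>W\<close> only, their values off \<open>W\<close> are arbitrary. The rule \<open>zero\<close> only
  matters for empty \<open>Xs\<close>.\<close>

inductive_set lie_module ::
  "('a::topological_space, 'e::euclidean_space) chart set \<Rightarrow> 'a set \<Rightarrow>
    ('a, 'e) vfield set \<Rightarrow> ('a, 'e) vfield set"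
  for M W Xs where
  generator: "X \<in> Xs \<Longrightarrow> X \<in> lie_module M W Xs"
| zero: "(\<lambda>c q. 0) \<in> lie_module M W Xs"
| add: "X \<in> lie_module M W Xs \<Longrightarrow> Y \<in> lie_module M W Xs \<Longrightarrow>
    (\<lambda>c q. X c q + Y c q) \<in> lie_module M W Xs"
| scale: "smooth_function M W f \<Longrightarrow> X \<in> lie_module M W Xs \<Longrightarrow>
    (\<lambda>c q. f q *\<^sub>R X c q) \<in> lie_module M W Xs"
| bracket: "X \<in> lie_module M W Xs \<Longrightarrow> Y \<in> lie_module M W Xs \<Longrightarrow>
    lie_bracket X Y \<in> lie_module M W Xs"

text \<open>For \<open>q\<close> in \<open>W\<close>, this does not depend on the chart \<open>c\<close> at \<open>q\<close>.\<close>

definition lie_rank ::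
  "('a::topological_space, 'e::euclidean_space) chart set \<Rightarrow> 'a set \<Rightarrow>
    ('a, 'e) vfield set \<Rightarrow> ('a, 'e) chart \<Rightarrow> 'a \<Rightarrow> nat" where
  "lie_rank M W Xs c q = dim (span ((\<lambda>Z. Z c q) ` lie_module M W Xs))"

definition independent_sections ::
  "('a::topological_space, 'e::euclidean_space) chart set \<Rightarrow> ('a, 'e) cometric \<Rightarrow>
    'a set \<Rightarrow> nat \<Rightarrow> (nat \<Rightarrow> ('a, 'e) vfield) \<Rightarrow> bool" where
  "independent_sections M g W k X \<longleftrightarrow>
     (\<forall>i<k. vector_field M W (X i)) \<and>
     (\<forall>c\<in>M. \<forall>q\<in>W \<inter> fst c.
        (\<forall>i<k. X i c q \<in> horizontal g c q) \<and>
        inj_on (\<lambda>i. X i c q) {..<k} \<and> independent ((\<lambda>i. X i c q) ` {..<k}))"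

definition rank_condition_near ::
  "('a::topological_space, 'e::euclidean_space) chart set \<Rightarrow> ('a, 'e) cometric \<Rightarrow>
    'a \<Rightarrow> nat \<Rightarrow> nat \<Rightarrow> bool" where
  "rank_condition_near M g p0 k r \<longleftrightarrow>
     (\<exists>N. open N \<and> p0 \<in> N \<and>
        (\<forall>W X. open W \<and> W \<subseteq> N \<and> independent_sections M g W k X \<longrightarrow>
           (\<forall>c\<in>M. \<forall>q\<in>W \<inter> fst c. r \<le> lie_rank M W (X ` {..<k}) c q)))"

end

theory Submission
  imports Defs
begin

text \<open>In translation-isometric coordinates \<open>z = (y, s)\<close> the cometric and the density do not depend on
  \<open>s\<close>, so the curvatures of the graphs of \<open>u\<close> and \<open>v\<close> are the values of one degenerate elliptic
  divergence operator at the functions \<open>\<phi> = u - s \<le> \<psi> = v - s\<close>. Hopf's barrier argument shows that at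
  every boundary point of the coincidence set \<open>Z = {\<phi> = \<psi>}\<close> each proximal normal is a null vector of
  the symbol, so that all sections of \<open>\<xi> \<inter> ker d\<phi>\<close> are tangent to \<open>Z\<close> in the sense of Bony. Tangency
  passes to Lie brackets, and so does annihilation by \<open>d\<phi>\<close>. A proximal normal \<open>(n, 0)\<close> of \<open>Z\<close> and \<open>d\<phi>\<close>
  would therefore both annihilate a Lie algebra of rank at least \<open>m\<close> in dimension \<open>m + 1\<close>, which
  is impossible; hence \<open>Z\<close> has no boundary near the origin.\<close>

section \<open>Smooth functions\<close>

text \<open>The two curvatures are compared at the points \<open>(y, u y)\<close> and
  \<open>(y, v y)\<close>, which differ. Translation invariance moves both values to one common
  point, and it turns the coincidence set into a cylinder along the \<open>s\<close> axis. Its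
  nearest-point normals can therefore be taken of the form \<open>(n, 0)\<close>, and these are
  independent of \<open>d\<phi>\<close>, whose last component is -1. The obstacle is degeneracy: the
  symbol vanishes on the kernel of the cometric and, for \<open>p = 0\<close>, on
  \<open>d\<phi>\<close> as well. A normal that is a null vector of the symbol gives, by
  Cauchy-Schwarz, orthogonality only to those fields of \<xi> that \<open>d\<phi>\<close>
  annihilates. They span one dimension less than \<xi>, that is \<open>m - l\<close>, which is the
  number of sections in the rank condition. A rank of at least \<open>m\<close> leaves room for a
  single annihilating covector, and \<open>d\<phi>\<close> already takes that place. The coincidence
  set is a closed set without known regularity. Tangency is therefore tested on proximal normals,
  which arise wherever an outside point has a nearest point in the set.\<close>

abbreviation FD :: "('a::real_normed_vector \<Rightarrow> 'b::real_normed_vector) \<Rightarrow> 'a \<Rightarrow> 'a \<Rightarrow> 'b" where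
  "FD f x \<equiv> frechet_derivative f (at x)"

section \<open>Calculus of maps that are differentiable to finite order\<close>

lemma C_k_on_cong:
  assumes "open S" "\<And>x. x \<in> S \<Longrightarrow> f x = g x" "C_k_on k S f"
  shows "C_k_on k S g"
  using assms(2,3)
proof (induction k arbitrary: f g)
  case 0
  then show ?case
    using continuous_on_cong[of S S f g] by simp
next
  case (Suc k)
  have fd: "FD f x v = FD g x v" if "x \<in> S" for x v
    using frechet_derivative_transform_within_open[of f x S g] Suc.prems that \<open>open S\<close> by simp
  show ?case
    unfolding C_k_on.simps
  proof (intro conjI ballI allI)
    fix x assume "x \<in> S"
    then have "f differentiable (at x)" using Suc.prems by simp
    then show "g differentiable (at x)"
      unfolding differentiable_def
      using has_derivative_transform_within_open[OF _ \<open>open S\<close> \<open>x \<in> S\<close>] Suc.prems(1) by metis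
  next
    fix v
    show "C_k_on k S (\<lambda>x. FD g x v)"
      using Suc.IH[of "\<lambda>x. FD f x v" "\<lambda>x. FD g x v"]
        fd Suc.prems(2) by simp
  qed
qed

lemma C_k_on_subset: "C_k_on k S f \<Longrightarrow> T \<subseteq> S \<Longrightarrow> C_k_on k T f"
  by (induction k arbitrary: f) (auto intro: continuous_on_subset)

lemma C_k_on_Suc_imp: "C_k_on (Suc k) S f \<Longrightarrow> C_k_on k S f"
proof (induction k arbitrary: f)
  case 0
  then show ?case
    using differentiable_imp_continuous_on[of f S] by (simp add: differentiable_on_def differentiable_at_withinI)
next
  case (Suc k)
  then have "C_k_on (Suc k) S (\<lambda>x. FD f x v)" for v
    by (subst (asm) C_k_on.simps(2)) blast
  from Suc.IH[OF this] Suc.prems show ?case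
    unfolding C_k_on.simps(2)[of k] C_k_on.simps(2)[of "Suc k"] by blast
qed

lemma C_k_on_const: "C_k_on k S (\<lambda>x. c)"
  by (induction k arbitrary: c) auto

lemma C_k_on_ident: "C_k_on k S (\<lambda>x. x)"
  by (cases k) (auto simp: C_k_on_const)

text \<open>Any explicit derivative may stand in for \<open>frechet_derivative\<close>. Together
  with \<open>C_k_on_SucD\<close> it makes each closure property below an induction on
  \<open>k\<close> with the functions generalised.\<close>

lemma C_k_on_SucI:
  assumes "open S" and f: "\<And>x. x \<in> S \<Longrightarrow> (f has_derivative f' x) (at x)"
    and f': "\<And>v. C_k_on k S (\<lambda>x. f' x v)"
  shows "C_k_on (Suc k) S f"
  unfolding C_k_on.simps
proof (intro conjI ballI allI)
  show "f differentiable at x" if "x \<in> S" for x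
    using f[OF that] by (auto simp: differentiable_def)
  show "C_k_on k S (\<lambda>x. FD f x v)" for v
    by (rule C_k_on_cong[OF \<open>open S\<close> _ f'[of v]]) (simp add: frechet_derivative_at[OF f, symmetric])
qed

lemma C_k_on_SucD:
  assumes "C_k_on (Suc k) S f"
  shows "x \<in> S \<Longrightarrow> (f has_derivative FD f x) (at x)" "C_k_on k S (\<lambda>x. FD f x v)"
  using assms by (simp_all add: frechet_derivative_works[symmetric])

lemma C_k_on_bounded_linear:
  assumes "open S" "bounded_linear L" "C_k_on k S f"
  shows "C_k_on k S (\<lambda>x. L (f x))"
  using assms(3)
proof (induction k arbitrary: f)
  case 0
  then show ?case
    using assms(2) by (simp add: bounded_linear.continuous_on)
next
  case (Suc k)
  note f = C_k_on_SucD[OF Suc.prems]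
  show ?case
    by (rule C_k_on_SucI[OF \<open>open S\<close> bounded_linear.has_derivative[OF assms(2) f(1)] Suc.IH[OF f(2)]])
qed

lemma C_k_on_add:
  assumes "open S" "C_k_on k S f" "C_k_on k S g"
  shows "C_k_on k S (\<lambda>x. f x + g x)"
  using assms(2,3)
proof (induction k arbitrary: f g)
  case 0
  then show ?case by (simp add: continuous_on_add)
next
  case (Suc k)
  note f = C_k_on_SucD[OF Suc.prems(1)] and g = C_k_on_SucD[OF Suc.prems(2)]
  show ?case
    by (rule C_k_on_SucI[OF \<open>open S\<close> has_derivative_add[OF f(1) g(1)] Suc.IH[OF f(2) g(2)]])
qed

text \<open>The product rule leaves one factor undifferentiated; \<open>C_k_on_Suc_imp\<close>
  lowers its order so that the induction hypothesis applies. Scaling, multiplication and inner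
  product are all instances.\<close>

lemma C_k_on_bilinear:
  assumes "bounded_bilinear pr" "open S" "C_k_on k S f" "C_k_on k S g"
  shows "C_k_on k S (\<lambda>x. pr (f x) (g x))"
  using assms(3,4)
proof (induction k arbitrary: f g)
  case 0
  then show ?case by (simp add: bounded_bilinear.continuous_on[OF assms(1)])
next
  case (Suc k)
  note f = C_k_on_SucD[OF Suc.prems(1)] and g = C_k_on_SucD[OF Suc.prems(2)]
  show ?case
    by (rule C_k_on_SucI[OF \<open>open S\<close> bounded_bilinear.FDERIV[OF assms(1) f(1) g(1)]
          C_k_on_add[OF \<open>open S\<close> Suc.IH[OF C_k_on_Suc_imp[OF Suc.prems(1)] g(2)]
            Suc.IH[OF f(2) C_k_on_Suc_imp[OF Suc.prems(2)]]]])
qed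

lemma C_k_on_sum:
  assumes "open S" "\<And>i. i \<in> I \<Longrightarrow> C_k_on k S (f i)"
  shows "C_k_on k S (\<lambda>x. \<Sum>i\<in>I. f i x)"
proof (cases "finite I")
  case True
  then show ?thesis using assms(2)
    by (induction I rule: finite_induct) (auto intro: C_k_on_const C_k_on_add[OF assms(1)])
qed (auto intro: C_k_on_const)

lemma linear_Basis_expand:
  fixes f :: "'e::euclidean_space \<Rightarrow> 'c::real_vector"
  assumes "linear f"
  shows "f v = (\<Sum>b\<in>Basis. (v \<bullet> b) *\<^sub>R f b)"
proof -
  have "f (\<Sum>b\<in>Basis. (v \<bullet> b) *\<^sub>R b) = (\<Sum>b\<in>Basis. (v \<bullet> b) *\<^sub>R f b)"
    using assms by (simp add: linear_sum linear_scale)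
  then show ?thesis by (simp add: euclidean_representation)
qed

lemma frechet_derivative_Basis_expand:
  fixes f :: "'b::euclidean_space \<Rightarrow> 'c::real_normed_vector"
  assumes "f differentiable (at x)"
  shows "FD f x v = (\<Sum>b\<in>Basis. (v \<bullet> b) *\<^sub>R FD f x b)"
  by (rule linear_Basis_expand[OF linear_frechet_derivative[OF assms]])

lemma covec_diff_inner:
  assumes "f differentiable (at z)"
  shows "covec_diff f z \<bullet> v = FD f z v"
  using linear_Basis_expand[OF linear_frechet_derivative[OF assms], of v]
  by (simp add: covec_diff_def inner_sum_left inner_commute[of v] mult.commute)

text \<open>In the chain rule \<open>f\<close> is differentiated in the direction
  \<open>FD g x v\<close>, which moves with \<open>x\<close>, whereas \<open>C_k_on\<close> speaks
  of fixed directions. Expanding that direction in \<open>Basis\<close> gives products of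
  fixed-direction derivatives of \<open>f\<close> with smooth coefficients.\<close>

lemma C_k_on_compose:
  fixes f :: "'b::euclidean_space \<Rightarrow> 'c::real_normed_vector" and g :: "'a::real_normed_vector \<Rightarrow> 'b"
  assumes "open S" "open T" "g ` S \<subseteq> T" "C_k_on k T f" "C_k_on k S g"
  shows "C_k_on k S (\<lambda>x. f (g x))"
  using assms(4,5)
proof (induction k arbitrary: f)
  case 0
  then show ?case using continuous_on_compose2[of T f S g] assms(3) by simp
next
  case (Suc k)
  note f = C_k_on_SucD[OF Suc.prems(1)] and g = C_k_on_SucD[OF Suc.prems(2)]
  have T: "g x \<in> T" if "x \<in> S" for x using that assms(3) by blast
  show ?case
  proof (rule C_k_on_SucI[OF \<open>open S\<close>])
    fix x assume x: "x \<in> S"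
    have "((\<lambda>x. f (g x)) has_derivative (\<lambda>v. FD f (g x) (FD g x v))) (at x)"
      by (rule has_derivative_compose[OF g(1)[OF x] f(1)[OF T[OF x]]])
    moreover have "f differentiable at (g x)" using f(1)[OF T[OF x]] by (auto simp: differentiable_def)
    ultimately show "((\<lambda>x. f (g x)) has_derivative
        (\<lambda>v. \<Sum>b\<in>Basis. (FD g x v \<bullet> b) *\<^sub>R FD f (g x) b)) (at x)"
      by (simp add: frechet_derivative_Basis_expand[symmetric])
  next
    show "C_k_on k S (\<lambda>x. \<Sum>b\<in>Basis. (FD g x v \<bullet> b) *\<^sub>R FD f (g x) b)" for v
      by (intro C_k_on_sum[OF \<open>open S\<close>] C_k_on_bilinear[OF bounded_bilinear_scaleR \<open>open S\<close>]
          C_k_on_bounded_linear[OF \<open>open S\<close> bounded_linear_inner_left g(2)]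
          Suc.IH[OF f(2) C_k_on_Suc_imp[OF Suc.prems(2)]])
  qed
qed

lemma C_k_on_powr: "C_k_on k {0<..} (\<lambda>x::real. x powr a)"
proof (induction k arbitrary: a)
  case 0
  then show ?case by (auto intro!: continuous_intros)
next
  case (Suc k)
  show ?case
  proof (rule C_k_on_SucI)
    show "((\<lambda>x. x powr a) has_derivative (\<lambda>v. v *\<^sub>R (a * x powr (a - 1)))) (at x)"
      if "x \<in> {0<..}" for x :: real
      by (rule has_derivative_eq_rhs[OF has_real_derivative_powr[unfolded has_field_derivative_def]])
        (use that in \<open>auto simp: fun_eq_iff\<close>)
    have "bounded_linear (\<lambda>x::real. v *\<^sub>R (a * x))" for v
      by (intro bounded_linear_intros)
    from C_k_on_bounded_linear[OF open_greaterThan this Suc]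
    show "C_k_on k {0<..} (\<lambda>x::real. v *\<^sub>R (a * x powr (a - 1)))" for v .
  qed simp
qed

section \<open>The same calculus for smooth maps\<close>

lemma smooth_on_cong:
  "smooth_on S f \<Longrightarrow> open S \<Longrightarrow> (\<And>x. x \<in> S \<Longrightarrow> f x = g x) \<Longrightarrow> smooth_on S g"
  unfolding smooth_on_def using C_k_on_cong by metis

lemma smooth_on_subset: "smooth_on S f \<Longrightarrow> T \<subseteq> S \<Longrightarrow> smooth_on T f"
  unfolding smooth_on_def using C_k_on_subset by metis

lemma smooth_on_differentiable: "smooth_on S f \<Longrightarrow> x \<in> S \<Longrightarrow> f differentiable (at x)"
  unfolding smooth_on_def by (metis C_k_on.simps(2))

lemma smooth_on_has_derivative:
  "smooth_on S f \<Longrightarrow> x \<in> S \<Longrightarrow> (f has_derivative FD f x) (at x)"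
  using smooth_on_differentiable frechet_derivative_works by blast

lemma smooth_on_continuous: "smooth_on S f \<Longrightarrow> continuous_on S f"
  unfolding smooth_on_def by (metis C_k_on.simps(1))

lemma smooth_on_frechet_derivative: "smooth_on S f \<Longrightarrow> smooth_on S (\<lambda>x. FD f x v)"
  unfolding smooth_on_def by (metis C_k_on.simps(2))

lemma smooth_on_const [simp]: "smooth_on S (\<lambda>x. c)"
  by (simp add: smooth_on_def C_k_on_const)

lemma smooth_on_ident: "smooth_on S (\<lambda>x. x)"
  by (simp add: smooth_on_def C_k_on_ident)

lemma smooth_on_bounded_linear:
  "open S \<Longrightarrow> bounded_linear L \<Longrightarrow> smooth_on S f \<Longrightarrow> smooth_on S (\<lambda>x. L (f x))"
  by (simp add: smooth_on_def C_k_on_bounded_linear)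

lemma smooth_on_linear_map: "open S \<Longrightarrow> bounded_linear L \<Longrightarrow> smooth_on S L"
  using smooth_on_bounded_linear[OF _ _ smooth_on_ident] .

lemma smooth_on_add:
  "open S \<Longrightarrow> smooth_on S f \<Longrightarrow> smooth_on S g \<Longrightarrow> smooth_on S (\<lambda>x. f x + g x)"
  by (simp add: smooth_on_def C_k_on_add)

lemma smooth_on_scaleR:
  "open S \<Longrightarrow> smooth_on S f \<Longrightarrow> smooth_on S g \<Longrightarrow> smooth_on S (\<lambda>x. f x *\<^sub>R g x)"
  by (simp add: smooth_on_def C_k_on_bilinear[OF bounded_bilinear_scaleR])

lemma smooth_on_mult:
  fixes f :: "'a::real_normed_vector \<Rightarrow> real"
  shows "open S \<Longrightarrow> smooth_on S f \<Longrightarrow> smooth_on S g \<Longrightarrow> smooth_on S (\<lambda>x. f x * g x)"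
  by (simp add: smooth_on_def C_k_on_bilinear[OF bounded_bilinear_mult])

lemma smooth_on_inner:
  "open S \<Longrightarrow> smooth_on S f \<Longrightarrow> smooth_on S g \<Longrightarrow> smooth_on S (\<lambda>x. f x \<bullet> g x)"
  by (simp add: smooth_on_def C_k_on_bilinear[OF bounded_bilinear_inner])

lemma smooth_on_minus:
  "open S \<Longrightarrow> smooth_on S f \<Longrightarrow> smooth_on S g \<Longrightarrow> smooth_on S (\<lambda>x. f x - g x)"
  using smooth_on_add[of S f "\<lambda>x. - g x"]
    smooth_on_bounded_linear[of S "\<lambda>x. - x" g, OF _ bounded_linear_minus[OF bounded_linear_ident]] by simp

lemma smooth_on_sum:
  "open S \<Longrightarrow> (\<And>i. i \<in> I \<Longrightarrow> smooth_on S (f i)) \<Longrightarrow> smooth_on S (\<lambda>x. \<Sum>i\<in>I. f i x)"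
  by (simp add: smooth_on_def C_k_on_sum)

lemma smooth_on_compose:
  fixes f :: "'b::euclidean_space \<Rightarrow> 'c::real_normed_vector"
  shows "smooth_on T f \<Longrightarrow> smooth_on S g \<Longrightarrow> open S \<Longrightarrow> open T \<Longrightarrow> (\<And>x. x \<in> S \<Longrightarrow> g x \<in> T) \<Longrightarrow>
    smooth_on S (\<lambda>x. f (g x))"
  unfolding smooth_on_def using C_k_on_compose[of S T g _ f] by blast

lemma smooth_on_powr:
  fixes f :: "'a::real_normed_vector \<Rightarrow> real"
  shows "open S \<Longrightarrow> smooth_on S f \<Longrightarrow> (\<And>x. x \<in> S \<Longrightarrow> 0 < f x) \<Longrightarrow> smooth_on S (\<lambda>x. f x powr a)"
  using smooth_on_compose[of "{0<..}" "\<lambda>x::real. x powr a" S f] C_k_on_powr by (auto simp: smooth_on_def)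

lemma smooth_on_divide:
  fixes f g :: "'a::real_normed_vector \<Rightarrow> real"
  assumes "open S" "smooth_on S f" "smooth_on S g" "\<And>x. x \<in> S \<Longrightarrow> g x \<noteq> 0"
  shows "smooth_on S (\<lambda>x. f x / g x)"
proof -
  have pos: "0 < g x * g x" if "x \<in> S" for x
    using assms(4)[OF that] by (auto simp: zero_less_mult_iff)
  \<comment> \<open>Powers are smooth on positive reals only and \<open>g\<close> may be negative,
    so the reciprocal is taken of the square.\<close>
  have "smooth_on S (\<lambda>x. f x * g x * (g x * g x) powr (- 1))"
    by (intro smooth_on_mult smooth_on_powr assms pos)
  then show ?thesis
    by (rule smooth_on_cong[OF _ \<open>open S\<close>])
      (use pos assms(4) in \<open>simp add: powr_minus divide_simps\<close>)
qed

lemma smooth_on_Pair: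
  assumes "open S" "smooth_on S f" "smooth_on S g"
  shows "smooth_on S (\<lambda>x. (f x :: 'b::real_normed_vector, g x :: 'c::real_normed_vector))"
proof -
  have "bounded_linear (\<lambda>y::'b. (y, 0::'c))" "bounded_linear (\<lambda>y::'c. (0::'b, y))"
    by (simp_all add: bounded_linear_Pair bounded_linear_ident bounded_linear_zero)
  then have "smooth_on S (\<lambda>x. (f x, 0::'c))" "smooth_on S (\<lambda>x. (0::'b, g x))"
    using smooth_on_bounded_linear[OF \<open>open S\<close>] assms(2,3) by blast+
  from smooth_on_add[OF \<open>open S\<close> this] show ?thesis by simp
qed

text \<open>Both base point and direction vary. This is the form needed for Lie brackets, for
  changes of chart and for the linearised flux.\<close>

lemma smooth_on_frechet_derivative_apply:
  fixes f :: "'b::euclidean_space \<Rightarrow> 'c::real_normed_vector"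
  assumes "smooth_on T f" "smooth_on S z" "smooth_on S v" "open S" "open T" "\<And>x. x \<in> S \<Longrightarrow> z x \<in> T"
  shows "smooth_on S (\<lambda>x. FD f (z x) (v x))"
proof -
  have "smooth_on S (\<lambda>x. \<Sum>b\<in>Basis. (v x \<bullet> b) *\<^sub>R FD f (z x) b)"
    using assms
    by (intro smooth_on_sum[OF \<open>open S\<close>] smooth_on_scaleR[OF \<open>open S\<close>] smooth_on_inner[OF \<open>open S\<close>] smooth_on_const
        smooth_on_compose[OF smooth_on_frechet_derivative[OF assms(1)]])
  then show ?thesis
    by (rule smooth_on_cong[OF _ \<open>open S\<close>])
      (simp add: frechet_derivative_Basis_expand[symmetric] smooth_on_differentiable[OF assms(1)] assms(6))
qed

section \<open>Vector fields tangent to a closed set\<close>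

text \<open>For \<open>c > 0\<close> the inequality says that, near \<open>x\<close>, the open ball
  centred at \<open>x + \<nu> / (2 c)\<close> with \<open>x\<close> on its boundary misses
  \<open>Z\<close>. At an interior point of \<open>Z\<close> only the zero vector qualifies, so
  conditions on normals concern boundary points.\<close>

definition proximal_normal :: "'e::real_inner set \<Rightarrow> 'e \<Rightarrow> 'e \<Rightarrow> bool" where
  "proximal_normal Z x \<nu> \<longleftrightarrow>
     (\<exists>c. \<exists>\<rho>>0. \<forall>z\<in>Z. dist z x < \<rho> \<longrightarrow> \<nu> \<bullet> (z - x) \<le> c * (dist z x)\<^sup>2)"

definition tangent_field :: "'e::real_inner set \<Rightarrow> ('e \<Rightarrow> 'e) \<Rightarrow> bool" where
  "tangent_field Z X \<longleftrightarrow> (\<forall>x\<in>Z. \<forall>\<nu>. proximal_normal Z x \<nu> \<longrightarrow> \<nu> \<bullet> X x = 0)"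

text \<open>A Gronwall estimate for the distance to \<open>K\<close> along an approximate integral
  curve of \<open>F\<close>, with a one-sided bound at nearest points as its only input. The
  distance itself need not be differentiable; the squared distance to one fixed nearest point is,
  and it dominates the squared distance to \<open>K\<close>.\<close>

lemma infdist_curve_bound:
  fixes \<gamma> :: "real \<Rightarrow> 'e::euclidean_space"
  assumes K: "closed K" "K \<noteq> {}"
    and H: "\<And>y q. y \<in> U \<Longrightarrow> q \<in> K \<Longrightarrow> infdist y K = dist y q \<Longrightarrow> (y - q) \<bullet> F y \<le> L * (dist y q)\<^sup>2"
    and \<gamma>: "\<And>s. 0 \<le> s \<Longrightarrow> s \<le> T \<Longrightarrow> (\<gamma> has_vector_derivative \<gamma>' s) (at s)"
    and U: "\<And>s. 0 \<le> s \<Longrightarrow> s \<le> T \<Longrightarrow> \<gamma> s \<in> U"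
    and e: "\<And>s. 0 \<le> s \<Longrightarrow> s \<le> T \<Longrightarrow> norm (\<gamma>' s - F (\<gamma> s)) \<le> e" "0 < e"
    and D: "infdist (\<gamma> 0) K \<le> D" "0 < D" and "0 \<le> L" "0 \<le> T"
  shows "infdist (\<gamma> T) K \<le> exp ((L + 1) * T) * (D + T * e)"
proof (rule ccontr)
  assume neg: "\<not> ?thesis"
  define B where "B s = exp ((L + 1) * s) * (D + s * e)" for s
  define d where "d s = infdist (\<gamma> s) K" for s
  \<comment> \<open>The last time at which the bound \<open>B\<close> holds is shown to be
    \<open>T\<close>: at an earlier last time the bound would persist a little longer.\<close>
  define C where "C = {s \<in> {0..T}. d s \<le> B s}"
  have Bpos: "0 < B s" if "0 \<le> s" for s
    using that e(2) D(2) by (simp add: B_def add_pos_nonneg)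
  have contg: "continuous_on {0..T} \<gamma>"
    by (rule continuous_at_imp_continuous_on) (use \<gamma> has_vector_derivative_continuous in fastforce)
  have "continuous_on {0..T} d" unfolding d_def using contg by (rule continuous_on_infdist)
  moreover have "continuous_on {0..T} B" unfolding B_def by (intro continuous_intros)
  ultimately have "closed C"
    unfolding C_def using continuous_on_closed_Collect_le[of "{0..T}" d B] by simp
  moreover have "C \<subseteq> {0..T}" by (auto simp: C_def)
  ultimately have "compact C" by (meson bounded_closed_interval bounded_subset compact_eq_bounded_closed)
  moreover have "0 \<in> C" using D \<open>0 \<le> T\<close> by (simp add: C_def d_def B_def)
  ultimately obtain t where t: "t \<in> C" "\<And>s. s \<in> C \<Longrightarrow> s \<le> t"
    using compact_attains_sup[of C] by blast
  have tT: "0 \<le> t" "t < T" and dt: "d t \<le> B t"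
    using t(1) neg unfolding C_def d_def B_def by (auto simp: less_le)
  obtain q where q: "q \<in> K" "infdist (\<gamma> t) K = dist (\<gamma> t) q"
    using infdist_attains_inf[OF K] by blast
  define f where "f s = (\<gamma> s - q) \<bullet> (\<gamma> s - q) - (B s)\<^sup>2" for s
  have ft: "f t = (d t)\<^sup>2 - (B t)\<^sup>2"
    by (simp add: f_def d_def q(2) dist_norm power2_norm_eq_inner)
  define B' where "B' = (L + 1) * B t + exp ((L + 1) * t) * e"
  have dB: "(B has_real_derivative B') (at t)"
    unfolding B_def B'_def by (auto intro!: derivative_eq_intros simp: algebra_simps)
  have dg: "((\<lambda>s. \<gamma> s - q) has_derivative (\<lambda>h. h *\<^sub>R \<gamma>' t)) (at t)"
    using \<gamma>[of t] tT unfolding has_vector_derivative_def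
    by (auto intro!: derivative_eq_intros)
  have "((\<lambda>s. (\<gamma> s - q) \<bullet> (\<gamma> s - q)) has_real_derivative 2 * ((\<gamma> t - q) \<bullet> \<gamma>' t)) (at t)"
    unfolding has_field_derivative_def
    by (rule has_derivative_eq_rhs[OF has_derivative_inner[OF dg dg]])
      (simp add: fun_eq_iff inner_commute)
  then have df: "(f has_real_derivative 2 * ((\<gamma> t - q) \<bullet> \<gamma>' t) - 2 * B t * B') (at t)"
    unfolding f_def using dB by (auto intro!: derivative_eq_intros)
  have "\<exists>h>0. \<forall>s. 0 < s \<and> s < h \<longrightarrow> f (t + s) < 0"
  proof (cases "d t = B t")
    case True
    have "(\<gamma> t - q) \<bullet> \<gamma>' t = (\<gamma> t - q) \<bullet> F (\<gamma> t) + (\<gamma> t - q) \<bullet> (\<gamma>' t - F (\<gamma> t))"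
      by (simp add: algebra_simps)
    also have "\<dots> \<le> L * (d t)\<^sup>2 + d t * e"
    proof (rule add_mono)
      show "(\<gamma> t - q) \<bullet> F (\<gamma> t) \<le> L * (d t)\<^sup>2"
        using H[OF U q(1)] q(2) tT by (simp add: d_def)
      have "(\<gamma> t - q) \<bullet> (\<gamma>' t - F (\<gamma> t)) \<le> norm (\<gamma> t - q) * norm (\<gamma>' t - F (\<gamma> t))"
        by (rule norm_cauchy_schwarz)
      also have "\<dots> \<le> norm (\<gamma> t - q) * e" using e(1) tT by (intro mult_left_mono) auto
      finally show "(\<gamma> t - q) \<bullet> (\<gamma>' t - F (\<gamma> t)) \<le> d t * e"
        by (simp add: d_def q(2) dist_norm)
    qed
    \<comment> \<open>The exponent \<open>L + 1\<close> in place of \<open>L\<close> provides the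
      slack \<open>B t\<close>, which makes the inequality strict.\<close>
    also have "\<dots> < B t * B'"
    proof -
      have "1 \<le> exp ((L + 1) * t)" using \<open>0 \<le> L\<close> tT by simp
      then have "e \<le> exp ((L + 1) * t) * e"
        using e(2) by simp
      then have "L * B t + e < B'"
        using Bpos[OF tT(1)] unfolding B'_def distrib_right by linarith
      then have "B t * (L * B t + e) < B t * B'"
        using Bpos[OF tT(1)] by simp
      then show ?thesis using True by (simp add: power2_eq_square algebra_simps)
    qed
    finally have "2 * ((\<gamma> t - q) \<bullet> \<gamma>' t) - 2 * B t * B' < 0" by simp
    from DERIV_neg_dec_right[OF df this] show ?thesis
      using ft True by fastforce
  next
    case False
    have "0 \<le> d t" by (simp add: d_def infdist_nonneg)
    then have "f t < 0" using False dt ft power_strict_mono[of "d t" "B t" 2] by simp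
    moreover have "isCont f t" using df by (rule DERIV_isCont)
    ultimately have "\<forall>\<^sub>F s in at t. f s < 0"
      using order_tendstoD(2) isCont_def by blast
    then obtain h where "h > 0" "\<And>s. s \<noteq> t \<Longrightarrow> dist s t < h \<Longrightarrow> f s < 0"
      by (auto simp: eventually_at)
    then show ?thesis by (intro exI[of _ h]) (auto simp: dist_norm)
  qed
  then obtain h where h: "h > 0" "\<And>s. 0 < s \<Longrightarrow> s < h \<Longrightarrow> f (t + s) < 0" by blast
  define s where "s = min (h / 2) (T - t)"
  have s: "0 < s" "s < h" "t + s \<le> T" using h(1) tT by (auto simp: s_def)
  have "(norm (\<gamma> (t + s) - q))\<^sup>2 < (B (t + s))\<^sup>2"
    using h(2)[OF s(1,2)] by (simp add: f_def power2_norm_eq_inner)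
  then have "dist (\<gamma> (t + s)) q < B (t + s)"
    using Bpos[of "t + s"] s tT by (simp add: dist_norm power2_less_imp_less)
  then have "d (t + s) \<le> B (t + s)"
    using infdist_le[OF q(1), of "\<gamma> (t + s)"] by (simp add: d_def)
  then have "t + s \<in> C" using s tT by (simp add: C_def)
  then show False using t(2)[of "t + s"] s by simp
qed

lemma smooth_on_locally_Lipschitz:
  fixes X :: "'e::euclidean_space \<Rightarrow> 'c::real_normed_vector"
  assumes "open S" "smooth_on S X" "x \<in> S"
  obtains \<rho> L where "0 < \<rho>" "0 \<le> L" "cball x \<rho> \<subseteq> S"
    "\<And>y z. y \<in> cball x \<rho> \<Longrightarrow> z \<in> cball x \<rho> \<Longrightarrow> norm (X y - X z) \<le> L * norm (y - z)"
proof -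
  obtain \<rho> where \<rho>: "0 < \<rho>" "cball x \<rho> \<subseteq> S"
    using assms(1,3) open_contains_cball by blast
  have "\<exists>M. \<forall>z\<in>cball x \<rho>. norm (FD X z b) \<le> M" for b
  proof -
    have "continuous_on (cball x \<rho>) (\<lambda>z. FD X z b)"
      using smooth_on_continuous[OF smooth_on_frechet_derivative[OF assms(2)]] \<rho>(2)
      by (rule continuous_on_subset)
    then have "bounded ((\<lambda>z. FD X z b) ` cball x \<rho>)"
      using compact_continuous_image compact_imp_bounded compact_cball by blast
    then show ?thesis by (auto simp: bounded_iff)
  qed
  then obtain M where M: "\<And>b z. z \<in> cball x \<rho> \<Longrightarrow> norm (FD X z b) \<le> M b"
    by metis
  have M0: "0 \<le> M b" for b using M[of x b] \<rho>(1) norm_ge_zero order_trans by (metis centre_in_cball less_imp_le)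
  define L where "L = (\<Sum>b\<in>Basis. M b)"
  have on: "onorm (FD X z) \<le> L" if z: "z \<in> cball x \<rho>" for z
  proof (rule onorm_le)
    fix v :: 'e
    have "norm (FD X z v) \<le>
      (\<Sum>b\<in>Basis. norm ((v \<bullet> b) *\<^sub>R FD X z b))"
      using smooth_on_differentiable[OF assms(2), of z] z \<rho>(2)
      by (subst frechet_derivative_Basis_expand) (blast, rule norm_sum)
    also have "\<dots> \<le> (\<Sum>b\<in>Basis. M b * norm v)"
      by (rule sum_mono)
        (auto simp: mult.commute[of "M _"] intro!: mult_mono M[OF z] Basis_le_norm)
    finally show "norm (FD X z v) \<le> L * norm v"
      by (simp add: L_def sum_distrib_right)
  qed
  have "norm (X y - X z) \<le> L * norm (y - z)" if "y \<in> cball x \<rho>" "z \<in> cball x \<rho>" for y z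
  proof (rule differentiable_bound[of "cball x \<rho>" X "\<lambda>z. FD X z"])
    fix z assume "z \<in> cball x \<rho>"
    then show "(X has_derivative FD X z) (at z within cball x \<rho>)"
      using smooth_on_has_derivative[OF assms(2)] \<rho>(2) has_derivative_at_withinI by blast
  qed (use on that in auto)
  moreover have "0 \<le> L" using M0 by (simp add: L_def sum_nonneg)
  ultimately show thesis using that \<rho> by blast
qed

text \<open>Expanding the two squared distances to \<open>y\<close> gives the quadratic bound with
  constant 1/2. Minimality is demanded only near \<open>q\<close>, so that \<open>Z\<close> may be
  truncated by a ball before the nearest point is chosen.\<close>

lemma proximal_normal_nearest:
  assumes near: "\<And>z. z \<in> Z \<Longrightarrow> dist z q < r \<Longrightarrow> dist y q \<le> dist y z" and "0 < r"
  shows "proximal_normal Z q (y - q)"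
  unfolding proximal_normal_def
proof (intro exI conjI ballI impI)
  show "0 < r" by fact
  fix z assume "z \<in> Z" "dist z q < r"
  then have "(norm (y - q))\<^sup>2 \<le> (norm (y - z))\<^sup>2"
    using near by (simp add: dist_norm power_mono)
  moreover have "(norm (y - z))\<^sup>2 = (norm (y - q))\<^sup>2 - 2 * ((y - q) \<bullet> (z - q)) + (norm (z - q))\<^sup>2"
    by (simp add: power2_norm_eq_inner algebra_simps inner_commute)
  ultimately show "(y - q) \<bullet> (z - q) \<le> 1 / 2 * (dist z q)\<^sup>2"
    by (simp add: dist_norm)
qed

section \<open>Brackets of tangent fields through commutator quadrilaterals\<close>

text \<open>The six vectors will be \<open>X x\<close>, \<open>Y x\<close> and their images under
  the derivatives of \<open>X\<close> and \<open>Y\<close>. One estimate then serves all four legs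
  of the quadrilateral.\<close>

lemma linear_combination_bound:
  fixes a :: "'e::real_normed_vector"
  assumes "\<bar>c1\<bar> \<le> C" "\<bar>c2\<bar> \<le> C" "\<bar>c3\<bar> \<le> C" "\<bar>c4\<bar> \<le> C" "\<bar>c5\<bar> \<le> C" "\<bar>c6\<bar> \<le> C"
  shows "norm (c1 *\<^sub>R a + c2 *\<^sub>R b + c3 *\<^sub>R c + c4 *\<^sub>R d + c5 *\<^sub>R e + c6 *\<^sub>R f) \<le>
    C * (norm a + norm b + norm c + norm d + norm e + norm f)"
proof -
  have *: "norm (k *\<^sub>R v) \<le> C * norm v" if "\<bar>k\<bar> \<le> C" for k and v :: 'e
    using that by (simp add: mult_right_mono)
  have "norm (c1 *\<^sub>R a + c2 *\<^sub>R b + c3 *\<^sub>R c + c4 *\<^sub>R d + c5 *\<^sub>R e + c6 *\<^sub>R f) \<le>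
    norm (c1 *\<^sub>R a) + norm (c2 *\<^sub>R b) + norm (c3 *\<^sub>R c) + norm (c4 *\<^sub>R d) + norm (c5 *\<^sub>R e)
      + norm (c6 *\<^sub>R f)"
    by (intro norm_triangle_mono order_refl)
  also have "\<dots> \<le> C * norm a + C * norm b + C * norm c + C * norm d + C * norm e + C * norm f"
    by (intro add_mono * assms)
  finally show ?thesis by (simp add: algebra_simps)
qed

text \<open>The four legs of the commutator quadrilateral need not be exact integral curves: leaving \<open>Z\<close>
  by \<open>o(T\<^sup>2)\<close> is harmless, so no flows are needed.\<close>

lemma bracket_reach:
  fixes X Y :: "'e::euclidean_space \<Rightarrow> 'e"
  assumes "open S" "closedin (top_of_set S) Z" "smooth_on S X" "smooth_on S Y"
    and tan: "tangent_field Z X" "tangent_field Z Y" and "x \<in> Z" and "0 < \<kappa>"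
  defines "V \<equiv> FD Y x (X x) - FD X x (Y x)"
  obtains T0 where "0 < T0"
    "\<And>T. 0 < T \<Longrightarrow> T \<le> T0 \<Longrightarrow> \<exists>k\<in>Z. dist k (x + T\<^sup>2 *\<^sub>R V) \<le> \<kappa> * T\<^sup>2"
proof -
  have "Z \<subseteq> S" "x \<in> S" using assms(2,7) closedin_imp_subset by blast+
  obtain \<rho>1 L1 where 1: "0 < \<rho>1" "0 \<le> L1" "cball x \<rho>1 \<subseteq> S"
    "\<And>y z. y \<in> cball x \<rho>1 \<Longrightarrow> z \<in> cball x \<rho>1 \<Longrightarrow> norm (X y - X z) \<le> L1 * norm (y - z)"
    using smooth_on_locally_Lipschitz[OF assms(1,3) \<open>x \<in> S\<close>] by metis
  obtain \<rho>2 L2 where 2: "0 < \<rho>2" "0 \<le> L2" "cball x \<rho>2 \<subseteq> S"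
    "\<And>y z. y \<in> cball x \<rho>2 \<Longrightarrow> z \<in> cball x \<rho>2 \<Longrightarrow> norm (Y y - Y z) \<le> L2 * norm (y - z)"
    using smooth_on_locally_Lipschitz[OF assms(1,4) \<open>x \<in> S\<close>] by metis
  define \<rho> where "\<rho> = min \<rho>1 \<rho>2"
  define L where "L = max L1 L2"
  have \<rho>: "0 < \<rho>" "cball x \<rho> \<subseteq> S" and L: "0 \<le> L" using 1 2 by (auto simp: \<rho>_def L_def)
  have Lip: "norm (X y - X z) \<le> L * norm (y - z)" "norm (Y y - Y z) \<le> L * norm (y - z)"
    if "y \<in> cball x \<rho>" "z \<in> cball x \<rho>" for y z
  proof -
    have "norm (X y - X z) \<le> L1 * norm (y - z)" "norm (Y y - Y z) \<le> L2 * norm (y - z)"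
      using 1(4) 2(4) that by (auto simp: \<rho>_def)
    moreover have "L1 * norm (y - z) \<le> L * norm (y - z)" "L2 * norm (y - z) \<le> L * norm (y - z)"
      by (auto simp: L_def intro!: mult_right_mono)
    ultimately show "norm (X y - X z) \<le> L * norm (y - z)" "norm (Y y - Y z) \<le> L * norm (y - z)"
      by linarith+
  qed
  \<comment> \<open>\<open>Z\<close> is closed only relative to \<open>S\<close>; the truncation is
    closed, hence has nearest points. Starting from \<open>U\<close>, of half the radius, the
    nearest point is interior to the ball because \<open>x\<close> itself lies in \<open>K\<close>,
    so truncation creates no spurious normals there.\<close>
  define K where "K = Z \<inter> cball x \<rho>"
  define U where "U = ball x (\<rho> / 2)"
  obtain C where C: "closed C" "Z = S \<inter> C"
    using assms(2) by (auto simp: closedin_closed)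
  have "K = C \<inter> cball x \<rho>" using C \<rho>(2) by (auto simp: K_def)
  then have "closed K" using C(1) by (simp add: closed_Int)
  moreover have "x \<in> K" using \<open>x \<in> Z\<close> \<rho>(1) by (simp add: K_def)
  ultimately have K: "closed K" "K \<noteq> {}" "x \<in> K" by auto
  have H: "\<bar>(y - q) \<bullet> F y\<bar> \<le> L * (dist y q)\<^sup>2"
    if "tangent_field Z F" "\<And>y z. y \<in> cball x \<rho> \<Longrightarrow> z \<in> cball x \<rho> \<Longrightarrow> norm (F y - F z) \<le> L * norm (y - z)"
      "y \<in> U" "q \<in> K" "infdist y K = dist y q" for F y q
  proof -
    have "dist y q \<le> dist y x" using that(5) infdist_le[OF K(3), of y] by simp
    then have qx: "dist q x < \<rho>" using that(3) unfolding U_def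
      by (metis dist_commute dist_triangle_half_r mem_ball order_le_less_trans)
    have "proximal_normal Z q (y - q)"
    proof (rule proximal_normal_nearest)
      show "0 < \<rho> - dist q x" using qx by simp
      fix z assume "z \<in> Z" "dist z q < \<rho> - dist q x"
      then have "z \<in> K" using dist_triangle[of z x q] by (simp add: K_def dist_commute)
      then show "dist y q \<le> dist y z" using infdist_le[of z K y] that(5) by simp
    qed
    then have "(y - q) \<bullet> F q = 0"
      using that(1,4) by (auto simp: tangent_field_def K_def)
    then have "(y - q) \<bullet> F y = (y - q) \<bullet> (F y - F q)" by (simp add: inner_diff_right)
    then have "\<bar>(y - q) \<bullet> F y\<bar> \<le> norm (y - q) * norm (F y - F q)"
      by (simp add: Cauchy_Schwarz_ineq2)
    also have "\<dots> \<le> norm (y - q) * (L * norm (y - q))"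
      using that(2)[of y q] that(3,4) \<rho>(1) by (intro mult_left_mono) (auto simp: U_def K_def)
    finally show ?thesis by (simp add: dist_norm power2_eq_square algebra_simps)
  qed
  define DX where "DX = FD X x"
  define DY where "DY = FD Y x"
  have dX: "(X has_derivative DX) (at x)" and dY: "(Y has_derivative DY) (at x)"
    unfolding DX_def DY_def using smooth_on_has_derivative \<open>x \<in> S\<close> assms(3,4) by blast+
  have blX: "bounded_linear DX" and blY: "bounded_linear DY"
    using dX dY has_derivative_bounded_linear by blast+
  obtain B1 where B1: "\<And>v. norm (DX v) \<le> norm v * B1" "B1 \<ge> 0"
    using bounded_linear.nonneg_bounded[OF blX] by blast
  obtain B2 where B2: "\<And>v. norm (DY v) \<le> norm v * B2" "B2 \<ge> 0"
    using bounded_linear.nonneg_bounded[OF blY] by blast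
  define B where "B = max B1 B2"
  have B: "norm (DX v) \<le> B * norm v" "norm (DY v) \<le> B * norm v" "0 \<le> B" for v
  proof -
    have "norm v * B1 \<le> B * norm v" "norm v * B2 \<le> B * norm v"
      by (auto simp: B_def mult.commute[of "norm v"] intro!: mult_right_mono)
    then show "norm (DX v) \<le> B * norm v" "norm (DY v) \<le> B * norm v"
      using B1(1)[of v] B2(1)[of v] by linarith+
    show "0 \<le> B" using B1(2) by (simp add: B_def)
  qed
  interpret DX: bounded_linear DX by (rule blX)
  interpret DY: bounded_linear DY by (rule blY)
  define a b where "a = X x" and "b = Y x"
  define xa xb ya yb where "xa = DX a" and "xb = DX b" and "ya = DY a" and "yb = DY b"
  have V: "V = ya - xb" by (simp add: V_def ya_def xb_def a_def b_def DX_def DY_def)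
  define N where "N = norm a + norm b + norm xa + norm xb + norm ya + norm yb"
  have N: "0 \<le> N" by (simp add: N_def)
  define E where "E = exp (L + 1)"
  have E1: "1 \<le> E" using L by (simp add: E_def)
  \<comment> \<open>The four legs accumulate at most \<open>5 * E ^ 4 * (T * e)\<close> with
    \<open>e = 4 * \<epsilon> * T * (N + 1)\<close>, that is
    \<open>20 * E ^ 4 * (N + 1) * \<epsilon> * T\<^sup>2\<close>. The factor 30 leaves room below
    \<open>\<kappa> * T\<^sup>2\<close>.\<close>
  define \<epsilon> where "\<epsilon> = \<kappa> / (30 * E ^ 4 * (N + 1))"
  have \<epsilon>: "0 < \<epsilon>" using \<open>0 < \<kappa>\<close> N E1 by (simp add: \<epsilon>_def)
  obtain \<delta>1 where \<delta>1: "0 < \<delta>1"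
    "\<And>y. norm (y - x) < \<delta>1 \<Longrightarrow> norm (X y - a - DX (y - x)) \<le> \<epsilon> * norm (y - x)"
    using dX \<epsilon> unfolding has_derivative_at_alt a_def by blast
  obtain \<delta>2 where \<delta>2: "0 < \<delta>2"
    "\<And>y. norm (y - x) < \<delta>2 \<Longrightarrow> norm (Y y - b - DY (y - x)) \<le> \<epsilon> * norm (y - x)"
    using dY \<epsilon> unfolding has_derivative_at_alt b_def by blast
  \<comment> \<open>The bound 1 controls the exponential factors, the second bound gives
    \<open>T * B \<le> \<epsilon>\<close> and absorbs the second order terms, and the third keeps
    all curves inside \<open>U\<close> and inside the ranges where the linearisations of
    \<open>X\<close> and \<open>Y\<close> hold.\<close>
  define T0 where "T0 = min 1 (min (\<epsilon> / (B + 1)) (min (\<rho> / 2) (min \<delta>1 \<delta>2) / (2 * N + 1)))"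
  have T0: "0 < T0" using \<epsilon> B(3) \<rho>(1) \<delta>1(1) \<delta>2(1) N
    by (simp add: T0_def add_nonneg_pos)
  have "\<exists>k\<in>Z. dist k (x + T\<^sup>2 *\<^sub>R V) \<le> \<kappa> * T\<^sup>2" if T: "0 < T" "T \<le> T0" for T
  proof -
    have T1: "T \<le> 1" and TB: "T * B \<le> \<epsilon>" and TN: "2 * T * N < \<rho> / 2" "2 * T * N < \<delta>1" "2 * T * N < \<delta>2"
    proof -
      show "T \<le> 1" using T by (simp add: T0_def)
      have "T \<le> \<epsilon> / (B + 1)" using T by (simp add: T0_def)
      then have "T * (B + 1) \<le> \<epsilon>" using B(3) by (simp add: pos_le_divide_eq)
      then show "T * B \<le> \<epsilon>" using T by (simp add: algebra_simps)
      have "T \<le> min (\<rho> / 2) (min \<delta>1 \<delta>2) / (2 * N + 1)" using T by (simp add: T0_def)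
      then have "T * (2 * N + 1) \<le> min (\<rho> / 2) (min \<delta>1 \<delta>2)" using N by (simp add: pos_le_divide_eq)
      moreover have "2 * T * N < T * (2 * N + 1)" using T by (simp add: algebra_simps)
      ultimately show "2 * T * N < \<rho> / 2" "2 * T * N < \<delta>1" "2 * T * N < \<delta>2" by linarith+
    qed
    define e where "e = 4 * \<epsilon> * T * (N + 1)"
    have e: "0 < e" using \<epsilon> T N by (simp add: e_def)
    have sq: "0 \<le> s\<^sup>2" "s\<^sup>2 \<le> T\<^sup>2" "0 \<le> s * T" "s * T \<le> T\<^sup>2" "T\<^sup>2 \<le> T" if "0 \<le> s" "s \<le> T" for s
      using that T T1 by (auto simp: power2_eq_square mult_mono mult_left_le)
    \<comment> \<open>The velocity of \<open>w\<close> is the linearisation of \<open>F\<close>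
      evaluated at the first order part of \<open>w\<close> alone. Its deviation from
      \<open>F\<close> consists of the linearisation error, at most
      \<open>\<epsilon> * norm (w s)\<close>, and of \<open>DF\<close> applied to the second order
      part, which is of size \<open>T\<^sup>2\<close>.\<close>
    have leg: "infdist (x + w T) K \<le> E * (D + T * e)"
      if HF: "\<And>y q. y \<in> U \<Longrightarrow> q \<in> K \<Longrightarrow> infdist y K = dist y q \<Longrightarrow>
          \<bar>(y - q) \<bullet> F y\<bar> \<le> L * (dist y q)\<^sup>2"
        and F: "\<And>y. norm (y - x) < \<delta>1 \<Longrightarrow> norm (y - x) < \<delta>2 \<Longrightarrow>
          norm (F y - F0 - DF (y - x)) \<le> \<epsilon> * norm (y - x)"
        and DF: "linear DF" "\<And>v. norm (DF v) \<le> B * norm v"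
        and dw: "\<And>s. (w has_vector_derivative F0 + DF (c1 s *\<^sub>R a + c2 s *\<^sub>R b)) (at s)"
        and w: "\<And>s. w s = (c1 s *\<^sub>R a + c2 s *\<^sub>R b) +
          (c3 s *\<^sub>R xa + c4 s *\<^sub>R xb + c5 s *\<^sub>R ya + c6 s *\<^sub>R yb)"
        and c: "\<And>s. 0 \<le> s \<Longrightarrow> s \<le> T \<Longrightarrow> \<bar>c1 s\<bar> \<le> T \<and> \<bar>c2 s\<bar> \<le> T \<and>
          \<bar>c3 s\<bar> \<le> T\<^sup>2 \<and> \<bar>c4 s\<bar> \<le> T\<^sup>2 \<and> \<bar>c5 s\<bar> \<le> T\<^sup>2 \<and> \<bar>c6 s\<bar> \<le> T\<^sup>2"
        and D: "infdist (x + w 0) K \<le> D" "0 < D"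
      for F F0 DF w c1 c2 c3 c4 c5 c6 D
    proof -
      have wn: "norm (w s) \<le> 2 * T * N" if s: "0 \<le> s" "s \<le> T" for s
        using linear_combination_bound[of "c1 s" "2 * T" "c2 s" "c3 s" "c4 s" "c5 s" "c6 s" a b xa xb ya yb]
          c[OF s] sq[OF s] T(1) unfolding w N_def by (auto simp: add.assoc)
      have we: "norm (F0 + DF (c1 s *\<^sub>R a + c2 s *\<^sub>R b) - F (x + w s)) \<le> e" if s: "0 \<le> s" "s \<le> T" for s
      proof -
        define r where "r = c3 s *\<^sub>R xa + c4 s *\<^sub>R xb + c5 s *\<^sub>R ya + c6 s *\<^sub>R yb"
        have "norm r \<le> T\<^sup>2 * N"
          using linear_combination_bound[of 0 "T\<^sup>2" 0 "c3 s" "c4 s" "c5 s" "c6 s" a b xa xb ya yb] c[OF s]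
          unfolding r_def N_def by simp
        then have "norm (DF r) \<le> B * (T\<^sup>2 * N)"
          using DF(2)[of r] B(3) by (meson mult_left_mono order_trans)
        also have "\<dots> = T * N * (T * B)" by (simp add: power2_eq_square)
        also have "\<dots> \<le> T * N * \<epsilon>" using TB T N by (intro mult_left_mono) auto
        finally have 1: "norm (DF r) \<le> T * N * \<epsilon>" .
        have "norm (F (x + w s) - F0 - DF (w s)) \<le> \<epsilon> * norm (w s)"
          using F[of "x + w s"] wn[OF s] TN by simp
        also have "\<dots> \<le> \<epsilon> * (2 * T * N)" using wn[OF s] \<epsilon> by (intro mult_left_mono) auto
        finally have 2: "norm (F (x + w s) - F0 - DF (w s)) \<le> \<epsilon> * (2 * T * N)" .
        have "DF (w s) = DF (c1 s *\<^sub>R a + c2 s *\<^sub>R b) + DF r"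
          unfolding w r_def by (rule linear_add[OF DF(1)])
        then have "F0 + DF (c1 s *\<^sub>R a + c2 s *\<^sub>R b) - F (x + w s) = - (F (x + w s) - F0 - DF (w s)) - DF r"
          by simp
        then have "norm (F0 + DF (c1 s *\<^sub>R a + c2 s *\<^sub>R b) - F (x + w s)) \<le>
            norm (F (x + w s) - F0 - DF (w s)) + norm (DF r)"
          by (metis norm_minus_cancel norm_triangle_ineq4)
        also have "\<dots> \<le> 3 * \<epsilon> * T * N" using 1 2 by (simp add: algebra_simps)
        also have "\<dots> \<le> e" using \<epsilon> T N by (simp add: e_def algebra_simps)
        finally show ?thesis .
      qed
      have "infdist (x + w T) K \<le> exp ((L + 1) * T) * (D + T * e)"
      proof (rule infdist_curve_bound[where F = F and L = L and U = U
            and \<gamma>' = "\<lambda>s. F0 + DF (c1 s *\<^sub>R a + c2 s *\<^sub>R b)"])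
        show "(y - q) \<bullet> F y \<le> L * (dist y q)\<^sup>2"
          if "y \<in> U" "q \<in> K" "infdist y K = dist y q" for y q
          using HF[OF that] by linarith
        show "((\<lambda>s. x + w s) has_vector_derivative F0 + DF (c1 s *\<^sub>R a + c2 s *\<^sub>R b)) (at s)" for s
          using dw[of s] has_vector_derivative_add[OF has_vector_derivative_const] by fastforce
        show "x + w s \<in> U" if "0 \<le> s" "s \<le> T" for s
          using wn[OF that] TN by (simp add: U_def dist_norm)
      qed (use K we D L T e in auto)
      also have "\<dots> \<le> E * (D + T * e)"
      proof (rule mult_right_mono)
        show "exp ((L + 1) * T) \<le> E" using T1 L T by (simp add: E_def mult_left_le)
        show "0 \<le> D + T * e" using D(2) T(1) e by simp
      qed
      finally show ?thesis .
    qed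
    have HX: "\<bar>(y - q) \<bullet> X y\<bar> \<le> L * (dist y q)\<^sup>2" "\<bar>(y - q) \<bullet> - X y\<bar> \<le> L * (dist y q)\<^sup>2"
      "\<bar>(y - q) \<bullet> Y y\<bar> \<le> L * (dist y q)\<^sup>2" "\<bar>(y - q) \<bullet> - Y y\<bar> \<le> L * (dist y q)\<^sup>2"
      if "y \<in> U" "q \<in> K" "infdist y K = dist y q" for y q
      using H[OF tan(1) Lip(1) that] H[OF tan(2) Lip(2) that] by simp_all
    text \<open>Second order Taylor polynomials of the flows of \<open>X\<close>, \<open>Y\<close>, \<open>-X\<close>, \<open>-Y\<close>, each started at the
      end point of the previous one; the last one ends at \<open>x + T\<^sup>2 V\<close>.\<close>
    define w1 where "w1 s = s *\<^sub>R a + (s\<^sup>2 / 2) *\<^sub>R xa" for s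
    define w2 where "w2 s = T *\<^sub>R a + s *\<^sub>R b + (T\<^sup>2 / 2) *\<^sub>R xa + (s * T) *\<^sub>R ya + (s\<^sup>2 / 2) *\<^sub>R yb" for s
    define w3 where "w3 s = (T - s) *\<^sub>R a + T *\<^sub>R b + (T\<^sup>2 / 2 - s * T + s\<^sup>2 / 2) *\<^sub>R xa
      + (- (s * T)) *\<^sub>R xb + T\<^sup>2 *\<^sub>R ya + (T\<^sup>2 / 2) *\<^sub>R yb" for s
    define w4 where "w4 s = (T - s) *\<^sub>R b + (- T\<^sup>2) *\<^sub>R xb + T\<^sup>2 *\<^sub>R ya
      + (T\<^sup>2 / 2 - s * T + s\<^sup>2 / 2) *\<^sub>R yb" for s
    note defs = has_vector_derivative_def w1_def w2_def w3_def w4_def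
    have lDX: "DX (k *\<^sub>R a + m *\<^sub>R b) = k *\<^sub>R xa + m *\<^sub>R xb"
      and lDY: "DY (k *\<^sub>R a + m *\<^sub>R b) = k *\<^sub>R ya + m *\<^sub>R yb" for k m
      by (simp_all add: DX.add DX.scaleR DY.add DY.scaleR xa_def xb_def ya_def yb_def)
    have expX: "norm (X y - a - DX (y - x)) \<le> \<epsilon> * norm (y - x)"
      "norm (- X y - (- a) - (- DX (y - x))) \<le> \<epsilon> * norm (y - x)"
      and expY: "norm (Y y - b - DY (y - x)) \<le> \<epsilon> * norm (y - x)"
      "norm (- Y y - (- b) - (- DY (y - x))) \<le> \<epsilon> * norm (y - x)"
      if "norm (y - x) < \<delta>1" "norm (y - x) < \<delta>2" for y
      using \<delta>1(2)[OF that(1)] \<delta>2(2)[OF that(2)]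
        norm_minus_cancel[of "X y - a - DX (y - x)"] norm_minus_cancel[of "Y y - b - DY (y - x)"]
      by (simp_all add: algebra_simps)
    have lin: "linear DX" "linear DY" "linear (\<lambda>v. - DX v)" "linear (\<lambda>v. - DY v)"
      using DX.linear DY.linear linear_compose_neg by blast+
    have B': "norm (- DX v) \<le> B * norm v" "norm (- DY v) \<le> B * norm v" for v
      using B by simp_all
    have bnd: "\<bar>s\<bar> \<le> T" "\<bar>T - s\<bar> \<le> T" "\<bar>s\<^sup>2 / 2\<bar> \<le> T\<^sup>2" "\<bar>s * T\<bar> \<le> T\<^sup>2" "\<bar>- (s * T)\<bar> \<le> T\<^sup>2"
      "\<bar>T\<^sup>2 / 2\<bar> \<le> T\<^sup>2" "\<bar>T\<^sup>2 / 2 - s * T + s\<^sup>2 / 2\<bar> \<le> T\<^sup>2"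
      if "0 \<le> s" "s \<le> T" for s
      using sq[OF that] that T by linarith+
    \<comment> \<open>The start \<open>x\<close> lies in \<open>K\<close>, but the distance bound of
      \<open>leg\<close> has to be positive; \<open>T * e\<close> is of the order of the error of a
      single leg.\<close>
    have leg1: "infdist (x + w1 T) K \<le> E * (T * e + T * e)"
    proof (rule leg[of X a DX w1 "\<lambda>s. s" "\<lambda>s. 0" "\<lambda>s. s\<^sup>2 / 2" "\<lambda>s. 0" "\<lambda>s. 0" "\<lambda>s. 0", OF HX(1) expX(1) lin(1) B(1)])
      show "(w1 has_vector_derivative a + DX (s *\<^sub>R a + 0 *\<^sub>R b)) (at s)" for s
        unfolding lDX defs by (auto intro!: derivative_eq_intros simp: algebra_simps)
      show "w1 s = s *\<^sub>R a + 0 *\<^sub>R b + ((s\<^sup>2 / 2) *\<^sub>R xa + 0 *\<^sub>R xb + 0 *\<^sub>R ya + 0 *\<^sub>R yb)" for s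
        by (simp add: w1_def)
      show "\<bar>s\<bar> \<le> T \<and> \<bar>0\<bar> \<le> T \<and> \<bar>s\<^sup>2 / 2\<bar> \<le> T\<^sup>2 \<and> \<bar>0\<bar> \<le> T\<^sup>2 \<and> \<bar>0\<bar> \<le> T\<^sup>2 \<and> \<bar>0\<bar> \<le> T\<^sup>2"
        if "0 \<le> s" "s \<le> T" for s
        using bnd[OF that] T(1) by simp
      show "infdist (x + w1 0) K \<le> T * e"
        using T e K(3) by (simp add: w1_def)
      show "0 < T * e" using T(1) e E1 by (intro add_pos_pos mult_pos_pos) auto
    qed
    have leg2: "infdist (x + w2 T) K \<le> E * (E * (T * e + T * e) + T * e)"
    proof (rule leg[of Y b DY w2 "\<lambda>s. T" "\<lambda>s. s" "\<lambda>s. T\<^sup>2 / 2" "\<lambda>s. 0" "\<lambda>s. s * T" "\<lambda>s. s\<^sup>2 / 2", OF HX(3) expY(1) lin(2) B(2)])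
      show "(w2 has_vector_derivative b + DY (T *\<^sub>R a + s *\<^sub>R b)) (at s)" for s
        unfolding lDY defs by (auto intro!: derivative_eq_intros simp: algebra_simps)
      show "w2 s = T *\<^sub>R a + s *\<^sub>R b + ((T\<^sup>2 / 2) *\<^sub>R xa + 0 *\<^sub>R xb + (s * T) *\<^sub>R ya + (s\<^sup>2 / 2) *\<^sub>R yb)" for s
        by (simp add: w2_def)
      show "\<bar>T\<bar> \<le> T \<and> \<bar>s\<bar> \<le> T \<and> \<bar>T\<^sup>2 / 2\<bar> \<le> T\<^sup>2 \<and> \<bar>0\<bar> \<le> T\<^sup>2 \<and> \<bar>s * T\<bar> \<le> T\<^sup>2 \<and> \<bar>s\<^sup>2 / 2\<bar> \<le> T\<^sup>2"
        if "0 \<le> s" "s \<le> T" for s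
        using bnd[OF that] T(1) by simp
      show "infdist (x + w2 0) K \<le> E * (T * e + T * e)"
        using leg1 by (simp add: w1_def w2_def)
      show "0 < E * (T * e + T * e)" using T(1) e E1 by (intro add_pos_pos mult_pos_pos) auto
    qed
    have leg3: "infdist (x + w3 T) K \<le> E * (E * (E * (T * e + T * e) + T * e) + T * e)"
    proof (rule leg[of "\<lambda>z. - X z" "- a" "\<lambda>v. - DX v" w3 "\<lambda>s. T - s" "\<lambda>s. T" "\<lambda>s. T\<^sup>2 / 2 - s * T + s\<^sup>2 / 2" "\<lambda>s. - (s * T)" "\<lambda>s. T\<^sup>2" "\<lambda>s. T\<^sup>2 / 2", OF HX(2) expX(2) lin(3) B'(1)])
      show "(w3 has_vector_derivative - a + - DX ((T - s) *\<^sub>R a + T *\<^sub>R b)) (at s)" for s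
        unfolding lDX defs by (auto intro!: derivative_eq_intros simp: algebra_simps)
      show "w3 s = (T - s) *\<^sub>R a + T *\<^sub>R b + ((T\<^sup>2 / 2 - s * T + s\<^sup>2 / 2) *\<^sub>R xa + (- (s * T)) *\<^sub>R xb + T\<^sup>2 *\<^sub>R ya + (T\<^sup>2 / 2) *\<^sub>R yb)" for s
        by (simp add: w3_def)
      show "\<bar>T - s\<bar> \<le> T \<and> \<bar>T\<bar> \<le> T \<and> \<bar>T\<^sup>2 / 2 - s * T + s\<^sup>2 / 2\<bar> \<le> T\<^sup>2 \<and> \<bar>- (s * T)\<bar> \<le> T\<^sup>2 \<and> \<bar>T\<^sup>2\<bar> \<le> T\<^sup>2 \<and> \<bar>T\<^sup>2 / 2\<bar> \<le> T\<^sup>2"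
        if "0 \<le> s" "s \<le> T" for s
        using bnd[OF that] T(1) by simp
      show "infdist (x + w3 0) K \<le> E * (E * (T * e + T * e) + T * e)"
        using leg2 by (simp add: w2_def w3_def power2_eq_square)
      show "0 < E * (E * (T * e + T * e) + T * e)" using T(1) e E1 by (intro add_pos_pos mult_pos_pos) auto
    qed
    have leg4: "infdist (x + w4 T) K \<le> E * (E * (E * (E * (T * e + T * e) + T * e) + T * e) + T * e)"
    proof (rule leg[of "\<lambda>z. - Y z" "- b" "\<lambda>v. - DY v" w4 "\<lambda>s. 0" "\<lambda>s. T - s" "\<lambda>s. 0" "\<lambda>s. - T\<^sup>2" "\<lambda>s. T\<^sup>2" "\<lambda>s. T\<^sup>2 / 2 - s * T + s\<^sup>2 / 2", OF HX(4) expY(2) lin(4) B'(2)])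
      show "(w4 has_vector_derivative - b + - DY (0 *\<^sub>R a + (T - s) *\<^sub>R b)) (at s)" for s
        unfolding lDY defs by (auto intro!: derivative_eq_intros simp: algebra_simps)
      show "w4 s = 0 *\<^sub>R a + (T - s) *\<^sub>R b + (0 *\<^sub>R xa + (- T\<^sup>2) *\<^sub>R xb + T\<^sup>2 *\<^sub>R ya + (T\<^sup>2 / 2 - s * T + s\<^sup>2 / 2) *\<^sub>R yb)" for s
        by (simp add: w4_def)
      show "\<bar>0\<bar> \<le> T \<and> \<bar>T - s\<bar> \<le> T \<and> \<bar>0\<bar> \<le> T\<^sup>2 \<and> \<bar>- T\<^sup>2\<bar> \<le> T\<^sup>2 \<and> \<bar>T\<^sup>2\<bar> \<le> T\<^sup>2 \<and> \<bar>T\<^sup>2 / 2 - s * T + s\<^sup>2 / 2\<bar> \<le> T\<^sup>2"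
        if "0 \<le> s" "s \<le> T" for s
        using bnd[OF that] T(1) by simp
      show "infdist (x + w4 0) K \<le> E * (E * (E * (T * e + T * e) + T * e) + T * e)"
        using leg3 by (simp add: w3_def w4_def power2_eq_square)
      show "0 < E * (E * (E * (T * e + T * e) + T * e) + T * e)" using T(1) e E1 by (intro add_pos_pos mult_pos_pos) auto
    qed
    have "w4 T = T\<^sup>2 *\<^sub>R V"
      by (simp add: w4_def V power2_eq_square algebra_simps)
    obtain k where k: "k \<in> K" "infdist (x + w4 T) K = dist (x + w4 T) k"
      using infdist_attains_inf[OF K(1,2)] by blast
    have pw: "E \<le> E ^ 4" "E\<^sup>2 \<le> E ^ 4" "E ^ 3 \<le> E ^ 4"
      using E1 power_increasing[of 1 4 E] power_increasing[of 2 4 E] power_increasing[of 3 4 E] by auto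
    have "E * (E * (E * (E * (T * e + T * e) + T * e) + T * e) + T * e) =
      (2 * E ^ 4 + E ^ 3 + E\<^sup>2 + E) * (T * e)"
      by (simp add: algebra_simps power2_eq_square eval_nat_numeral)
    also have "\<dots> \<le> (5 * E ^ 4) * (T * e)"
      using pw T e by (intro mult_right_mono) auto
    also have "\<dots> = 20 / 30 * (\<epsilon> * (30 * E ^ 4 * (N + 1))) * T\<^sup>2"
      by (simp add: e_def power2_eq_square algebra_simps)
    also have "\<epsilon> * (30 * E ^ 4 * (N + 1)) = \<kappa>"
      using N E1 by (simp add: \<epsilon>_def)
    also have "20 / 30 * \<kappa> * T\<^sup>2 \<le> \<kappa> * T\<^sup>2" using \<open>0 < \<kappa>\<close> by (simp add: mult_right_mono)
    finally have "dist k (x + T\<^sup>2 *\<^sub>R V) \<le> \<kappa> * T\<^sup>2"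
      using leg4 k(2) \<open>w4 T = T\<^sup>2 *\<^sub>R V\<close> by (simp add: dist_commute)
    then show ?thesis using k(1) by (auto simp: K_def)
  qed
  with T0 that show thesis by blast
qed

lemma divide_twice_mult_cancel: "m \<noteq> 0 \<Longrightarrow> a / (2 * m) * m = a / (2::real)"
  by simp

text \<open>The point of \<open>Z\<close> supplied by \<open>bracket_reach\<close> is displaced by
  \<open>T\<^sup>2 V\<close> up to an error \<open>\<kappa> * T\<^sup>2\<close>, which would violate
  the normal inequality if \<nu> had a positive product with \<open>V\<close>. The first order form
  of that inequality also admits gradients of functions in the role of \<nu>.\<close>

lemma bracket_normal_le:
  fixes X Y :: "'e::euclidean_space \<Rightarrow> 'e"
  assumes "open S" "closedin (top_of_set S) Z" "smooth_on S X" "smooth_on S Y"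
    and tan: "tangent_field Z X" "tangent_field Z Y" and "x \<in> Z"
    and \<nu>: "\<And>\<epsilon>. 0 < \<epsilon> \<Longrightarrow> \<exists>\<delta>>0. \<forall>z\<in>Z. dist z x < \<delta> \<longrightarrow> \<nu> \<bullet> (z - x) \<le> \<epsilon> * dist z x"
  shows "\<nu> \<bullet> (FD Y x (X x) - FD X x (Y x)) \<le> 0"
    (is "\<nu> \<bullet> ?V \<le> 0")
proof (rule ccontr)
  define a where "a = \<nu> \<bullet> ?V"
  assume "\<not> \<nu> \<bullet> ?V \<le> 0"
  then have a: "0 < a" by (simp add: a_def)
  define W where "W = norm ?V + 1"
  have W: "0 < W" by (simp add: W_def add_nonneg_pos)
  have n1: "0 < norm \<nu> + 1" by (simp add: add_nonneg_pos)
  \<comment> \<open>With \<open>a\<close> the supposed positive product, the displacement error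
    costs less than \<open>a / 2\<close> per \<open>T\<^sup>2\<close>; the choice of \<epsilon>
    below makes the normal inequality cost the other half, since
    \<open>dist k x \<le> T\<^sup>2 * W\<close>.\<close>
  define \<kappa> where "\<kappa> = min 1 (a / (2 * (norm \<nu> + 1)))"
  have \<kappa>: "0 < \<kappa>" "\<kappa> \<le> 1" using a n1 by (auto simp: \<kappa>_def)
  have "\<kappa> * (norm \<nu> + 1) \<le> a / (2 * (norm \<nu> + 1)) * (norm \<nu> + 1)"
    using n1 by (intro mult_right_mono) (auto simp: \<kappa>_def)
  also have "\<dots> = a / 2" using n1 by (intro divide_twice_mult_cancel) simp
  finally have \<kappa>\<nu>: "norm \<nu> * \<kappa> < a / 2" using \<kappa>(1) by (simp add: algebra_simps)
  define \<epsilon> where "\<epsilon> = a / (2 * W)"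
  have \<epsilon>: "0 < \<epsilon>" using a W by (simp add: \<epsilon>_def)
  obtain \<delta> where \<delta>: "0 < \<delta>" "\<And>z. z \<in> Z \<Longrightarrow> dist z x < \<delta> \<Longrightarrow> \<nu> \<bullet> (z - x) \<le> \<epsilon> * dist z x"
    using \<nu>[OF \<epsilon>] by blast
  obtain T0 where T0: "0 < T0"
    "\<And>T. 0 < T \<Longrightarrow> T \<le> T0 \<Longrightarrow> \<exists>k\<in>Z. dist k (x + T\<^sup>2 *\<^sub>R ?V) \<le> \<kappa> * T\<^sup>2"
    using bracket_reach[OF assms(1-7) \<kappa>(1)] by blast
  define q where "q = \<delta> / (2 * W)"
  have q: "0 < q" using \<delta>(1) W by (simp add: q_def)
  define T where "T = min T0 (sqrt q)"
  have T: "0 < T" "T \<le> T0" "T\<^sup>2 \<le> q"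
  proof -
    show "0 < T" "T \<le> T0" using T0(1) q by (auto simp: T_def)
    have "T\<^sup>2 \<le> (sqrt q)\<^sup>2" using \<open>0 < T\<close> by (intro power_mono) (auto simp: T_def)
    then show "T\<^sup>2 \<le> q" using q by simp
  qed
  obtain k where k: "k \<in> Z" "dist k (x + T\<^sup>2 *\<^sub>R ?V) \<le> \<kappa> * T\<^sup>2" using T0(2)[OF T(1,2)] by blast
  define r where "r = k - (x + T\<^sup>2 *\<^sub>R ?V)"
  have r: "norm r \<le> \<kappa> * T\<^sup>2" "k - x = T\<^sup>2 *\<^sub>R ?V + r"
    using k(2) by (simp_all add: r_def dist_norm)
  have "dist k x \<le> norm (T\<^sup>2 *\<^sub>R ?V) + norm r"
    unfolding dist_norm r(2) by (rule norm_triangle_ineq)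
  also have "\<dots> \<le> T\<^sup>2 * norm ?V + 1 * T\<^sup>2"
    using r(1) \<kappa>(2) mult_right_mono[of \<kappa> 1 "T\<^sup>2"] by simp
  finally have kx: "dist k x \<le> T\<^sup>2 * W" by (simp add: W_def algebra_simps)
  have "T\<^sup>2 * W \<le> \<delta> / (2 * W) * W" using T(3) W by (intro mult_right_mono) (auto simp: q_def)
  then have "dist k x < \<delta>" using kx W \<delta>(1) by simp
  then have "\<nu> \<bullet> (k - x) \<le> \<epsilon> * dist k x" using \<delta>(2) k(1) by blast
  also have "\<dots> \<le> \<epsilon> * (T\<^sup>2 * W)" using kx \<epsilon> by simp
  also have "\<dots> = T\<^sup>2 * (a / 2)" using W by (simp add: \<epsilon>_def)
  finally have 1: "\<nu> \<bullet> (k - x) \<le> T\<^sup>2 * (a / 2)" .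
  have "\<nu> \<bullet> (k - x) = T\<^sup>2 * a + \<nu> \<bullet> r" unfolding r(2) a_def by (simp add: inner_add_right)
  moreover have "- (\<nu> \<bullet> r) \<le> norm \<nu> * norm r" using Cauchy_Schwarz_ineq2[of \<nu> r] by linarith
  moreover have "norm \<nu> * norm r \<le> T\<^sup>2 * (norm \<nu> * \<kappa>)"
    using mult_left_mono[OF r(1), of "norm \<nu>"] by (simp add: algebra_simps)
  ultimately have "T\<^sup>2 * a \<le> T\<^sup>2 * (norm \<nu> * \<kappa> + a / 2)"
    using 1 unfolding distrib_left by linarith
  then have "a \<le> norm \<nu> * \<kappa> + a / 2" using T(1) by simp
  then show False using \<kappa>\<nu> by linarith
qed

lemma proximal_normal_first_order:
  assumes "proximal_normal Z x \<nu>" "0 < \<epsilon>"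
  shows "\<exists>\<delta>>0. \<forall>z\<in>Z. dist z x < \<delta> \<longrightarrow> \<nu> \<bullet> (z - x) \<le> \<epsilon> * dist z x"
proof -
  obtain c \<rho> where c: "0 < \<rho>" "\<And>z. z \<in> Z \<Longrightarrow> dist z x < \<rho> \<Longrightarrow> \<nu> \<bullet> (z - x) \<le> c * (dist z x)\<^sup>2"
    using assms(1) by (auto simp: proximal_normal_def)
  have c1: "0 < \<bar>c\<bar> + 1" by (simp add: add_nonneg_pos)
  show ?thesis
  proof (intro exI[of _ "min \<rho> (\<epsilon> / (\<bar>c\<bar> + 1))"] conjI ballI impI)
    show "0 < min \<rho> (\<epsilon> / (\<bar>c\<bar> + 1))" using c(1) assms(2) c1 by simp
    fix z assume z: "z \<in> Z" "dist z x < min \<rho> (\<epsilon> / (\<bar>c\<bar> + 1))"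
    then have "dist z x * (\<bar>c\<bar> + 1) < \<epsilon>" using c1 by (simp add: pos_less_divide_eq)
    moreover have "c * dist z x \<le> dist z x * (\<bar>c\<bar> + 1)"
      using mult_right_mono[of c "\<bar>c\<bar> + 1" "dist z x"] by (simp add: mult.commute)
    ultimately have "c * dist z x * dist z x \<le> \<epsilon> * dist z x" by (intro mult_right_mono) auto
    moreover have "\<nu> \<bullet> (z - x) \<le> c * (dist z x)\<^sup>2" using c(2) z by simp
    ultimately show "\<nu> \<bullet> (z - x) \<le> \<epsilon> * dist z x" by (simp add: power2_eq_square mult.assoc)
  qed
qed

text \<open>The one-sided estimate is used for both orders of the fields; antisymmetry of the
  bracket turns the two inequalities into an equality.\<close>

lemma tangent_field_bracket:
  fixes X Y :: "'e::euclidean_space \<Rightarrow> 'e"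
  assumes "open S" "closedin (top_of_set S) Z" "smooth_on S X" "smooth_on S Y"
    and "tangent_field Z X" "tangent_field Z Y"
  shows "tangent_field Z (\<lambda>x. FD Y x (X x) - FD X x (Y x))"
  unfolding tangent_field_def
proof (intro ballI allI impI)
  fix x \<nu> assume "x \<in> Z" "proximal_normal Z x \<nu>"
  then have "\<nu> \<bullet> (FD Y x (X x) - FD X x (Y x)) \<le> 0"
    "\<nu> \<bullet> (FD X x (Y x) - FD Y x (X x)) \<le> 0"
    using bracket_normal_le[OF assms(1-6)] bracket_normal_le[OF assms(1,2,4,3,6,5)]
      proximal_normal_first_order by blast+
  then show "\<nu> \<bullet> (FD Y x (X x) - FD X x (Y x)) = 0"
    by (simp add: inner_diff_right)
qed

section \<open>Fields annihilated by the differential of a function\<close>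

text \<open>A short segment in a direction of strict decrease stays in the sublevel set, so a normal
  has nonpositive product with that direction. Directions \<open>v\<close> with
  \<open>FD \<phi> z v \<le> 0\<close> are limits of such directions, and annihilation allows both
  \<open>X\<close> and \<open>- X\<close>.\<close>

lemma tangent_field_sublevel:
  fixes X :: "'e::euclidean_space \<Rightarrow> 'e" and \<phi> :: "'e \<Rightarrow> real"
  assumes "open S" "smooth_on S \<phi>"
    and ann: "\<And>z. z \<in> S \<Longrightarrow> FD \<phi> z (X z) = 0"
    and reg: "\<And>z. z \<in> S \<Longrightarrow> \<exists>p. FD \<phi> z p < 0"
  shows "tangent_field {z \<in> S. \<phi> z \<le> c} X"
proof -
  have half: "\<nu> \<bullet> v \<le> 0"
    if z: "z \<in> S" "\<phi> z \<le> c" and \<nu>: "proximal_normal {z \<in> S. \<phi> z \<le> c} z \<nu>"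
      and v: "FD \<phi> z v \<le> 0" for z \<nu> v
  proof (rule ccontr)
    assume "\<not> \<nu> \<bullet> v \<le> 0"
    then have pos: "0 < \<nu> \<bullet> v" by simp
    obtain p where p: "FD \<phi> z p < 0" using reg[OF z(1)] by blast
    have lin: "linear (FD \<phi> z)"
      using smooth_on_differentiable[OF assms(2) z(1)] by (rule linear_frechet_derivative)
    \<comment> \<open>Tilting \<open>v\<close> by \<open>\<kappa>\<close> towards \<open>p\<close>
      makes the decrease strict, while at least half of the positive product with \<nu>
      survives.\<close>
    define \<kappa> where "\<kappa> = \<nu> \<bullet> v / (2 * (\<bar>\<nu> \<bullet> p\<bar> + 1))"
    have \<kappa>: "0 < \<kappa>" using pos by (simp add: \<kappa>_def)
    define w where "w = v + \<kappa> *\<^sub>R p"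
    have "\<kappa> * (\<bar>\<nu> \<bullet> p\<bar> + 1) = \<nu> \<bullet> v / 2"
      unfolding \<kappa>_def by (rule divide_twice_mult_cancel) linarith
    moreover have "- (\<kappa> * (\<nu> \<bullet> p)) \<le> \<kappa> * (\<bar>\<nu> \<bullet> p\<bar> + 1)"
      using \<kappa> mult_left_mono[of "- (\<nu> \<bullet> p)" "\<bar>\<nu> \<bullet> p\<bar> + 1" \<kappa>] by simp
    ultimately have \<nu>w: "0 < \<nu> \<bullet> w" using pos by (simp add: w_def inner_add_right)
    have dw: "FD \<phi> z w < 0"
      using v p \<kappa> by (simp add: w_def linear_add[OF lin] linear_scale[OF lin] add_nonpos_neg mult_pos_neg)
    have d: "((\<lambda>t. z + t *\<^sub>R w) has_derivative (\<lambda>t. t *\<^sub>R w)) (at 0)"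
      by (auto intro!: derivative_eq_intros)
    have "((\<lambda>t. \<phi> (z + t *\<^sub>R w)) has_derivative (\<lambda>t. FD \<phi> z (t *\<^sub>R w))) (at 0)"
      using smooth_on_has_derivative[OF assms(2) z(1)]
      by (intro has_derivative_compose[OF d]) simp
    then have "((\<lambda>t. \<phi> (z + t *\<^sub>R w)) has_real_derivative FD \<phi> z w) (at 0)"
      unfolding has_field_derivative_def
      by (rule has_derivative_eq_rhs) (simp add: fun_eq_iff linear_scale[OF lin])
    from DERIV_neg_dec_right[OF this dw] obtain h1 where
      h1: "0 < h1" "\<And>t. 0 < t \<Longrightarrow> t < h1 \<Longrightarrow> \<phi> (z + t *\<^sub>R w) < \<phi> z" by auto
    obtain h2 where h2: "0 < h2" "ball z h2 \<subseteq> S" using assms(1) z(1) openE by blast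
    define W where "W = norm w + 1"
    have W: "0 < W" "norm w \<le> W" by (auto simp: W_def add_nonneg_pos)
    obtain \<rho> where m: "0 < \<rho>"
      "\<And>y. y \<in> S \<Longrightarrow> \<phi> y \<le> c \<Longrightarrow> dist y z < \<rho> \<Longrightarrow> \<nu> \<bullet> (y - z) \<le> \<nu> \<bullet> w / (2 * W) * dist y z"
      using proximal_normal_first_order[OF \<nu>, of "\<nu> \<bullet> w / (2 * W)"] \<nu>w W(1) by auto
    define t where "t = min (h1 / 2) (min h2 \<rho> / (2 * W))"
    have t: "0 < t" "t < h1" using h1(1) h2(1) m(1) W by (auto simp: t_def)
    have "t * W \<le> min h2 \<rho> / (2 * W) * W" using W by (intro mult_right_mono) (auto simp: t_def)
    then have "t * W < h2" "t * W < \<rho>" using W h2(1) m(1) by (auto simp: min_def split: if_splits)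
    moreover have "t * norm w \<le> t * W" using W t by simp
    ultimately have tw: "t * norm w < h2" "t * norm w < \<rho>" "t * norm w \<le> t * W" by linarith+
    have "z + t *\<^sub>R w \<in> S" using h2(2) tw t by (auto simp: dist_norm subset_iff)
    moreover have "\<phi> (z + t *\<^sub>R w) \<le> c" using h1(2)[OF t] z by simp
    ultimately have "\<nu> \<bullet> (t *\<^sub>R w) \<le> \<nu> \<bullet> w / (2 * W) * (t * norm w)"
      using m(2)[of "z + t *\<^sub>R w"] tw t by (simp add: dist_norm)
    also have "\<dots> \<le> \<nu> \<bullet> w / (2 * W) * (t * W)"
      using W t \<nu>w by (intro mult_left_mono) auto
    also have "\<dots> = t * (\<nu> \<bullet> w / 2)" using W(1) by simp
    finally have "t * (\<nu> \<bullet> w) \<le> t * (\<nu> \<bullet> w / 2)" by simp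
    then have "\<nu> \<bullet> w \<le> \<nu> \<bullet> w / 2" using t(1) by (simp only: mult_le_cancel_left_pos)
    then show False using \<nu>w by simp
  qed
  show ?thesis
    unfolding tangent_field_def
  proof (intro ballI allI impI)
    fix z \<nu> assume z: "z \<in> {z \<in> S. \<phi> z \<le> c}" and \<nu>: "proximal_normal {z \<in> S. \<phi> z \<le> c} z \<nu>"
    have "FD \<phi> z (- X z) = - FD \<phi> z (X z)"
      using smooth_on_differentiable[OF assms(2)] z
      by (intro linear_neg linear_frechet_derivative) auto
    then have "\<nu> \<bullet> X z \<le> 0" "\<nu> \<bullet> (- X z) \<le> 0"
      using half[OF _ _ \<nu>, of "X z"] half[OF _ _ \<nu>, of "- X z"] z ann by auto
    then show "\<nu> \<bullet> X z = 0" by simp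
  qed
qed

text \<open>The bracket identity \<open>[X, Y] \<phi> = X (Y \<phi>) - Y (X \<phi>)\<close> would need the symmetry of second
  derivatives; here the sublevel set of \<open>\<phi>\<close> is reached along \<open>[X, Y]\<close> instead.\<close>

lemma bracket_annihilates:
  fixes X Y :: "'e::euclidean_space \<Rightarrow> 'e" and \<phi> :: "'e \<Rightarrow> real"
  assumes S: "open S" "smooth_on S \<phi>" "smooth_on S X" "smooth_on S Y"
    and ann: "\<And>z. z \<in> S \<Longrightarrow> FD \<phi> z (X z) = 0"
      "\<And>z. z \<in> S \<Longrightarrow> FD \<phi> z (Y z) = 0"
    and reg: "\<And>z. z \<in> S \<Longrightarrow> \<exists>p. FD \<phi> z p < 0"
    and x: "x \<in> S"
  shows "FD \<phi> x (FD Y x (X x) - FD X x (Y x)) = 0"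
proof -
  define Z where "Z = {z \<in> S. \<phi> z \<le> \<phi> x}"
  have cl: "closedin (top_of_set S) Z"
    unfolding Z_def using continuous_closedin_preimage[OF smooth_on_continuous[OF S(2)] closed_atMost[of "\<phi> x"]]
    by (simp add: vimage_def Int_def)
  have tan: "tangent_field Z X" "tangent_field Z Y"
    unfolding Z_def using tangent_field_sublevel[OF S(1,2)] ann reg by blast+
  have xZ: "x \<in> Z" using x by (simp add: Z_def)
  note diff = smooth_on_differentiable[OF S(2) x]
  \<comment> \<open>The gradient at \<open>x\<close> is a first order normal of the sublevel set of
    level \<open>\<phi> x\<close>: there the increment of \<phi> is nonpositive and equals its
    linear part up to a small error.\<close>
  have \<nu>: "\<exists>\<delta>>0. \<forall>z\<in>Z. dist z x < \<delta> \<longrightarrow> covec_diff \<phi> x \<bullet> (z - x) \<le> \<epsilon> * dist z x"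
    if \<epsilon>: "0 < \<epsilon>" for \<epsilon>
  proof -
    obtain \<delta> where \<delta>: "0 < \<delta>"
      "\<And>y. norm (y - x) < \<delta> \<Longrightarrow> norm (\<phi> y - \<phi> x - FD \<phi> x (y - x)) \<le> \<epsilon> * norm (y - x)"
      using smooth_on_has_derivative[OF S(2) x] \<epsilon> unfolding has_derivative_at_alt by blast
    have "FD \<phi> x (z - x) \<le> \<epsilon> * dist z x" if "z \<in> Z" "dist z x < \<delta>" for z
    proof -
      have "\<phi> z \<le> \<phi> x" "norm (z - x) < \<delta>" using that by (auto simp: Z_def dist_norm)
      with \<delta>(2)[of z] show ?thesis unfolding dist_norm real_norm_def by linarith
    qed
    then show ?thesis using \<delta>(1) by (auto simp: covec_diff_inner[OF diff])
  qed
  have "covec_diff \<phi> x \<bullet> (FD Y x (X x) - FD X x (Y x)) \<le> 0"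
    by (rule bracket_normal_le[OF S(1) cl S(3,4) tan xZ \<nu>])
  moreover have "covec_diff \<phi> x \<bullet> (FD X x (Y x) - FD Y x (X x)) \<le> 0"
    by (rule bracket_normal_le[OF S(1) cl S(4,3) tan(2,1) xZ \<nu>])
  ultimately show ?thesis by (simp add: covec_diff_inner[OF diff, symmetric] inner_diff_right)
qed

section \<open>The strong maximum principle in coordinates\<close>

lemma sum_sum_insert:
  assumes "finite I" "k \<notin> I"
  shows "(\<Sum>i\<in>insert k I. \<Sum>j\<in>insert k I. f i j) =
    (f k k + (\<Sum>j\<in>I. f k j) + (\<Sum>i\<in>I. f i k) + (\<Sum>i\<in>I. \<Sum>j\<in>I. f i j) :: real)"
  using assms by (simp add: sum.distrib)

text \<open>Eliminating one index of \<open>a\<close> (a Cholesky step) splits off a form of rank one.\<close>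

lemma sum_psd_mult_nonneg:
  fixes a w :: "'i \<Rightarrow> 'i \<Rightarrow> real"
  assumes "finite I"
    and "\<And>i j. i \<in> I \<Longrightarrow> j \<in> I \<Longrightarrow> a i j = a j i"
    and "\<And>c. 0 \<le> (\<Sum>i\<in>I. \<Sum>j\<in>I. c i * c j * a i j)"
    and "\<And>c. 0 \<le> (\<Sum>i\<in>I. \<Sum>j\<in>I. c i * c j * w i j)"
  shows "0 \<le> (\<Sum>i\<in>I. \<Sum>j\<in>I. a i j * w i j)"
  using assms
proof (induction I arbitrary: a rule: finite_induct)
  case empty
  then show ?case by simp
next
  case (insert k I)
  note ins = sum_sum_insert[OF insert.hyps]
  have ext: "(\<Sum>i\<in>I. \<Sum>j\<in>I. c i * c j * f i j) =
      (\<Sum>i\<in>insert k I. \<Sum>j\<in>insert k I. (c(k := 0)) i * (c(k := 0)) j * f i j)" for c and f :: "'i \<Rightarrow> 'i \<Rightarrow> real"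
    unfolding ins using insert.hyps(2) by (auto intro!: sum.cong)
  have wI: "0 \<le> (\<Sum>i\<in>I. \<Sum>j\<in>I. c i * c j * w i j)" for c
    unfolding ext by (rule insert.prems(3))
  \<comment> \<open>The form is viewed as a quadratic polynomial in the coefficient \<open>s\<close>
    of the eliminated index.\<close>
  have expand: "(\<Sum>i\<in>insert k I. \<Sum>j\<in>insert k I. (c(k := s)) i * (c(k := s)) j * a i j) =
      s\<^sup>2 * a k k + 2 * s * (\<Sum>j\<in>I. c j * a k j) + (\<Sum>i\<in>I. \<Sum>j\<in>I. c i * c j * a i j)" for c s
  proof -
    have c: "(\<Sum>j\<in>I. (c(k := s)) k * (c(k := s)) j * a k j) = s * (\<Sum>j\<in>I. c j * a k j)"
      "(\<Sum>i\<in>I. (c(k := s)) i * (c(k := s)) k * a i k) = s * (\<Sum>j\<in>I. c j * a k j)"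
      "(\<Sum>i\<in>I. \<Sum>j\<in>I. (c(k := s)) i * (c(k := s)) j * a i j) = (\<Sum>i\<in>I. \<Sum>j\<in>I. c i * c j * a i j)"
      unfolding sum_distrib_left
      using insert.hyps(2) insert.prems(1) by (auto intro!: sum.cong)
    show ?thesis unfolding ins c by (simp add: power2_eq_square)
  qed
  have akk: "0 \<le> a k k"
    using insert.prems(2)[of "(\<lambda>_. 0)(k := 1)"] unfolding expand by simp
  show ?case
  proof (cases "a k k = 0")
    case True
    have z: "a k j = 0" if j: "j \<in> I" for j
    proof (rule ccontr)
      assume nz: "a k j \<noteq> 0"
      define c where "c = (\<lambda>i. if i = j then 1 else 0 :: real)"
      have 1: "(\<Sum>i\<in>I. c i * a k i) = a k j"
        using j insert.hyps(1) by (simp add: c_def if_distrib[of "\<lambda>x. x * _"] sum.delta cong: if_cong)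
      \<comment> \<open>With zero pivot the polynomial is affine in \<open>s\<close>; this value
        would make it -1.\<close>
      define s where "s = - ((\<Sum>i\<in>I. \<Sum>j\<in>I. c i * c j * a i j) + 1) / (2 * a k j)"
      have "2 * s * a k j = - ((\<Sum>i\<in>I. \<Sum>j\<in>I. c i * c j * a i j) + 1)"
        using nz by (simp add: s_def)
      then show False
        using insert.prems(2)[of "c(k := s)"] unfolding expand True 1 by simp
    qed
    have z': "a j k = 0" if "j \<in> I" for j using z[OF that] insert.prems(1)[of j k] that by simp
    have "0 \<le> (\<Sum>i\<in>I. \<Sum>j\<in>I. a i j * w i j)"
    proof (rule insert.IH)
      show "0 \<le> (\<Sum>i\<in>I. \<Sum>j\<in>I. c i * c j * a i j)" for c
        unfolding ext by (rule insert.prems(2))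
    qed (use insert.prems(1) wI in auto)
    then show ?thesis unfolding ins by (simp add: True z z')
  next
    case False
    then have pos: "0 < a k k" using akk by simp
    define a' where "a' i j = a i j - a k i * a k j / a k k" for i j
    have sq: "(\<Sum>i\<in>I. \<Sum>j\<in>I. c i * c j * (a k i * a k j)) = (\<Sum>j\<in>I. c j * a k j)\<^sup>2" for c
      unfolding power2_eq_square sum_product by (auto intro!: sum.cong)
    have "0 \<le> (\<Sum>i\<in>I. \<Sum>j\<in>I. a' i j * w i j)"
    proof (rule insert.IH)
      show "a' i j = a' j i" if "i \<in> I" "j \<in> I" for i j
        using insert.prems(1) that by (simp add: a'_def)
      show "0 \<le> (\<Sum>i\<in>I. \<Sum>j\<in>I. c i * c j * a' i j)" for c
      proof -
        define B where "B = (\<Sum>j\<in>I. c j * a k j)"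
        have "(\<Sum>i\<in>I. \<Sum>j\<in>I. c i * c j * a' i j) =
          (\<Sum>i\<in>I. \<Sum>j\<in>I. c i * c j * a i j) - (\<Sum>i\<in>I. \<Sum>j\<in>I. c i * c j * (a k i * a k j)) / a k k"
          by (simp add: a'_def right_diff_distrib sum_subtractf sum_divide_distrib)
        also have "\<dots> = (\<Sum>i\<in>I. \<Sum>j\<in>I. c i * c j * a i j) - B\<^sup>2 / a k k"
          unfolding sq B_def ..
        \<comment> \<open>Completion of the square: \<open>- B / a k k\<close> minimises the
          polynomial, and its minimum is the reduced form.\<close>
        also have "\<dots> = (- B / a k k)\<^sup>2 * a k k + 2 * (- B / a k k) * B + (\<Sum>i\<in>I. \<Sum>j\<in>I. c i * c j * a i j)"
          using pos by (simp add: power2_eq_square field_simps)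
        also have "0 \<le> \<dots>"
          using insert.prems(2)[of "c(k := - B / a k k)"] unfolding expand B_def .
        finally show ?thesis .
      qed
    qed (rule wI)
    moreover have "0 \<le> (\<Sum>i\<in>insert k I. \<Sum>j\<in>insert k I. a k i * a k j * w i j)"
      by (rule insert.prems(3))
    moreover have "(\<Sum>i\<in>insert k I. \<Sum>j\<in>insert k I. a i j * w i j) =
      (\<Sum>i\<in>insert k I. \<Sum>j\<in>insert k I. a' i j * w i j) +
      (\<Sum>i\<in>insert k I. \<Sum>j\<in>insert k I. a k i * a k j * w i j) / a k k"
      by (simp only: a'_def left_diff_distrib sum_subtractf sum_divide_distrib times_divide_eq_left)
    moreover have "(\<Sum>i\<in>insert k I. \<Sum>j\<in>insert k I. a' i j * w i j) = (\<Sum>i\<in>I. \<Sum>j\<in>I. a' i j * w i j)"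
    proof -
      have "a' k j = 0" "a' j k = 0" if "j \<in> insert k I" for j
        using that insert.prems(1)[of j k] pos by (auto simp: a'_def)
      then show ?thesis unfolding ins by simp
    qed
    ultimately show ?thesis using pos by simp
  qed
qed

section \<open>Gradients, the second derivative test and semidefinite forms\<close>

lemma inner_sum_Basis:
  fixes c :: "'e::euclidean_space \<Rightarrow> real"
  assumes "b \<in> Basis"
  shows "(\<Sum>b\<in>Basis. c b *\<^sub>R b) \<bullet> b = c b"
  using assms by (simp add: inner_sum_left inner_Basis if_distrib sum.delta cong: if_cong)

lemma smooth_on_covec_diff:
  "open S \<Longrightarrow> smooth_on S f \<Longrightarrow> smooth_on S (covec_diff f)"
  unfolding covec_diff_def[abs_def]
  by (intro smooth_on_sum smooth_on_scaleR smooth_on_frechet_derivative smooth_on_const)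

lemma covec_diff_eqI:
  assumes "(f has_derivative (\<lambda>v. c \<bullet> v)) (at z)"
  shows "covec_diff f z = c"
  unfolding covec_diff_def frechet_derivative_at[OF assms, symmetric] by (simp add: euclidean_representation)

lemma covec_diff_add_scaled:
  assumes "f differentiable (at z)" "h differentiable (at z)"
  shows "covec_diff (\<lambda>y. f y + e * h y) z = covec_diff f z + e *\<^sub>R covec_diff h z"
proof (rule covec_diff_eqI)
  have "((\<lambda>y. f y + e * h y) has_derivative
      (\<lambda>v. FD f z v + e * FD h z v)) (at z)"
    using assms by (intro has_derivative_add has_derivative_mult_right)
      (simp_all add: frechet_derivative_works[symmetric])
  then show "((\<lambda>y. f y + e * h y) has_derivative (\<lambda>v. (covec_diff f z + e *\<^sub>R covec_diff h z) \<bullet> v)) (at z)"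
    by (simp add: inner_add_left covec_diff_inner assms)
qed

text \<open>Everything is restricted to lines through \<open>z\<close>. If the second derivative
  along \<open>v\<close> were negative, the first derivative would be negative just after 0, and the
  mean value theorem would give a value below the minimum.\<close>

lemma smooth_local_min:
  fixes f :: "'e::euclidean_space \<Rightarrow> real"
  assumes "open S" "smooth_on S f" "z \<in> S" "0 < r" and min: "\<And>y. dist y z < r \<Longrightarrow> f z \<le> f y"
  shows "covec_diff f z = 0" "0 \<le> FD (covec_diff f) z v \<bullet> v"
proof -
  obtain r' where r': "0 < r'" "ball z r' \<subseteq> S" using assms(1,3) openE by blast
  define r0 where "r0 v = min r r' / (norm v + 1)" for v :: 'e
  have r0: "0 < r0 v" for v using assms(4) r'(1) by (simp add: r0_def add_nonneg_pos)
  have near: "z + t *\<^sub>R v \<in> S \<and> f z \<le> f (z + t *\<^sub>R v)" if "\<bar>t\<bar> < r0 v" for t v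
  proof -
    have "\<bar>t\<bar> * (norm v + 1) < min r r'"
      using that by (simp add: r0_def add_nonneg_pos pos_less_divide_eq)
    moreover have "norm (t *\<^sub>R v) \<le> \<bar>t\<bar> * (norm v + 1)" by (simp add: distrib_left)
    ultimately have "norm (t *\<^sub>R v) < min r r'" by linarith
    then show ?thesis using min[of "z + t *\<^sub>R v"] r'(2) by (auto simp: dist_norm subset_iff)
  qed
  have d: "((\<lambda>t. z + t *\<^sub>R v) has_derivative (\<lambda>t. t *\<^sub>R v)) (at s)" for s v
    by (auto intro!: derivative_eq_intros)
  have d1: "((\<lambda>t. f (z + t *\<^sub>R v)) has_real_derivative covec_diff f (z + s *\<^sub>R v) \<bullet> v) (at s)"
    if "\<bar>s\<bar> < r0 v" for s v
  proof -
    have S: "z + s *\<^sub>R v \<in> S" using near that by blast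
    have "((\<lambda>t. f (z + t *\<^sub>R v)) has_derivative (\<lambda>t. FD f (z + s *\<^sub>R v) (t *\<^sub>R v))) (at s)"
      by (rule has_derivative_compose[OF d smooth_on_has_derivative[OF assms(2) S]])
    then show ?thesis
      unfolding has_field_derivative_def
      by (rule has_derivative_eq_rhs)
        (simp add: fun_eq_iff covec_diff_inner[OF smooth_on_differentiable[OF assms(2) S], symmetric])
  qed
  have z1: "covec_diff f z \<bullet> v = 0" for v
    using DERIV_local_min[OF d1[of 0 v] r0[of v]] near[of _ v] r0[of v] by auto
  then show "covec_diff f z = 0" using inner_eq_zero_iff by blast
  show "0 \<le> FD (covec_diff f) z v \<bullet> v"
  proof (rule ccontr)
    assume "\<not> ?thesis"
    then have neg: "FD (covec_diff f) z v \<bullet> v < 0" by simp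
    have dc: "(covec_diff f has_derivative FD (covec_diff f) z) (at z)"
      by (rule smooth_on_has_derivative[OF smooth_on_covec_diff[OF assms(1,2)] assms(3)])
    have "((\<lambda>t. covec_diff f (z + t *\<^sub>R v)) has_derivative
        (\<lambda>t. FD (covec_diff f) z (t *\<^sub>R v))) (at 0)"
      by (rule has_derivative_compose[OF d]) (use dc in simp)
    then have "((\<lambda>t. covec_diff f (z + t *\<^sub>R v) \<bullet> v) has_derivative
        (\<lambda>t. FD (covec_diff f) z (t *\<^sub>R v) \<bullet> v)) (at 0)"
      by (rule has_derivative_inner_left)
    then have "((\<lambda>t. covec_diff f (z + t *\<^sub>R v) \<bullet> v) has_real_derivative
        FD (covec_diff f) z v \<bullet> v) (at 0)"
      unfolding has_field_derivative_def
      by (rule has_derivative_eq_rhs)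
        (simp add: fun_eq_iff linear_scale[OF has_derivative_linear[OF dc]])
    from DERIV_neg_dec_right[OF this neg] obtain h where
      h: "0 < h" "\<And>t. 0 < t \<Longrightarrow> t < h \<Longrightarrow> covec_diff f (z + t *\<^sub>R v) \<bullet> v < 0"
      using z1 by auto
    define t where "t = min h (r0 v) / 2"
    have t: "0 < t" "t < h" "t < r0 v" using h(1) r0[of v] by (auto simp: t_def min_def)
    obtain s where s: "0 < s" "s < t" "f (z + t *\<^sub>R v) - f (z + 0 *\<^sub>R v) = (t - 0) * (covec_diff f (z + s *\<^sub>R v) \<bullet> v)"
      using MVT2[of 0 t "\<lambda>t. f (z + t *\<^sub>R v)" "\<lambda>s. covec_diff f (z + s *\<^sub>R v) \<bullet> v"] t d1 by auto
    have "(t - 0) * (covec_diff f (z + s *\<^sub>R v) \<bullet> v) < 0"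
      using h(2)[of s] s t by (simp add: mult_pos_neg)
    then show False using s(3) near[of t v] t by simp
  qed
qed

lemma bilinear_expand:
  fixes f :: "'e::euclidean_space \<Rightarrow> 'e \<Rightarrow> real"
  assumes "bilinear f"
  shows "f v w = (\<Sum>b\<in>Basis. \<Sum>c\<in>Basis. (v \<bullet> b) * (w \<bullet> c) * f b c)"
proof -
  have 1: "f v w = (\<Sum>b\<in>Basis. (v \<bullet> b) * f b w)"
    using linear_Basis_expand[of "\<lambda>v. f v w" v] assms by (simp add: bilinear_def)
  have 2: "f b w = (\<Sum>c\<in>Basis. (w \<bullet> c) * f b c)" for b
    using linear_Basis_expand[of "f b" w] assms by (simp add: bilinear_def)
  show ?thesis unfolding 1 by (subst 2) (simp add: sum_distrib_left mult.assoc)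
qed

text \<open>The form may be degenerate. Then \<open>f w w = 0\<close> has to force
  \<open>f v w = 0\<close>, since otherwise the polynomial \<open>q\<close> is affine with nonzero
  slope and takes the value -1.\<close>

lemma psd_Cauchy_Schwarz:
  fixes f :: "'e::real_vector \<Rightarrow> 'e \<Rightarrow> real"
  assumes "bilinear f" "\<And>v w. f v w = f w v" "\<And>v. 0 \<le> f v v"
  shows "(f v w)\<^sup>2 \<le> f v v * f w w"
proof -
  note b = bilinear_ladd[OF assms(1)] bilinear_radd[OF assms(1)]
    bilinear_lmul[OF assms(1)] bilinear_rmul[OF assms(1)]
  have q: "0 \<le> f v v + 2 * t * f v w + t\<^sup>2 * f w w" for t
    using assms(3)[of "v + t *\<^sub>R w"] assms(2)[of w v] by (simp add: b power2_eq_square algebra_simps)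
  show ?thesis
  proof (cases "f w w = 0")
    case True
    have "f v w = 0"
    proof (rule ccontr)
      assume nz: "f v w \<noteq> 0"
      have "2 * (- (f v v + 1) / (2 * f v w)) * f v w = - (f v v + 1)" using nz by simp
      then show False using q[of "- (f v v + 1) / (2 * f v w)"] True by simp
    qed
    then show ?thesis using True by simp
  next
    case False
    then have pos: "0 < f w w" using assms(3)[of w] by simp
    have "0 \<le> (f v v + 2 * (- f v w / f w w) * f v w + (- f v w / f w w)\<^sup>2 * f w w) * f w w"
      using pos by (intro mult_nonneg_nonneg[OF q]) simp
    also have "\<dots> = f v v * f w w - (f v w)\<^sup>2"
      using pos by (simp add: power2_eq_square field_simps)
    finally show ?thesis by simp
  qed
qed

section \<open>The divergence operator, its symbol and the comparison at a minimum\<close>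

text \<open>\<open>gm\<close> holds the components of the cometric and \<open>A\<close> the volume
  density in one coordinate system. The form \<open>gm z\<close> is only semidefinite, so the
  operator is degenerate elliptic, and \<open>0 \<le> p\<close> is what makes its symbol
  nonnegative.\<close>

locale divergence_operator =
  fixes S :: "'e::euclidean_space set" and gm :: "'e \<Rightarrow> 'e \<Rightarrow> 'e \<Rightarrow> real"
    and A :: "'e \<Rightarrow> real" and p :: real
  assumes open_S: "open S"
    and bil: "\<And>z. z \<in> S \<Longrightarrow> bilinear (gm z)"
    and sym: "\<And>z v w. z \<in> S \<Longrightarrow> gm z v w = gm z w v"
    and psd: "\<And>z v. z \<in> S \<Longrightarrow> 0 \<le> gm z v v"
    and smooth_gm: "\<And>v w. smooth_on S (\<lambda>z. gm z v w)"
    and smooth_A: "smooth_on S A" and A_nz: "\<And>z. z \<in> S \<Longrightarrow> A z \<noteq> 0"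
    and p_nonneg: "0 \<le> p"
begin

definition G :: "'e \<Rightarrow> 'e \<Rightarrow> 'e" where
  "G z \<xi> = (\<Sum>b\<in>Basis. gm z b \<xi> *\<^sub>R b)"

text \<open>In terms of the conorm this is the vector \<open>A |\<xi>|^(p-1) G \<xi>\<close>; the
  exponent is halved because \<open>gm\<close> evaluates to the square of the conorm. Point and
  covector form one joint argument, so that smoothness in both is available.\<close>

definition flux :: "'e \<times> 'e \<Rightarrow> 'e" where
  "flux w = (A (fst w) * gm (fst w) (snd w) (snd w) powr ((p - 1) / 2)) *\<^sub>R G (fst w) (snd w)"

text \<open>The open domain on which the real power in \<open>flux\<close> is smooth.\<close>

definition \<Omega> :: "('e \<times> 'e) set" where
  "\<Omega> = {w. fst w \<in> S \<and> 0 < gm (fst w) (snd w) (snd w)}"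

definition hop :: "('e \<Rightarrow> real) \<Rightarrow> 'e \<Rightarrow> real" where
  "hop f z = (\<Sum>b\<in>Basis. FD (\<lambda>y. flux (y, covec_diff f y)) z b \<bullet> b) / A z"

text \<open>Up to the positive power of \<open>gm z \<xi> \<xi>\<close> and the density, this is the
  derivative of \<open>flux\<close> in the covector variable. For positive
  \<open>gm z \<xi> \<xi>\<close> it equals \<open>p * gm z \<xi> \<xi>\<close> on \<xi>, and it
  agrees with \<open>gm z\<close> on covectors orthogonal to \<xi>.\<close>

definition symb :: "'e \<Rightarrow> 'e \<Rightarrow> 'e \<Rightarrow> 'e \<Rightarrow> real" where
  "symb z \<xi> v w = gm z v w - (1 - p) * gm z v \<xi> * gm z w \<xi> / gm z \<xi> \<xi>"

text \<open>The locale grants smoothness for constant covectors only; expansion in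
  \<open>Basis\<close> extends it to moving ones.\<close>

lemma smooth_gm_comp:
  assumes "open T" "smooth_on T a" "smooth_on T v" "smooth_on T w" "\<And>t. t \<in> T \<Longrightarrow> a t \<in> S"
  shows "smooth_on T (\<lambda>t. gm (a t) (v t) (w t))"
proof -
  have "smooth_on T (\<lambda>t. \<Sum>b\<in>Basis. \<Sum>c\<in>Basis. (v t \<bullet> b) * (w t \<bullet> c) * gm (a t) b c)"
    by (intro smooth_on_sum[OF assms(1)] smooth_on_mult[OF assms(1)] smooth_on_inner[OF assms(1)]
        smooth_on_const assms smooth_on_compose[OF smooth_gm _ assms(1) open_S])
  then show ?thesis
    by (rule smooth_on_cong[OF _ assms(1)]) (subst bilinear_expand[OF bil[OF assms(5)]], auto)
qed

lemma smooth_G_comp: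
  assumes "open T" "smooth_on T a" "smooth_on T w" "\<And>t. t \<in> T \<Longrightarrow> a t \<in> S"
  shows "smooth_on T (\<lambda>t. G (a t) (w t))"
  unfolding G_def
  by (intro smooth_on_sum[OF assms(1)] smooth_on_scaleR[OF assms(1)] smooth_gm_comp smooth_on_const assms)

lemma smooth_on_fst: "open T \<Longrightarrow> smooth_on T fst"
  and smooth_on_snd: "open T \<Longrightarrow> smooth_on T snd"
  by (auto intro: smooth_on_linear_map bounded_linear_fst bounded_linear_snd)

lemma open_\<Omega>: "open \<Omega>"
proof -
  have o: "open (S \<times> (UNIV :: 'e set))" using open_S by (simp add: open_Times)
  have "smooth_on (S \<times> (UNIV :: 'e set)) (\<lambda>w. gm (fst w) (snd w) (snd w))"
    by (rule smooth_gm_comp[OF o smooth_on_fst[OF o] smooth_on_snd[OF o] smooth_on_snd[OF o]]) auto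
  from smooth_on_continuous[OF this]
  have "open ((\<lambda>w. gm (fst w) (snd w) (snd w)) -` {0<..} \<inter> (S \<times> UNIV))"
    unfolding continuous_on_open_vimage[OF o] by simp
  moreover have "\<Omega> = (\<lambda>w. gm (fst w) (snd w) (snd w)) -` {0<..} \<inter> (S \<times> UNIV)"
    by (auto simp: \<Omega>_def)
  ultimately show ?thesis by simp
qed

lemma smooth_flux: "smooth_on \<Omega> flux"
  unfolding flux_def[abs_def]
  by (intro smooth_on_scaleR[OF open_\<Omega>] smooth_on_mult[OF open_\<Omega>] smooth_on_powr[OF open_\<Omega>]
      smooth_gm_comp[OF open_\<Omega>] smooth_G_comp[OF open_\<Omega>] smooth_on_fst[OF open_\<Omega>] smooth_on_snd[OF open_\<Omega>]
      smooth_on_compose[OF smooth_A _ open_\<Omega> open_S]) (auto simp: \<Omega>_def)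

lemma linear_D_flux: "w \<in> \<Omega> \<Longrightarrow> linear (FD flux w)"
  using smooth_on_differentiable[OF smooth_flux] linear_frechet_derivative by blast

text \<open>The chain rule exhibits the quasilinear structure: for fixed point and gradient the
  operator depends on second derivatives through a linear map.\<close>

lemma hop_eq:
  assumes "open T" "T \<subseteq> S" "smooth_on T f" "z \<in> T" "(z, covec_diff f z) \<in> \<Omega>"
  shows "hop f z = (\<Sum>b\<in>Basis. FD flux (z, covec_diff f z)
    (b, FD (covec_diff f) z b) \<bullet> b) / A z"
proof -
  have "((\<lambda>y. (y, covec_diff f y)) has_derivative (\<lambda>b. (b, FD (covec_diff f) z b))) (at z)"
    using smooth_on_has_derivative[OF smooth_on_covec_diff[OF assms(1,3)] assms(4)]
    by (intro has_derivative_Pair has_derivative_ident)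
  then have "((\<lambda>y. flux (y, covec_diff f y)) has_derivative
    (\<lambda>b. FD flux (z, covec_diff f z) (b, FD (covec_diff f) z b))) (at z)"
    by (rule has_derivative_compose) (rule smooth_on_has_derivative[OF smooth_flux assms(5)])
  then show ?thesis
    unfolding hop_def by (simp add: frechet_derivative_at[symmetric])
qed

text \<open>Along the line \<open>\<xi> + t w\<close> the flux is an explicit function of one real
  variable, so two computations of its derivative at 0 can be equated.\<close>

lemma D_flux_vertical:
  assumes "(z, \<xi>) \<in> \<Omega>" "b \<in> Basis"
  shows "FD flux (z, \<xi>) (0, w) \<bullet> b =
    A z * gm z \<xi> \<xi> powr ((p - 1) / 2) * symb z \<xi> b w"
proof -
  have z: "z \<in> S" and N: "0 < gm z \<xi> \<xi>" using assms(1) by (auto simp: \<Omega>_def)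
  note bl = bilinear_ladd[OF bil[OF z]] bilinear_radd[OF bil[OF z]]
    bilinear_lmul[OF bil[OF z]] bilinear_rmul[OF bil[OF z]]
  define q where "q = (p - 1) / 2"
  have Gb: "G z v \<bullet> b = gm z b v" for v using assms(2) by (simp add: G_def inner_sum_Basis)
  have d0: "((\<lambda>t::real. (z, \<xi> + t *\<^sub>R w)) has_derivative (\<lambda>t. (0, t *\<^sub>R w))) (at 0)"
    by (auto intro!: derivative_eq_intros)
  have "((\<lambda>t. flux (z, \<xi> + t *\<^sub>R w)) has_derivative (\<lambda>t. FD flux (z, \<xi>) (0, t *\<^sub>R w))) (at 0)"
    by (rule has_derivative_compose[OF d0]) (use smooth_on_has_derivative[OF smooth_flux assms(1)] in simp)
  then have "((\<lambda>t. flux (z, \<xi> + t *\<^sub>R w) \<bullet> b) has_derivative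
      (\<lambda>t. FD flux (z, \<xi>) (0, t *\<^sub>R w) \<bullet> b)) (at 0)"
    by (rule has_derivative_inner_left)
  moreover have "FD flux (z, \<xi>) (0, t *\<^sub>R w) = t *\<^sub>R FD flux (z, \<xi>) (0, w)" for t
    using linear_scale[OF linear_D_flux[OF assms(1)], of t "(0, w)"] by simp
  ultimately have 1: "((\<lambda>t. flux (z, \<xi> + t *\<^sub>R w) \<bullet> b) has_real_derivative
      FD flux (z, \<xi>) (0, w) \<bullet> b) (at 0)"
    unfolding has_field_derivative_def
    by (elim has_derivative_eq_rhs) (simp add: fun_eq_iff)
  have f: "flux (z, \<xi> + t *\<^sub>R w) \<bullet> b =
      A z * (gm z \<xi> \<xi> + 2 * t * gm z \<xi> w + t\<^sup>2 * gm z w w) powr q * (gm z b \<xi> + t * gm z b w)" for t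
    by (simp add: flux_def q_def Gb bl sym[OF z, of w \<xi>] power2_eq_square algebra_simps)
  have "((\<lambda>t. flux (z, \<xi> + t *\<^sub>R w) \<bullet> b) has_real_derivative
      A z * (q * gm z \<xi> \<xi> powr (q - 1) * (2 * gm z \<xi> w)) * gm z b \<xi> + A z * gm z \<xi> \<xi> powr q * gm z b w) (at 0)"
    unfolding f using N
    by (auto intro!: derivative_eq_intros simp: power2_eq_square)
  from DERIV_unique[OF 1 this] have "FD flux (z, \<xi>) (0, w) \<bullet> b =
      A z * gm z \<xi> \<xi> powr q * (gm z b w + 2 * q * gm z \<xi> w * gm z b \<xi> / gm z \<xi> \<xi>)"
    using N by (simp add: powr_diff algebra_simps)
  moreover have "1 - p = - (2 * q)" by (simp add: q_def diff_divide_distrib)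
  ultimately show ?thesis
    unfolding symb_def q_def[symmetric] by (simp add: sym[OF z, of \<xi> w] mult_ac)
qed

text \<open>On the diagonal the symbol is
  \<open>gm z v v - (gm z v \<xi>)\<^sup>2 / gm z \<xi> \<xi>\<close> plus \<open>p\<close> times a
  nonnegative square. The first part is nonnegative by Cauchy-Schwarz and is the symbol for exponent
  0, hence the comparison in the last clause.\<close>

lemma symb_props:
  assumes "(z, \<xi>) \<in> \<Omega>"
  shows "bilinear (symb z \<xi>)" "symb z \<xi> v w = symb z \<xi> w v" "0 \<le> symb z \<xi> v v"
    "gm z v v - (gm z v \<xi>)\<^sup>2 / gm z \<xi> \<xi> \<le> symb z \<xi> v v"
proof -
  have z: "z \<in> S" and N: "0 < gm z \<xi> \<xi>" using assms by (auto simp: \<Omega>_def)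
  note bl = bilinear_ladd[OF bil[OF z]] bilinear_radd[OF bil[OF z]]
    bilinear_lmul[OF bil[OF z]] bilinear_rmul[OF bil[OF z]]
  show "bilinear (symb z \<xi>)"
  proof -
    define k where "k = (1 - p) / gm z \<xi> \<xi>"
    have "symb z \<xi> = (\<lambda>v w. gm z v w - k * (gm z v \<xi> * gm z w \<xi>))"
      by (simp add: fun_eq_iff symb_def k_def)
    then show ?thesis
      unfolding bilinear_def by (auto intro!: linearI simp: bl algebra_simps)
  qed
  show "symb z \<xi> v w = symb z \<xi> w v" by (simp add: symb_def sym[OF z, of v w])
  have "0 \<le> p * ((gm z v \<xi>)\<^sup>2 / gm z \<xi> \<xi>)" using p_nonneg N by simp
  then show 1: "gm z v v - (gm z v \<xi>)\<^sup>2 / gm z \<xi> \<xi> \<le> symb z \<xi> v v"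
    by (simp add: symb_def power2_eq_square algebra_simps diff_divide_distrib)
  have "(gm z v \<xi>)\<^sup>2 / gm z \<xi> \<xi> \<le> gm z v v"
    using psd_Cauchy_Schwarz[OF bil[OF z] sym[OF z] psd[OF z], of v \<xi>] N by (simp add: pos_divide_le_eq)
  with 1 show "0 \<le> symb z \<xi> v v" by simp
qed

text \<open>The contraction of two positive semidefinite matrices is nonnegative. \<open>W\<close>
  will be a Hessian, of which only the sign of the quadratic form is known.\<close>

lemma symb_trace_nonneg:
  assumes "(z, \<xi>) \<in> \<Omega>" "linear W" "\<And>v. 0 \<le> W v \<bullet> v"
  shows "0 \<le> (\<Sum>b\<in>Basis. symb z \<xi> b (W b))"
proof -
  note s = symb_props[OF assms(1)]
  have "symb z \<xi> b (W b) = (\<Sum>c\<in>Basis. symb z \<xi> b c * (W b \<bullet> c))" for b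
    using linear_Basis_expand[of "symb z \<xi> b" "W b"] s(1) by (simp add: bilinear_def mult.commute)
  then have "(\<Sum>b\<in>Basis. symb z \<xi> b (W b)) = (\<Sum>b\<in>Basis. \<Sum>c\<in>Basis. symb z \<xi> b c * (W b \<bullet> c))" by simp
  also have "0 \<le> \<dots>"
  proof (rule sum_psd_mult_nonneg)
    fix c :: "'e \<Rightarrow> real"
    define v where "v = (\<Sum>b\<in>Basis. c b *\<^sub>R b)"
    have v: "v \<bullet> b = c b" if "b \<in> Basis" for b using that by (simp add: v_def inner_sum_Basis)
    have "(\<Sum>i\<in>Basis. \<Sum>j\<in>Basis. c i * c j * symb z \<xi> i j) = symb z \<xi> v v"
      by (subst bilinear_expand[OF s(1)]) (simp add: v)
    then show "0 \<le> (\<Sum>i\<in>Basis. \<Sum>j\<in>Basis. c i * c j * symb z \<xi> i j)" using s(3) by simp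
    have "bilinear (\<lambda>v w. W v \<bullet> w)"
      unfolding bilinear_def using assms(2)
      by (auto intro!: linearI simp: linear_add linear_scale inner_add_left inner_add_right)
    from bilinear_expand[OF this, of v v]
    have "(\<Sum>i\<in>Basis. \<Sum>j\<in>Basis. c i * c j * (W i \<bullet> j)) = W v \<bullet> v"
      by (simp add: v)
    then show "0 \<le> (\<Sum>i\<in>Basis. \<Sum>j\<in>Basis. c i * c j * (W i \<bullet> j))" using assms(3) by simp
  qed (use s(2) in auto)
  finally show ?thesis .
qed

text \<open>At a minimum of \<open>f - h\<close> the gradients agree, so the linear maps acting on
  the two Hessians coincide. The difference of the operators is then the symbol contracted with the
  Hessian of \<open>f - h\<close>, which is positive semidefinite.\<close>

lemma hop_compare_at_min:
  assumes f: "smooth_on S f" "smooth_on S h" "z \<in> S" "(z, covec_diff h z) \<in> \<Omega>"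
    and "0 < r" "\<And>y. dist y z < r \<Longrightarrow> f z - h z \<le> f y - h y"
  shows "hop h z \<le> hop f z"
proof -
  have sm: "smooth_on S (\<lambda>y. f y - h y)" by (rule smooth_on_minus[OF open_S f(1,2)])
  note min = smooth_local_min[OF open_S sm f(3) assms(5), OF assms(6)]
  have eq: "covec_diff (\<lambda>y. f y - h y) y = covec_diff f y - covec_diff h y" if "y \<in> S" for y
    using covec_diff_add_scaled[OF smooth_on_differentiable[OF f(1) that] smooth_on_differentiable[OF f(2) that], of "-1"]
    by simp
  then have same: "covec_diff f z = covec_diff h z" using min(1) f(3) by simp
  define W where "W = FD (covec_diff (\<lambda>y. f y - h y)) z"
  have dW: "(covec_diff (\<lambda>y. f y - h y) has_derivative W) (at z)"
    unfolding W_def by (rule smooth_on_has_derivative[OF smooth_on_covec_diff[OF open_S sm] f(3)])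
  have "((\<lambda>y. covec_diff f y - covec_diff h y) has_derivative
    (\<lambda>v. FD (covec_diff f) z v - FD (covec_diff h) z v)) (at z)"
    using smooth_on_has_derivative[OF smooth_on_covec_diff[OF open_S f(1)] f(3)]
      smooth_on_has_derivative[OF smooth_on_covec_diff[OF open_S f(2)] f(3)]
    by (rule has_derivative_diff)
  then have "(covec_diff (\<lambda>y. f y - h y) has_derivative
    (\<lambda>v. FD (covec_diff f) z v - FD (covec_diff h) z v)) (at z)"
    by (rule has_derivative_transform_within_open[OF _ open_S f(3)]) (simp add: eq)
  then have W: "W v = FD (covec_diff f) z v - FD (covec_diff h) z v" for v
    using has_derivative_unique[OF dW] by simp
  note lin = linear_D_flux[OF f(4)]
  have "hop f z - hop h z = (\<Sum>b\<in>Basis. FD flux (z, covec_diff h z) (0, W b) \<bullet> b) / A z"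
    unfolding hop_eq[OF open_S order_refl f(1,3), unfolded same, OF f(4)] hop_eq[OF open_S order_refl f(2,3,4)]
    by (simp add: diff_divide_distrib[symmetric] sum_subtractf[symmetric] inner_diff_left[symmetric]
        linear_diff[OF lin, symmetric] W)
  also have "\<dots> = gm z (covec_diff h z) (covec_diff h z) powr ((p - 1) / 2) *
      (\<Sum>b\<in>Basis. symb z (covec_diff h z) b (W b))"
    using A_nz[OF f(3)] by (simp add: D_flux_vertical[OF f(4)] sum_distrib_left[symmetric] mult.assoc)
  also have "0 \<le> \<dots>"
    using symb_trace_nonneg[OF f(4) has_derivative_linear[OF dW]] min(2) by (simp add: W_def)
  finally show ?thesis by simp
qed

text \<open>Hopf's argument: at a boundary point with interior sphere condition (here in the form of a
  proximal normal) the graph of \<open>\<psi>\<close> is touched from below by \<open>\<phi> + \<epsilon> h\<close>, where \<open>h\<close> is the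
  quadratic barrier \<open>\<nu> \<bullet> d - \<tau> |d|\<^sup>2 + \<kappa> (\<nu> \<bullet> d)\<^sup>2\<close> in \<open>d = z - z0\<close>.\<close>

lemma normal_characteristic:
  assumes \<phi>: "smooth_on S \<phi>" "\<And>z. z \<in> S \<Longrightarrow> 0 < gm z (covec_diff \<phi> z) (covec_diff \<phi> z)"
    and \<psi>: "smooth_on S \<psi>" and le: "\<And>z. z \<in> S \<Longrightarrow> \<phi> z \<le> \<psi> z"
    and hop_le: "\<And>z. z \<in> S \<Longrightarrow> hop \<psi> z \<le> hop \<phi> z"
    and z0: "z0 \<in> S" and \<nu>: "proximal_normal {z \<in> S. \<phi> z = \<psi> z} z0 \<nu>" and eq0: "\<phi> z0 = \<psi> z0"
  shows "symb z0 (covec_diff \<phi> z0) \<nu> \<nu> = 0"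
proof (rule ccontr)
  define \<xi> where "\<xi> = covec_diff \<phi>"
  have \<Omega>0: "(z, \<xi> z) \<in> \<Omega>" if "z \<in> S" for z using \<phi>(2) that by (simp add: \<Omega>_def \<xi>_def)
  assume "symb z0 (covec_diff \<phi> z0) \<nu> \<nu> \<noteq> 0"
  then have s0: "0 < symb z0 (\<xi> z0) \<nu> \<nu>"
    using symb_props(3)[OF \<Omega>0[OF z0], of \<nu>] by (simp add: \<xi>_def)
  obtain c \<rho> where c: "0 < \<rho>"
    "\<And>z. z \<in> S \<Longrightarrow> \<phi> z = \<psi> z \<Longrightarrow> dist z z0 < \<rho> \<Longrightarrow> \<nu> \<bullet> (z - z0) \<le> c * (dist z z0)\<^sup>2"
    using \<nu> unfolding proximal_normal_def by blast
  \<comment> \<open>A coincidence point at distance \<open>r\<close> satisfies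
    \<open>a \<le> c * r\<^sup>2\<close> for \<open>a = \<nu> \<bullet> (z - z0)\<close>. With small
    \<open>r\<close>, a nonnegative barrier there would require \<open>\<tau> * r\<^sup>2 \<le> a +
    \<bar>a\<bar> \<le> 2 * \<bar>c\<bar> * r\<^sup>2\<close>, which this \<tau> excludes.\<close>
  define \<tau> where "\<tau> = 2 * \<bar>c\<bar> + 1"
  have smooth_\<xi>: "smooth_on S \<xi>" unfolding \<xi>_def by (rule smooth_on_covec_diff[OF open_S \<phi>(1)])
  define H\<phi> where "H\<phi> z = FD \<xi> z" for z
  text \<open>\<open>R\<close> collects the contribution of the lower order terms, which does not depend on \<open>\<kappa>\<close>.\<close>
  define R where "R \<eta> = (\<Sum>b\<in>Basis. FD flux (z0, \<eta>) (b, H\<phi> z0 b) \<bullet> b)" for \<eta>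
  define \<Omega>z where "\<Omega>z = (\<lambda>\<eta>. (z0, \<eta>)) -` \<Omega>"
  have o\<Omega>z: "open \<Omega>z"
    unfolding \<Omega>z_def by (rule open_vimage[OF open_\<Omega>]) (intro continuous_intros)
  have \<Omega>z0: "\<xi> z0 \<in> \<Omega>z" using \<Omega>0[OF z0] by (simp add: \<Omega>z_def)
  have smooth_DF: "smooth_on \<Omega>z (\<lambda>\<eta>. FD flux (z0, \<eta>) w \<bullet> b)" for w b
    by (intro smooth_on_inner[OF o\<Omega>z] smooth_on_const smooth_on_compose[OF smooth_on_frechet_derivative[OF smooth_flux] _ o\<Omega>z open_\<Omega>]
        smooth_on_Pair[OF o\<Omega>z] smooth_on_ident) (simp add: \<Omega>z_def)
  have smooth_R: "smooth_on \<Omega>z R"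
    unfolding R_def[abs_def] by (intro smooth_on_sum[OF o\<Omega>z] smooth_DF)
  define N where "N = gm z0 (\<xi> z0) (\<xi> z0) powr ((p - 1) / 2)"
  have N: "0 < N" using \<Omega>0[OF z0] by (simp add: N_def \<Omega>_def)
  define R' where "R' = FD R (\<xi> z0) \<nu> / A z0"
  define tr where "tr = (\<Sum>b\<in>Basis. symb z0 (\<xi> z0) b b)"
  \<comment> \<open>Makes the rate of change of the operator under
    \<open>\<phi> + \<epsilon> h\<close>, namely \<open>R' + N * (2 * \<kappa> * symb z0 (\<xi> z0)
    \<nu> \<nu> - 2 * \<tau> * tr)\<close>, at least \<open>N\<close> for
    \<open>\<epsilon> = 0\<close> at \<open>z0\<close>.\<close>
  define \<kappa> where "\<kappa> = (\<bar>R'\<bar> / N + 2 * \<tau> * \<bar>tr\<bar> + 1) / (2 * symb z0 (\<xi> z0) \<nu> \<nu>)"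
  have \<tau>: "0 < \<tau>" by (simp add: \<tau>_def)
  have \<kappa>: "0 < \<kappa>" using s0 N \<tau> by (auto simp: \<kappa>_def intro!: divide_pos_pos add_nonneg_pos)
  define h where "h z = \<nu> \<bullet> (z - z0) - \<tau> * ((z - z0) \<bullet> (z - z0)) + \<kappa> * (\<nu> \<bullet> (z - z0))\<^sup>2" for z
  define hg where "hg z = \<nu> - (2 * \<tau>) *\<^sub>R (z - z0) + (2 * \<kappa> * (\<nu> \<bullet> (z - z0))) *\<^sub>R \<nu>" for z
  define hW where "hW v = - ((2 * \<tau>) *\<^sub>R v) + (2 * \<kappa> * (\<nu> \<bullet> v)) *\<^sub>R \<nu>" for v
  have dh: "(h has_derivative (\<lambda>v. hg z \<bullet> v)) (at z)" for z
    unfolding h_def hg_def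
    by (auto intro!: derivative_eq_intros simp: fun_eq_iff inner_commute algebra_simps power2_eq_square)
  have h_hg: "covec_diff h z = hg z" for z by (rule covec_diff_eqI[OF dh])
  have dhg: "(hg has_derivative hW) (at z)" for z
    unfolding hg_def hW_def by (auto intro!: derivative_eq_intros simp: fun_eq_iff algebra_simps)
  have smooth_h: "smooth_on S h"
    unfolding h_def[abs_def] power2_eq_square
    by (intro smooth_on_add[OF open_S] smooth_on_minus[OF open_S] smooth_on_mult[OF open_S] smooth_on_inner[OF open_S]
        smooth_on_const smooth_on_ident)
  have smooth_hg: "smooth_on S hg"
    using smooth_on_covec_diff[OF open_S smooth_h] unfolding h_hg[abs_def] .
  define T where "T = (\<lambda>w :: real \<times> 'e. (snd w, \<xi> (snd w) + fst w *\<^sub>R hg (snd w))) -` \<Omega> \<inter> (UNIV \<times> S)"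
  have oUS: "open ((UNIV :: real set) \<times> S)" using open_S by (simp add: open_Times)
  have smooth_arg: "smooth_on (UNIV \<times> S) (\<lambda>w :: real \<times> 'e. (snd w, \<xi> (snd w) + fst w *\<^sub>R hg (snd w)))"
  proof -
    have 1: "smooth_on (UNIV \<times> S) (snd :: real \<times> 'e \<Rightarrow> _)" "smooth_on (UNIV \<times> S) (fst :: real \<times> 'e \<Rightarrow> _)"
      using oUS by (auto intro: smooth_on_linear_map bounded_linear_fst bounded_linear_snd)
    have 2: "smooth_on (UNIV \<times> S) (\<lambda>w :: real \<times> 'e. \<xi> (snd w))" "smooth_on (UNIV \<times> S) (\<lambda>w :: real \<times> 'e. hg (snd w))"
      using smooth_on_compose[OF smooth_\<xi> 1(1) oUS open_S] smooth_on_compose[OF smooth_hg 1(1) oUS open_S] by auto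
    show ?thesis
      by (intro smooth_on_Pair[OF oUS] smooth_on_add[OF oUS] smooth_on_scaleR[OF oUS] 1 2)
  qed
  have oT: "open T"
    using smooth_on_continuous[OF smooth_arg] open_\<Omega> unfolding continuous_on_open_vimage[OF oUS] T_def by blast
  have TS: "T \<subseteq> UNIV \<times> S" by (auto simp: T_def)
  \<comment> \<open>The operator at \<open>\<phi> + \<epsilon> h\<close> as a function of the pair
    \<open>(\<epsilon>, z)\<close>. Its joint smoothness makes the sign of the \<epsilon>-derivative
    stable around \<open>(0, z0)\<close>.\<close>
  define K where "K w = (\<Sum>b\<in>Basis. FD flux (snd w, \<xi> (snd w) + fst w *\<^sub>R hg (snd w))
      (b, H\<phi> (snd w) b + fst w *\<^sub>R hW b) \<bullet> b) / A (snd w)" for w :: "real \<times> 'e"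
  have smooth_K: "smooth_on T K"
  proof -
    have 1: "smooth_on T (snd :: real \<times> 'e \<Rightarrow> _)" "smooth_on T (fst :: real \<times> 'e \<Rightarrow> _)"
      using oT by (auto intro: smooth_on_linear_map bounded_linear_fst bounded_linear_snd)
    have sT: "snd w \<in> S" if "w \<in> T" for w using that TS by auto
    have 2: "smooth_on T (\<lambda>w. H\<phi> (snd w) b)" for b
      unfolding H\<phi>_def
      by (rule smooth_on_compose[OF smooth_on_frechet_derivative[OF smooth_\<xi>, of b] 1(1) oT open_S sT])
    have 3: "smooth_on T (\<lambda>w. A (snd w))"
      by (rule smooth_on_compose[OF smooth_A 1(1) oT open_S sT])
    have 4: "smooth_on T (\<lambda>w. FD flux (snd w, \<xi> (snd w) + fst w *\<^sub>R hg (snd w))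
      (b, H\<phi> (snd w) b + fst w *\<^sub>R hW b))" for b
    proof (rule smooth_on_frechet_derivative_apply[OF smooth_flux smooth_on_subset[OF smooth_arg TS] _ oT open_\<Omega>])
      show "smooth_on T (\<lambda>w. (b, H\<phi> (snd w) b + fst w *\<^sub>R hW b))"
        by (intro smooth_on_Pair[OF oT] smooth_on_add[OF oT] smooth_on_scaleR[OF oT] smooth_on_const 1 2)
    qed (auto simp: T_def)
    have 5: "A (snd w) \<noteq> 0" if "w \<in> T" for w using that TS A_nz by auto
    show ?thesis
      unfolding K_def[abs_def]
      by (rule smooth_on_divide[OF oT _ 3 5])
        (intro smooth_on_sum[OF oT] smooth_on_inner[OF oT] 4 smooth_on_const)
  qed
  have hop_K: "hop (\<lambda>y. \<phi> y + \<epsilon> * h y) z = K (\<epsilon>, z)" and cov_K: "(z, covec_diff (\<lambda>y. \<phi> y + \<epsilon> * h y) z) \<in> \<Omega>"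
    if "(\<epsilon>, z) \<in> T" for \<epsilon> z
  proof -
    have z: "z \<in> S" using that TS by auto
    have ce: "covec_diff (\<lambda>y. \<phi> y + \<epsilon> * h y) y = \<xi> y + \<epsilon> *\<^sub>R hg y" if "y \<in> S" for y
      using covec_diff_add_scaled[OF smooth_on_differentiable[OF \<phi>(1) that] smooth_on_differentiable[OF smooth_h that]]
      by (simp add: \<xi>_def h_hg)
    have "((\<lambda>y. \<xi> y + \<epsilon> *\<^sub>R hg y) has_derivative (\<lambda>v. H\<phi> z v + \<epsilon> *\<^sub>R hW v)) (at z)"
      unfolding H\<phi>_def
      by (intro has_derivative_add has_derivative_scaleR_right dhg smooth_on_has_derivative[OF smooth_\<xi> z])
    then have "(covec_diff (\<lambda>y. \<phi> y + \<epsilon> * h y) has_derivative (\<lambda>v. H\<phi> z v + \<epsilon> *\<^sub>R hW v)) (at z)"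
      by (rule has_derivative_transform_within_open[OF _ open_S z]) (simp add: ce)
    note D = frechet_derivative_at[OF this, symmetric]
    show c: "(z, covec_diff (\<lambda>y. \<phi> y + \<epsilon> * h y) z) \<in> \<Omega>"
      using that z by (simp add: ce T_def)
    have "smooth_on S (\<lambda>y. \<phi> y + \<epsilon> * h y)"
      by (intro smooth_on_add[OF open_S] smooth_on_mult[OF open_S] smooth_on_const \<phi>(1) smooth_h)
    from hop_eq[OF open_S order_refl this z c]
    show "hop (\<lambda>y. \<phi> y + \<epsilon> * h y) z = K (\<epsilon>, z)"
      by (simp add: K_def D ce[OF z])
  qed
  have T0: "(0, z0) \<in> T" using z0 \<Omega>0[OF z0] by (simp add: T_def)
  have hg0: "hg z0 = \<nu>" by (simp add: hg_def)
  \<comment> \<open>At \<open>z0\<close> the numerator of \<open>K\<close> splits into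
    \<open>R (\<xi> z0 + \<epsilon> *\<^sub>R \<nu>)\<close> and
    \<open>\<epsilon> * Q \<epsilon>\<close>. The second term has derivative \<open>Q 0\<close>, the
    only place where \<kappa> enters.\<close>
  have Dpos: "0 < FD K (0, z0) (1, 0)"
  proof -
    define Q where "Q \<epsilon> = (\<Sum>b\<in>Basis. FD flux (z0, \<xi> z0 + \<epsilon> *\<^sub>R \<nu>) (0, hW b) \<bullet> b)" for \<epsilon>
    define I where "I = (\<lambda>\<epsilon>::real. \<xi> z0 + \<epsilon> *\<^sub>R \<nu>) -` \<Omega>z"
    have oI: "open I"
      unfolding I_def by (rule open_vimage[OF o\<Omega>z]) (intro continuous_intros)
    have I0: "0 \<in> I" using \<Omega>z0 by (simp add: I_def)
    have dl: "((\<lambda>\<epsilon>::real. \<xi> z0 + \<epsilon> *\<^sub>R \<nu>) has_derivative (\<lambda>\<epsilon>. \<epsilon> *\<^sub>R \<nu>)) (at 0)"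
      by (auto intro!: derivative_eq_intros)
    have sI: "smooth_on I (\<lambda>\<epsilon>::real. \<xi> z0 + \<epsilon> *\<^sub>R \<nu>)"
      by (intro smooth_on_add[OF oI] smooth_on_scaleR[OF oI] smooth_on_const smooth_on_ident)
    have "smooth_on I Q"
      unfolding Q_def[abs_def]
      by (intro smooth_on_sum[OF oI] smooth_on_compose[OF smooth_DF sI oI o\<Omega>z]) (simp add: I_def)
    then have dQ: "((\<lambda>\<epsilon>. \<epsilon> * Q \<epsilon>) has_derivative (\<lambda>\<epsilon>. \<epsilon> * Q 0)) (at 0)"
      using smooth_on_has_derivative[of I Q 0] I0
      by (auto intro!: derivative_eq_intros)
    have linR: "linear (FD R (\<xi> z0))"
      using smooth_on_differentiable[OF smooth_R \<Omega>z0] by (rule linear_frechet_derivative)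
    have "((\<lambda>\<epsilon>. R (\<xi> z0 + \<epsilon> *\<^sub>R \<nu>)) has_derivative (\<lambda>\<epsilon>. FD R (\<xi> z0) (\<epsilon> *\<^sub>R \<nu>))) (at 0)"
      by (rule has_derivative_compose[OF dl]) (use smooth_on_has_derivative[OF smooth_R \<Omega>z0] in simp)
    from has_derivative_add[OF this dQ]
    have "((\<lambda>\<epsilon>. R (\<xi> z0 + \<epsilon> *\<^sub>R \<nu>) + \<epsilon> * Q \<epsilon>) has_derivative
        (\<lambda>\<epsilon>. \<epsilon> * (FD R (\<xi> z0) \<nu> + Q 0))) (at 0)"
      by (elim has_derivative_eq_rhs) (simp add: fun_eq_iff linear_scale[OF linR] algebra_simps)
    from has_derivative_mult_left[OF this, of "inverse (A z0)"]
    have 1: "((\<lambda>\<epsilon>. (R (\<xi> z0 + \<epsilon> *\<^sub>R \<nu>) + \<epsilon> * Q \<epsilon>) / A z0) has_derivative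
        (\<lambda>\<epsilon>. \<epsilon> * (FD R (\<xi> z0) \<nu> + Q 0) / A z0)) (at 0)"
      by (simp add: divide_inverse)
    have K0: "(R (\<xi> z0 + \<epsilon> *\<^sub>R \<nu>) + \<epsilon> * Q \<epsilon>) / A z0 = K (\<epsilon>, z0)" if "\<epsilon> \<in> I" for \<epsilon>
    proof -
      have "(z0, \<xi> z0 + \<epsilon> *\<^sub>R \<nu>) \<in> \<Omega>" using that by (simp add: I_def \<Omega>z_def)
      note l = linear_D_flux[OF this]
      have "FD flux (z0, \<xi> z0 + \<epsilon> *\<^sub>R \<nu>) (b, H\<phi> z0 b + \<epsilon> *\<^sub>R hW b) =
        FD flux (z0, \<xi> z0 + \<epsilon> *\<^sub>R \<nu>) (b, H\<phi> z0 b) +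
        \<epsilon> *\<^sub>R FD flux (z0, \<xi> z0 + \<epsilon> *\<^sub>R \<nu>) (0, hW b)" for b
        using linear_add[OF l, of "(b, H\<phi> z0 b)" "\<epsilon> *\<^sub>R (0, hW b)"] linear_scale[OF l, of \<epsilon> "(0, hW b)"] by simp
      then show ?thesis
        by (simp add: K_def R_def Q_def hg0 inner_add_left sum.distrib sum_distrib_left)
    qed
    have 2: "((\<lambda>\<epsilon>. K (\<epsilon>, z0)) has_derivative
        (\<lambda>\<epsilon>. \<epsilon> * (FD R (\<xi> z0) \<nu> + Q 0) / A z0)) (at 0)"
      by (rule has_derivative_transform_within_open[OF 1 oI I0]) (rule K0)
    have dp: "((\<lambda>\<epsilon>::real. (\<epsilon>, z0)) has_derivative (\<lambda>\<epsilon>. (\<epsilon>, 0))) (at 0)"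
      by (auto intro!: derivative_eq_intros)
    have 3: "((\<lambda>\<epsilon>. K (\<epsilon>, z0)) has_derivative (\<lambda>\<epsilon>. FD K (0, z0) (\<epsilon>, 0))) (at 0)"
      by (rule has_derivative_compose[OF dp smooth_on_has_derivative[OF smooth_K T0]])
    have Q0: "Q 0 = A z0 * N * (2 * \<kappa> * symb z0 (\<xi> z0) \<nu> \<nu> - 2 * \<tau> * tr)"
    proof -
      note bl = symb_props(1)[OF \<Omega>0[OF z0]]
      have "(\<Sum>b\<in>Basis. (\<nu> \<bullet> b) * symb z0 (\<xi> z0) b \<nu>) = symb z0 (\<xi> z0) \<nu> \<nu>"
        using linear_Basis_expand[of "\<lambda>v. symb z0 (\<xi> z0) v \<nu>" \<nu>] bl by (simp add: bilinear_def)
      moreover have "symb z0 (\<xi> z0) b (hW b) = 2 * \<kappa> * ((\<nu> \<bullet> b) * symb z0 (\<xi> z0) b \<nu>) - 2 * \<tau> * symb z0 (\<xi> z0) b b" for b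
        by (simp add: hW_def bilinear_radd[OF bl] bilinear_rneg[OF bl] bilinear_rsub[OF bl] bilinear_rmul[OF bl])
      ultimately have "(\<Sum>b\<in>Basis. symb z0 (\<xi> z0) b (hW b)) = 2 * \<kappa> * symb z0 (\<xi> z0) \<nu> \<nu> - 2 * \<tau> * tr"
        by (simp add: sum_subtractf sum_distrib_left[symmetric] tr_def)
      then show ?thesis
        using D_flux_vertical[OF \<Omega>0[OF z0]]
        by (simp add: Q_def N_def sum_distrib_left[symmetric])
    qed
    have "FD K (0, z0) (1, 0) = (FD R (\<xi> z0) \<nu> + Q 0) / A z0"
      using fun_cong[OF has_derivative_unique[OF 3 2], of 1] by simp
    also have "\<dots> = R' + N * (2 * \<kappa> * symb z0 (\<xi> z0) \<nu> \<nu> - 2 * \<tau> * tr)"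
      using A_nz[OF z0] by (simp add: R'_def Q0 add_divide_distrib)
    also have "2 * \<kappa> * symb z0 (\<xi> z0) \<nu> \<nu> = \<bar>R'\<bar> / N + 2 * \<tau> * \<bar>tr\<bar> + 1"
      using s0 by (simp add: \<kappa>_def)
    also have "R' + N * (\<bar>R'\<bar> / N + 2 * \<tau> * \<bar>tr\<bar> + 1 - 2 * \<tau> * tr) =
      R' + \<bar>R'\<bar> + N * (2 * \<tau> * (\<bar>tr\<bar> - tr)) + N"
      using N by (simp add: algebra_simps)
    also have "0 < \<dots>"
    proof -
      have "0 \<le> N * (2 * \<tau> * (\<bar>tr\<bar> - tr))" using N \<tau> by simp
      then show ?thesis using N by linarith
    qed
    finally show ?thesis .
  qed
  have "open ((\<lambda>w. FD K w (1, 0)) -` {0<..} \<inter> T)"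
    using smooth_on_continuous[OF smooth_on_frechet_derivative[OF smooth_K, of "(1, 0)"]]
    unfolding continuous_on_open_vimage[OF oT] by simp
  then obtain r1 where r1: "0 < r1" "ball (0, z0) r1 \<subseteq> (\<lambda>w. FD K w (1, 0)) -` {0<..} \<inter> T"
    using Dpos T0 by (metis (no_types, lifting) IntI greaterThan_iff openE vimageI)
  have near: "(\<epsilon>, z) \<in> T \<and> 0 < FD K (\<epsilon>, z) (1, 0)"
    if "\<bar>\<epsilon>\<bar> < r1 / 2" "dist z z0 < r1 / 2" for \<epsilon> z
  proof -
    have "dist (0, z0) (\<epsilon>, z) \<le> dist 0 \<epsilon> + dist z0 z"
      using sqrt_sum_squares_le_sum_abs[of \<epsilon> "dist z0 z"] by (simp add: dist_prod_def)
    also have "\<dots> < r1" using that by (simp add: dist_commute)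
    finally show ?thesis using r1(2) by auto
  qed
  have K_less: "K (0, z) < K (\<epsilon>, z)" if "0 < \<epsilon>" "\<epsilon> < r1 / 2" "dist z z0 < r1 / 2" for \<epsilon> z
  proof (rule DERIV_pos_imp_increasing[OF that(1)])
    fix s assume s: "0 \<le> s" "s \<le> \<epsilon>"
    have n: "(s, z) \<in> T" "0 < FD K (s, z) (1, 0)" using near[of s z] s that by auto
    have dp: "((\<lambda>\<epsilon>::real. (\<epsilon>, z)) has_derivative (\<lambda>\<epsilon>. \<epsilon> *\<^sub>R (1, 0))) (at s)"
      by (auto intro!: derivative_eq_intros)
    have d1: "((\<lambda>\<epsilon>. K (\<epsilon>, z)) has_derivative (\<lambda>\<epsilon>. FD K (s, z) (\<epsilon> *\<^sub>R (1, 0)))) (at s)"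
      by (rule has_derivative_compose[OF dp smooth_on_has_derivative[OF smooth_K n(1)]])
    have d2: "FD K (s, z) (\<epsilon> *\<^sub>R (1, 0)) = FD K (s, z) (1, 0) * \<epsilon>" for \<epsilon>
      using linear_scale[OF linear_frechet_derivative[OF smooth_on_differentiable[OF smooth_K n(1)]], of \<epsilon> "(1, 0)"]
      by simp
    have "((\<lambda>\<epsilon>. K (\<epsilon>, z)) has_real_derivative FD K (s, z) (1, 0)) (at s)"
      unfolding has_field_derivative_def by (rule has_derivative_eq_rhs[OF d1]) (rule ext, rule d2)
    then show "\<exists>y. ((\<lambda>\<epsilon>. K (\<epsilon>, z)) has_real_derivative y) (at s) \<and> 0 < y" using n(2) by blast
  qed
  obtain rS where rS: "0 < rS" "ball z0 rS \<subseteq> S" using open_S z0 openE by blast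
  \<comment> \<open>The sphere has to lie within the range of the normal inequality, inside
    \<open>S\<close> and where \<open>K\<close> increases in \<epsilon>. The last bound makes
    \<open>\<kappa> * norm \<nu> * r < 1\<close>, so that the term
    \<open>\<kappa> (\<nu> \<bullet> d)\<^sup>2\<close> is dominated by
    \<open>\<bar>\<nu> \<bullet> d\<bar>\<close>.\<close>
  define r where "r = min (min \<rho> rS) (min (r1 / 2) (1 / (\<kappa> * norm \<nu> + 1))) / 2"
  have \<kappa>\<nu>: "0 < \<kappa> * norm \<nu> + 1" using \<kappa> by (simp add: add_nonneg_pos)
  have r: "0 < r" "r < \<rho>" "r < rS" "r < r1 / 2" "\<kappa> * norm \<nu> * r < 1"
  proof -
    have "0 < min (min \<rho> rS) (min (r1 / 2) (1 / (\<kappa> * norm \<nu> + 1)))"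
      using c(1) rS(1) r1(1) \<kappa>\<nu> by simp
    then show r: "0 < r" "r < \<rho>" "r < rS" "r < r1 / 2" by (auto simp: r_def)
    have "2 * r \<le> 1 / (\<kappa> * norm \<nu> + 1)" by (simp add: r_def)
    then have "r < 1 / (\<kappa> * norm \<nu> + 1)" using r(1) by linarith
    then have "r * (\<kappa> * norm \<nu> + 1) < 1" using \<kappa>\<nu> by (simp add: pos_less_divide_eq)
    then show "\<kappa> * norm \<nu> * r < 1" using r(1) by (simp add: algebra_simps)
  qed
  have cS: "cball z0 r \<subseteq> S" using rS(2) r(3) by auto
  have pos: "\<phi> z < \<psi> z" if z: "z \<in> sphere z0 r" "0 \<le> h z" for z
  proof (rule ccontr)
    have zS: "z \<in> S" using z cS by auto
    have d: "dist z z0 = r" using z by (simp add: dist_commute)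
    assume "\<not> \<phi> z < \<psi> z"
    then have "\<phi> z = \<psi> z" using le[OF zS] by simp
    then have 1: "\<nu> \<bullet> (z - z0) \<le> c * r\<^sup>2" using c(2)[OF zS] d r(2) by simp
    define a where "a = \<nu> \<bullet> (z - z0)"
    have "\<bar>a\<bar> \<le> norm \<nu> * r" using Cauchy_Schwarz_ineq2[of \<nu> "z - z0"] d by (simp add: a_def dist_norm)
    then have "\<kappa> * \<bar>a\<bar> \<le> \<kappa> * (norm \<nu> * r)" using \<kappa> by simp
    then have \<kappa>a: "\<kappa> * \<bar>a\<bar> < 1" using r(5) by (simp add: mult.assoc)
    have "0 \<le> a - \<tau> * r\<^sup>2 + \<kappa> * a\<^sup>2"
      using z(2) d by (simp add: h_def a_def dot_square_norm dist_norm)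
    moreover have "\<kappa> * a\<^sup>2 \<le> \<bar>a\<bar>"
      using mult_right_mono[of "\<kappa> * \<bar>a\<bar>" 1 "\<bar>a\<bar>"] \<kappa>a by (simp add: power2_eq_square mult.assoc)
    ultimately have 2: "\<tau> * r\<^sup>2 \<le> a + \<bar>a\<bar>" by linarith
    have "c * r\<^sup>2 \<le> \<bar>c\<bar> * r\<^sup>2" by (simp add: mult_right_mono)
    moreover have "\<tau> * r\<^sup>2 = 2 * (\<bar>c\<bar> * r\<^sup>2) + r\<^sup>2" by (simp add: \<tau>_def algebra_simps)
    moreover have "0 < r\<^sup>2" "0 \<le> \<bar>c\<bar> * r\<^sup>2" using r(1) by simp_all
    ultimately show False using 1 2 unfolding a_def[symmetric] by linarith
  qed
  have cont_h: "continuous_on (cball z0 r) h" and cont_w: "continuous_on (cball z0 r) (\<lambda>z. \<psi> z - \<phi> z)"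
    using smooth_on_continuous[OF smooth_h] smooth_on_continuous[OF \<phi>(1)] smooth_on_continuous[OF \<psi>]
    by (auto intro!: continuous_intros continuous_on_subset[OF _ cS])
  \<comment> \<open>By compactness the positive gap \<open>\<psi> - \<phi>\<close> dominates a
    multiple of \<open>h\<close> on the part of the sphere where \<open>h\<close> is nonnegative.
    The quotient uses \<open>h + 1\<close> because \<open>h\<close> may vanish there.\<close>
  obtain m where m: "0 < m" "\<And>z. z \<in> sphere z0 r \<Longrightarrow> 0 \<le> h z \<Longrightarrow> m * h z \<le> \<psi> z - \<phi> z"
  proof (cases "sphere z0 r \<inter> {z. 0 \<le> h z} = {}")
    case True
    then have "False" if "z \<in> sphere z0 r" "0 \<le> h z" for z using that by blast
    then show thesis using that[of 1] zero_less_one by blast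
  next
    case False
    have cs: "continuous_on (sphere z0 r) h"
      using cont_h by (rule continuous_on_subset) (rule sphere_cball)
    have "closed (sphere z0 r \<inter> {z. 0 \<le> h z})"
      using continuous_closed_preimage[OF cs closed_sphere closed_atLeast[of 0]]
      by (simp add: vimage_def Int_def)
    then have "compact (sphere z0 r \<inter> {z. 0 \<le> h z})"
      by (metis Int_absorb Int_assoc compact_Int_closed compact_sphere inf_commute)
    moreover have "continuous_on (sphere z0 r \<inter> {z. 0 \<le> h z}) (\<lambda>z. (\<psi> z - \<phi> z) / (h z + 1))"
    proof (intro continuous_on_divide)
      have "sphere z0 r \<inter> {z. 0 \<le> h z} \<subseteq> cball z0 r" by auto
      then show "continuous_on (sphere z0 r \<inter> {z. 0 \<le> h z}) (\<lambda>z. \<psi> z - \<phi> z)"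
        "continuous_on (sphere z0 r \<inter> {z. 0 \<le> h z}) (\<lambda>z. h z + 1)"
        using continuous_on_subset[OF cont_w] continuous_on_subset[OF cont_h]
        by (blast, intro continuous_on_add continuous_on_const) blast
    qed auto
    ultimately have "\<exists>y\<in>sphere z0 r \<inter> {z. 0 \<le> h z}. \<forall>z\<in>sphere z0 r \<inter> {z. 0 \<le> h z}.
        (\<psi> y - \<phi> y) / (h y + 1) \<le> (\<psi> z - \<phi> z) / (h z + 1)"
      using False by (intro continuous_attains_inf)
    then obtain y where y: "y \<in> sphere z0 r" "0 \<le> h y"
      "\<And>z. z \<in> sphere z0 r \<Longrightarrow> 0 \<le> h z \<Longrightarrow> (\<psi> y - \<phi> y) / (h y + 1) \<le> (\<psi> z - \<phi> z) / (h z + 1)"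
      by blast
    define m where "m = (\<psi> y - \<phi> y) / (h y + 1)"
    have m: "0 < m" using pos[OF y(1,2)] y(2) by (simp add: m_def)
    have "m * h z \<le> \<psi> z - \<phi> z" if "z \<in> sphere z0 r" "0 \<le> h z" for z
    proof -
      have "m * (h z + 1) \<le> \<psi> z - \<phi> z"
        using y(3)[OF that] that(2) unfolding m_def[symmetric] by (simp add: pos_le_divide_eq)
      then show ?thesis using m by (simp add: algebra_simps)
    qed
    then show thesis using that m by blast
  qed
  define \<epsilon> where "\<epsilon> = min m (r1 / 4)"
  have \<epsilon>: "0 < \<epsilon>" "\<epsilon> \<le> m" "\<epsilon> < r1 / 2" using m(1) r1(1) by (auto simp: \<epsilon>_def)
  define f where "f z = \<psi> z - (\<phi> z + \<epsilon> * h z)" for z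
  have bd: "0 \<le> f z" if "z \<in> sphere z0 r" for z
  proof (cases "0 \<le> h z")
    case True
    then have "\<epsilon> * h z \<le> m * h z" using \<epsilon> by (simp add: mult_right_mono)
    then show ?thesis using m(2)[OF that True] by (simp add: f_def)
  next
    case False
    then have "\<epsilon> * h z \<le> 0" using \<epsilon>(1) by (simp add: mult_nonneg_nonpos)
    moreover have "z \<in> S" using that cS by auto
    ultimately show ?thesis using le[of z] by (simp add: f_def)
  qed
  have f0: "f z0 = 0" by (simp add: f_def h_def eq0)
  have "continuous_on (cball z0 r) (\<lambda>z. (\<psi> z - \<phi> z) - \<epsilon> * h z)"
    by (intro continuous_intros cont_h cont_w)
  then have "continuous_on (cball z0 r) f" by (simp add: f_def[abs_def] algebra_simps)
  then obtain y where y: "y \<in> cball z0 r" "\<And>z. z \<in> cball z0 r \<Longrightarrow> f y \<le> f z"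
    using continuous_attains_inf[of "cball z0 r" f] r(1) by auto
  \<comment> \<open>\<open>f\<close> is nonnegative on the sphere and zero at the centre, so if a
    minimum is attained on the sphere, the centre is a minimum as well.\<close>
  obtain zs where zs: "zs \<in> ball z0 r" "\<And>z. z \<in> cball z0 r \<Longrightarrow> f zs \<le> f z"
  proof (cases "y \<in> ball z0 r")
    case True
    then show thesis using that y by blast
  next
    case False
    then have "y \<in> sphere z0 r" using y(1) by auto
    then have "f z0 \<le> f z" if "z \<in> cball z0 r" for z using y(2)[OF that] bd f0 by fastforce
    then show thesis using that[of z0] r(1) by simp
  qed
  have zsS: "zs \<in> S" using zs(1) cS by auto
  have d: "dist zs z0 < r1 / 2" using zs(1) r(4) by (simp add: dist_commute)
  have "(\<epsilon>, zs) \<in> T" "(0, zs) \<in> T" using near[of \<epsilon> zs] near[of 0 zs] \<epsilon> d r1(1) by auto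
  have "hop (\<lambda>y. \<phi> y + \<epsilon> * h y) zs \<le> hop \<psi> zs"
  proof (rule hop_compare_at_min[OF \<psi> _ zsS cov_K[OF \<open>(\<epsilon>, zs) \<in> T\<close>]])
    show "smooth_on S (\<lambda>y. \<phi> y + \<epsilon> * h y)"
      by (intro smooth_on_add[OF open_S] smooth_on_mult[OF open_S] smooth_on_const \<phi>(1) smooth_h)
    show "0 < r - dist zs z0" using zs(1) by (simp add: dist_commute)
    fix y assume "dist y zs < r - dist zs z0"
    then have "y \<in> cball z0 r" using dist_triangle[of z0 y zs] by (simp add: dist_commute)
    then show "\<psi> zs - (\<phi> zs + \<epsilon> * h zs) \<le> \<psi> y - (\<phi> y + \<epsilon> * h y)" using zs(2) by (simp add: f_def)
  qed
  \<comment> \<open>The barrier pushes the operator at \<open>\<phi> + \<epsilon> h\<close> strictly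
    above that at \<phi>, while the touching point and the hypothesis bound it by the
    latter.\<close>
  then have "K (\<epsilon>, zs) \<le> hop \<phi> zs"
    using hop_K[OF \<open>(\<epsilon>, zs) \<in> T\<close>] hop_le[OF zsS] by simp
  moreover have "hop \<phi> zs = K (0, zs)"
    using hop_K[OF \<open>(0, zs) \<in> T\<close>] by simp
  ultimately show False using K_less[OF \<epsilon>(1,3) d] by simp
qed

end

section \<open>The divergence formula for the curvature of a graph\<close>

lemma wedge1_Nil [simp]: "wedge1 \<eta> \<alpha> [] = 0"
  by (simp add: wedge1_def)

text \<open>Contraction with \<open>v\<close> is an antiderivation. This recursion on the argument
  list carries all identities for forms in this section.\<close>

lemma wedge1_Cons:
  "wedge1 \<eta> \<alpha> (v # vs) = (\<eta> \<bullet> v) * \<alpha> vs - wedge1 \<eta> (\<lambda>ws. \<alpha> (v # ws)) vs"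
  unfolding wedge1_def
  by (simp add: sum.lessThan_Suc_shift omit_nth_def sum_negf[symmetric] del: sum.lessThan_Suc)

lemma wedge1_scale: "wedge1 \<eta> (\<lambda>vs. k * \<alpha> vs) vs = k * wedge1 \<eta> \<alpha> vs"
  unfolding wedge1_def sum_distrib_left by (simp add: mult_ac)

lemma wedge1_diff: "wedge1 \<eta> (\<lambda>vs. \<alpha> vs - \<beta> vs) vs = wedge1 \<eta> \<alpha> vs - wedge1 \<eta> \<beta> vs"
  unfolding wedge1_def by (simp add: right_diff_distrib sum_subtractf)

text \<open>Two applications of the recursion produce terms antisymmetric in \<open>a\<close> and
  \<open>b\<close>, plus the same expression on a shorter list. The case \<open>a = b\<close> says
  that a covector wedges with itself to zero.\<close>

lemma wedge1_anticommute: "wedge1 a (wedge1 b \<alpha>) vs = - wedge1 b (wedge1 a \<alpha>) vs"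
proof (induction vs arbitrary: \<alpha>)
  case Nil
  then show ?case by simp
next
  case (Cons v vs)
  have "wedge1 a (wedge1 b \<alpha>) (v # vs) = (a \<bullet> v) * wedge1 b \<alpha> vs - (b \<bullet> v) * wedge1 a \<alpha> vs
      + wedge1 a (wedge1 b (\<lambda>ws. \<alpha> (v # ws))) vs" for a b
    by (simp add: wedge1_Cons wedge1_diff wedge1_scale)
  from this[of a b] this[of b a] show ?case using Cons.IH[of "\<lambda>ws. \<alpha> (v # ws)"] by simp
qed

lemma wedge1_coord_form_member: "e \<in> set es \<Longrightarrow> wedge1 e (coord_form es) vs = 0"
proof (induction es arbitrary: vs)
  case Nil
  then show ?case by simp
next
  case (Cons c es)
  show ?case
  proof (cases "e = c")
    case True
    then show ?thesis using wedge1_anticommute[of c c "coord_form es" vs] by (simp add: coord_form_def)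
  next
    case False
    then have "wedge1 e (coord_form es) = (\<lambda>_. 0)" using Cons by auto
    then show ?thesis
      using wedge1_anticommute[of e c "coord_form es" vs] by (simp add: coord_form_def wedge1_def)
  qed
qed

text \<open>A covector is a combination of coordinate covectors, and each of these already occurs as
  a factor of the form.\<close>

lemma wedge1_coord_form:
  fixes \<eta> :: "'e::euclidean_space"
  assumes "set es = Basis"
  shows "wedge1 \<eta> (coord_form es) vs = 0"
proof -
  have key: "\<eta> \<bullet> w = (\<Sum>b\<in>Basis. (\<eta> \<bullet> b) * (b \<bullet> w))" for w
    using euclidean_inner[of \<eta> w] by (simp add: inner_commute[of w])
  have "wedge1 \<eta> (coord_form es) vs =
    (\<Sum>i<length vs. \<Sum>b\<in>Basis. (\<eta> \<bullet> b) * ((-1) ^ i * (b \<bullet> vs ! i) * coord_form es (omit_nth i vs)))"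
    unfolding wedge1_def
    by (intro sum.cong refl, subst key) (simp add: sum_distrib_left sum_distrib_right mult_ac)
  also have "\<dots> = (\<Sum>b\<in>Basis. (\<eta> \<bullet> b) * wedge1 b (coord_form es) vs)"
    unfolding wedge1_def by (subst sum.swap) (simp add: sum_distrib_left)
  also have "\<dots> = 0" using wedge1_coord_form_member[of _ es vs] assms by simp
  finally show ?thesis .
qed

lemma linear_coord_form: "linear (\<lambda>v. coord_form es (v # ws))"
proof (induction es arbitrary: ws)
  case Nil
  then show ?case by (simp add: coord_form_def linear_zero)
next
  case (Cons c es)
  have "coord_form (c # es) (v # ws) = (c \<bullet> v) * coord_form es ws -
      (\<Sum>i<length ws. (-1) ^ i * (c \<bullet> ws ! i) * coord_form es (v # omit_nth i ws))" for v
    using wedge1_Cons[of c "coord_form es" v ws] by (simp add: coord_form_def wedge1_def)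
  moreover have "linear (\<lambda>v. (c \<bullet> v) * coord_form es ws -
      (\<Sum>i<length ws. (-1) ^ i * (c \<bullet> ws ! i) * coord_form es (v # omit_nth i ws)))"
    by (intro linear_compose_sub linear_compose_sum ballI linearI)
      (auto simp: inner_add_right algebra_simps linear_add[OF Cons.IH] linear_scale[OF Cons.IH])
  ultimately show ?case by simp
qed

text \<open>Contracting the vanishing form \<open>\<eta> \<and> dv\<close> with \<open>X\<close>,
  the vector dual to \<omega>, gives \<open>\<eta> \<and> (dv contracted with X) = (\<eta> \<bullet>
  X) dv\<close>. This is the defining property, so the form in question is the ordinary contraction
  with \<open>X\<close>.\<close>

lemma interior_form_eq:
  fixes g :: "('a, 'e::euclidean_space) cometric"
  assumes alt: "alternating_form DIM('e) (dv c q)" and es: "set es = Basis"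
    and dv: "\<And>vs. dv c q vs = a * coord_form es vs"
    and X: "\<And>\<eta>. \<eta> \<bullet> X = g c q \<eta> \<omega>"
  shows "interior_form g dv c q \<omega> = (\<lambda>vs. dv c q (X # vs))"
  unfolding interior_form_def
proof (rule the_equality)
  define \<beta> where "\<beta> vs = dv c q (X # vs)" for vs
  note alt = alt[unfolded alternating_form_def]
  have w: "wedge1 \<eta> \<beta> vs = g c q \<eta> \<omega> * dv c q vs" for \<eta> vs
  proof -
    have "wedge1 \<eta> (dv c q) (X # vs) = 0"
      unfolding dv wedge1_scale[of _ _ "coord_form es", folded dv] wedge1_scale[of \<eta> a "coord_form es"]
      using wedge1_coord_form[OF es, of \<eta> "X # vs"] wedge1_scale[of \<eta> a "coord_form es" "X # vs"] dv
      by (metis (no_types, lifting) ext mult_zero_right)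
    then show ?thesis
      using wedge1_Cons[of \<eta> "dv c q" X vs] by (simp add: \<beta>_def[abs_def] X)
  qed
  show al: "alternating_form (DIM('e) - 1) (\<lambda>vs. dv c q (X # vs)) \<and>
      (\<forall>\<eta>. wedge1 \<eta> (\<lambda>vs. dv c q (X # vs)) = (\<lambda>vs. g c q \<eta> \<omega> * dv c q vs))"
  proof (intro conjI allI)
    show "wedge1 \<eta> (\<lambda>vs. dv c q (X # vs)) = (\<lambda>vs. g c q \<eta> \<omega> * dv c q vs)" for \<eta>
      using w[of \<eta>] unfolding \<beta>_def by blast
    show "alternating_form (DIM('e) - 1) (\<lambda>vs. dv c q (X # vs))"
      unfolding alternating_form_def
    proof (intro conjI allI impI)
      fix vs :: "'e list" assume "length vs \<noteq> DIM('e) - 1"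
      then have "length (X # vs) \<noteq> DIM('e)" by auto
      then show "dv c q (X # vs) = 0" using alt by blast
    next
      fix vs :: "'e list" and i assume "length vs = DIM('e) - 1 \<and> i < DIM('e) - 1"
      then have "length (X # vs) = DIM('e) \<and> Suc i < DIM('e)" by auto
      then have "linear (\<lambda>v. dv c q ((X # vs)[Suc i := v]))" using alt by blast
      then show "linear (\<lambda>v. dv c q (X # vs[i := v]))" by simp
    next
      fix vs :: "'e list" and i j assume "length vs = DIM('e) - 1 \<and> i < j \<and> j < DIM('e) - 1 \<and> vs ! i = vs ! j"
      then have "length (X # vs) = DIM('e) \<and> Suc i < Suc j \<and> Suc j < DIM('e) \<and> (X # vs) ! Suc i = (X # vs) ! Suc j"
        by auto
      then show "dv c q (X # vs) = 0" using alt by blast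
    qed
  qed
  fix \<alpha> assume \<alpha>: "alternating_form (DIM('e) - 1) \<alpha> \<and>
      (\<forall>\<eta>. wedge1 \<eta> \<alpha> = (\<lambda>vs. g c q \<eta> \<omega> * dv c q vs))"
  show "\<alpha> = (\<lambda>vs. dv c q (X # vs))"
  proof
    fix vs
    show "\<alpha> vs = dv c q (X # vs)"
    proof (cases "length vs = DIM('e) - 1")
      case False
      then show ?thesis using \<alpha> al unfolding alternating_form_def by metis
    next
      case True
      \<comment> \<open>Uniqueness: fewer vectors than the dimension leave a nonzero \<eta>
        orthogonal to all of them. Evaluated at \<open>\<eta> # vs\<close>, the wedge with \<eta>
        returns \<open>(\<eta> \<bullet> \<eta>) * \<alpha> vs\<close>.\<close>
      have "dim (set vs) \<le> card (set vs)" by (simp add: dim_le_card')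
      also have "\<dots> \<le> DIM('e) - 1" using card_length[of vs] True by simp
      finally have "dim (set vs) < DIM('e)" using DIM_positive[where 'a='e] by linarith
      then obtain \<eta> where \<eta>0: "\<eta> \<noteq> 0" "\<And>y. y \<in> span (set vs) \<Longrightarrow> orthogonal \<eta> y"
        using orthogonal_to_subspace_exists by blast
      then have \<eta>: "\<eta> \<noteq> 0" "\<eta> \<bullet> y = 0" if "y \<in> set vs" for y
        using span_base[OF that] by (simp_all add: orthogonal_def)
      have "wedge1 \<eta> \<gamma> (\<eta> # vs) = (\<eta> \<bullet> \<eta>) * \<gamma> vs" for \<gamma>
        using \<eta>(2) unfolding wedge1_Cons by (simp add: wedge1_def)
      from this[of \<alpha>] this[of \<beta>] have "(\<eta> \<bullet> \<eta>) * \<alpha> vs = (\<eta> \<bullet> \<eta>) * \<beta> vs"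
        using \<alpha> w by simp
      then show ?thesis using \<eta>0(1) by (simp add: \<beta>_def)
    qed
  qed
qed

lemma sharp_eq:
  fixes g :: "('a, 'e::euclidean_space) cometric"
  assumes "bilinear (g c q)"
  shows "sharp g c q \<eta> = (\<Sum>b\<in>Basis. g c q b \<eta> *\<^sub>R b)" "\<omega> \<bullet> sharp g c q \<eta> = g c q \<omega> \<eta>"
proof -
  have 1: "\<omega> \<bullet> (\<Sum>b\<in>Basis. g c q b \<eta> *\<^sub>R b) = g c q \<omega> \<eta>" for \<omega>
    using linear_Basis_expand[of "\<lambda>\<omega>. g c q \<omega> \<eta>" \<omega>] assms
    by (simp add: bilinear_def inner_sum_right mult.commute)
  show s: "sharp g c q \<eta> = (\<Sum>b\<in>Basis. g c q b \<eta> *\<^sub>R b)"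
    unfolding sharp_def
  proof (rule the_equality)
    fix v assume "\<forall>\<omega>. \<omega> \<bullet> v = g c q \<omega> \<eta>"
    then have "\<omega> \<bullet> v = \<omega> \<bullet> (\<Sum>b\<in>Basis. g c q b \<eta> *\<^sub>R b)" for \<omega> using 1 by simp
    then show "v = (\<Sum>b\<in>Basis. g c q b \<eta> *\<^sub>R b)" by (metis vector_eq_ldot)
  qed (use 1 in blast)
  show "\<omega> \<bullet> sharp g c q \<eta> = g c q \<omega> \<eta>" unfolding s by (rule 1)
qed

text \<open>The classical identity that the exterior derivative of a volume form contracted with
  \<open>F\<close> is the divergence of \<open>F\<close> times the volume form.\<close>

lemma ext_deriv_coord_form:
  fixes F :: "'e::euclidean_space \<Rightarrow> 'e"
  assumes es: "set es = Basis" and T: "open T" "z \<in> T"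
    and \<alpha>: "\<And>y vs. y \<in> T \<Longrightarrow> \<alpha> y vs = coord_form es (F y # vs)"
    and F: "(F has_derivative F') (at z)"
  shows "ext_deriv \<alpha> z ws = (\<Sum>b\<in>Basis. F' b \<bullet> b) * coord_form es ws"
proof -
  have linF: "linear F'" using F by (rule has_derivative_linear)
  have fd: "FD (\<lambda>y. \<alpha> y vs) z v = coord_form es (F' v # vs)" for vs v
  proof -
    have "bounded_linear (\<lambda>v. coord_form es (v # vs))"
      using linear_coord_form by (rule linear_conv_bounded_linear[THEN iffD1])
    from bounded_linear.has_derivative[OF this F]
    have "((\<lambda>y. \<alpha> y vs) has_derivative (\<lambda>v. coord_form es (F' v # vs))) (at z)"
      by (rule has_derivative_transform_within_open[OF _ T]) (simp add: \<alpha>)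
    from frechet_derivative_at[OF this] show ?thesis by metis
  qed
  \<comment> \<open>The differential of the \<open>b\<close>-th component of \<open>F\<close>. The
    derivative becomes the sum over \<open>b\<close> of \<open>\<eta> b\<close> wedged with the
    contraction by \<open>b\<close>, and \<open>wedge1_Cons\<close> reduces each summand to
    \<open>\<eta> b \<bullet> b\<close> times the volume form.\<close>
  define \<eta> where "\<eta> b = (\<Sum>c\<in>Basis. (F' c \<bullet> b) *\<^sub>R c)" for b
  have \<eta>: "\<eta> b \<bullet> w = F' w \<bullet> b" for b w
    using linear_Basis_expand[OF linF, of w]
    by (simp add: \<eta>_def inner_sum_left inner_commute[of w] mult.commute)
  have "coord_form es (F' w # vs) = (\<Sum>b\<in>Basis. (\<eta> b \<bullet> w) * coord_form es (b # vs))" for w vs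
    using linear_Basis_expand[OF linear_coord_form[of es vs], of "F' w"] by (simp add: \<eta>)
  then have "ext_deriv \<alpha> z ws =
    (\<Sum>i<length ws. \<Sum>b\<in>Basis. (-1) ^ i * (\<eta> b \<bullet> ws ! i) * coord_form es (b # omit_nth i ws))"
    unfolding ext_deriv_def fd by (simp add: sum_distrib_left mult.assoc)
  also have "\<dots> = (\<Sum>b\<in>Basis. wedge1 (\<eta> b) (\<lambda>ws. coord_form es (b # ws)) ws)"
    unfolding wedge1_def by (rule sum.swap)
  also have "\<dots> = (\<Sum>b\<in>Basis. (F' b \<bullet> b) * coord_form es ws)"
    using wedge1_Cons[of _ "coord_form es" _ ws] wedge1_coord_form[OF es]
    by (intro sum.cong refl) (simp add: \<eta> wedge1_Cons[of _ "coord_form es", symmetric] algebra_simps)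
  finally show ?thesis by (simp add: sum_distrib_right)
qed

context divergence_operator
begin

text \<open>Contracting \<open>dv\<close> with the vector dual to the normalised differential is
  contracting the coordinate form with \<open>flux\<close>, the density included. The curvature is
  then the divergence of the flux over \<open>A\<close>; the description is unique because
  \<open>dv\<close> does not vanish.\<close>

lemma p_mean_curvature_eq_hop:
  fixes g :: "('a, 'e) cometric"
  assumes T: "open T" "T \<subseteq> S" "z \<in> T" and \<phi>: "smooth_on T \<phi>"
    and es: "set es = Basis" and nz: "\<exists>vs. dv c (chart_inv c z) vs \<noteq> 0"
    and alt: "\<And>y. y \<in> T \<Longrightarrow> alternating_form DIM('e) (dv c (chart_inv c y))"
    and dv: "\<And>y vs. y \<in> T \<Longrightarrow> dv c (chart_inv c y) vs = A y * coord_form es vs"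
    and g: "\<And>y. y \<in> T \<Longrightarrow> g c (chart_inv c y) = gm y"
    and pos: "\<And>y. y \<in> T \<Longrightarrow> 0 < gm y (covec_diff \<phi> y) (covec_diff \<phi> y)"
  shows "p_mean_curvature g dv c p \<phi> z = hop \<phi> z"
proof -
  define F where "F y = flux (y, covec_diff \<phi> y)" for y
  have int: "interior_form g dv c (chart_inv c y)
      ((1 / conorm g c (chart_inv c y) (covec_diff \<phi> y) powr (1 - p)) *\<^sub>R covec_diff \<phi> y) vs =
      coord_form es (F y # vs)" if y: "y \<in> T" for y vs
  proof -
    have yS: "y \<in> S" using y T(2) by blast
    define N where "N = gm y (covec_diff \<phi> y) (covec_diff \<phi> y)"
    have N: "0 < N" using pos[OF y] by (simp add: N_def)
    define k where "k = 1 / conorm g c (chart_inv c y) (covec_diff \<phi> y) powr (1 - p)"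
    have "conorm g c (chart_inv c y) (covec_diff \<phi> y) = N powr (1 / 2)"
      using N by (simp only: conorm_def g[OF y] N_def[symmetric] powr_half_sqrt less_imp_le)
    then have "k = N powr (- (1 / 2 * (1 - p)))"
      unfolding k_def by (simp only: powr_powr powr_minus_divide)
    also have "- (1 / 2 * (1 - p)) = (p - 1) / 2" by (simp add: diff_divide_distrib)
    finally have k: "k = N powr ((p - 1) / 2)" .
    have "bilinear (g c (chart_inv c y))" using bil[OF yS] g[OF y] by simp
    note sh = sharp_eq[of g c "chart_inv c y", OF this]
    have "sharp g c (chart_inv c y) (k *\<^sub>R covec_diff \<phi> y) = k *\<^sub>R G y (covec_diff \<phi> y)"
      unfolding sh(1) G_def scaleR_sum_right
      by (simp add: g[OF y] bilinear_rmul[OF bil[OF yS]])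
    then have "F y = A y *\<^sub>R sharp g c (chart_inv c y) (k *\<^sub>R covec_diff \<phi> y)"
      by (simp add: F_def flux_def k N_def)
    moreover have "interior_form g dv c (chart_inv c y) (k *\<^sub>R covec_diff \<phi> y) vs =
        dv c (chart_inv c y) (sharp g c (chart_inv c y) (k *\<^sub>R covec_diff \<phi> y) # vs)"
      using interior_form_eq[of dv c "chart_inv c y" es "A y" _ g "k *\<^sub>R covec_diff \<phi> y", OF alt[OF y] es dv[OF y] sh(2)] by simp
    ultimately show ?thesis
      unfolding k_def[symmetric] by (simp add: dv[OF y] linear_scale[OF linear_coord_form])
  qed
  have z: "z \<in> S" "(z, covec_diff \<phi> z) \<in> \<Omega>" using T pos[OF T(3)] by (auto simp: \<Omega>_def)
  have "((\<lambda>y. (y, covec_diff \<phi> y)) has_derivative (\<lambda>b. (b, FD (covec_diff \<phi>) z b))) (at z)"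
    using smooth_on_has_derivative[OF smooth_on_covec_diff[OF T(1) \<phi>] T(3)]
    by (intro has_derivative_Pair has_derivative_ident)
  then have "((\<lambda>y. flux (y, covec_diff \<phi> y)) has_derivative
    (\<lambda>b. FD flux (z, covec_diff \<phi> z) (b, FD (covec_diff \<phi>) z b))) (at z)"
    by (rule has_derivative_compose) (rule smooth_on_has_derivative[OF smooth_flux z(2)])
  then have "F differentiable (at z)"
    unfolding F_def[abs_def] differentiable_def by blast
  then have dF: "(F has_derivative FD F z) (at z)"
    by (simp add: frechet_derivative_works)
  define d where "d = (\<Sum>b\<in>Basis. FD F z b \<bullet> b)"
  have hop: "hop \<phi> z = d / A z" by (simp add: hop_def d_def F_def[abs_def])
  have ext: "ext_deriv (\<lambda>y. interior_form g dv c (chart_inv c y)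
      ((1 / conorm g c (chart_inv c y) (covec_diff \<phi> y) powr (1 - p)) *\<^sub>R covec_diff \<phi> y)) z vs =
      d * coord_form es vs" for vs
    unfolding d_def by (rule ext_deriv_coord_form[OF es T(1,3) int dF])
  obtain vs0 where "dv c (chart_inv c z) vs0 \<noteq> 0" using nz by blast
  then have vs0: "coord_form es vs0 \<noteq> 0" using dv[OF T(3)] by auto
  show ?thesis
    unfolding p_mean_curvature_def ext dv[OF T(3)] hop
  proof (rule the_equality)
    show "\<forall>vs. d * coord_form es vs = d / A z * (A z * coord_form es vs)" using A_nz[OF z(1)] by simp
    show "h = d / A z" if "\<forall>vs. d * coord_form es vs = h * (A z * coord_form es vs)" for h
      using that[rule_format, of vs0] vs0 A_nz[OF z(1)] by (simp add: field_simps)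
  qed
qed

end

section \<open>Charts and local sections\<close>

lemma chart_inv_into: "z \<in> snd c ` fst c \<Longrightarrow> chart_inv c z \<in> fst c"
  and chart_chart_inv: "z \<in> snd c ` fst c \<Longrightarrow> snd c (chart_inv c z) = z"
  by (auto intro: inv_into_into f_inv_into_f)

lemma chart_inv_chart: "is_chart c \<Longrightarrow> q \<in> fst c \<Longrightarrow> chart_inv c (snd c q) = q"
  unfolding is_chart_def using homeomorphism_apply1 by blast

lemma chart_open_image:
  assumes "is_chart c" "open W"
  shows "open (snd c ` (fst c \<inter> W))"
proof -
  have h: "homeomorphism (fst c) (snd c ` fst c) (snd c) (chart_inv c)" "open (snd c ` fst c)"
    using assms(1) unfolding is_chart_def by blast+
  have "openin (top_of_set (fst c)) (fst c \<inter> W)" using assms(2) by blast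
  from homeomorphism_imp_open_map[OF h(1) this] show ?thesis
    using h(2) openin_open_trans by blast
qed

lemma smooth_transition:
  assumes "smooth_structure M" "c \<in> M" "c' \<in> M"
  shows "smooth_on (snd c ` (fst c \<inter> fst c')) (\<lambda>z. snd c' (chart_inv c z))"
  using assms unfolding smooth_structure_def smooth_compatible_def by (auto simp: comp_def)

lemma smooth_structure_chart: "smooth_structure M \<Longrightarrow> c \<in> M \<Longrightarrow> is_chart c"
  by (simp add: smooth_structure_def)

lemma chart_diff_id:
  "chart_diff c c' id q = FD (\<lambda>z. snd c' (chart_inv c z)) (snd c q)"
  by (simp add: chart_diff_def comp_def)

lemma chart_diff_has_derivative:
  assumes M: "smooth_structure M" "c \<in> M" "c' \<in> M" and q: "q \<in> fst c" "q \<in> fst c'"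
  shows "((\<lambda>z. snd c' (chart_inv c z)) has_derivative chart_diff c c' id q) (at (snd c q))"
  unfolding chart_diff_id
  by (rule smooth_on_has_derivative[OF smooth_transition[OF M]]) (use q in auto)

lemma chart_diff_comp:
  assumes M: "smooth_structure M" "c \<in> M" "c' \<in> M" "c'' \<in> M"
    and q: "q \<in> fst c" "q \<in> fst c'" "q \<in> fst c''"
  shows "chart_diff c c'' id q v = chart_diff c' c'' id q (chart_diff c c' id q v)"
proof -
  note ch = smooth_structure_chart[OF M(1)]
  have "((\<lambda>z. snd c'' (chart_inv c' (snd c' (chart_inv c z)))) has_derivative
      (\<lambda>v. chart_diff c' c'' id q (chart_diff c c' id q v))) (at (snd c q))"
    by (rule has_derivative_compose[OF chart_diff_has_derivative[OF M(1,2,3) q(1,2)]])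
      (use chart_diff_has_derivative[OF M(1,3,4) q(2,3)] in \<open>simp only: chart_inv_chart[OF ch[OF M(2)] q(1)]\<close>)
  moreover have "open (snd c ` (fst c \<inter> fst c'))"
    using chart_open_image[OF ch[OF M(2)]] ch[OF M(3)] unfolding is_chart_def by blast
  ultimately have "((\<lambda>z. snd c'' (chart_inv c z)) has_derivative
      (\<lambda>v. chart_diff c' c'' id q (chart_diff c c' id q v))) (at (snd c q))"
    by (rule has_derivative_transform_within_open)
      (use q in \<open>auto simp: chart_inv_chart[OF ch[OF M(2)]] chart_inv_chart[OF ch[OF M(3)]]\<close>)
  from has_derivative_unique[OF chart_diff_has_derivative[OF M(1,2,4) q(1,3)] this]
  show ?thesis by (rule fun_cong)
qed

lemma chart_diff_self:
  assumes "smooth_structure M" "c \<in> M" "q \<in> fst c"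
  shows "chart_diff c c id q v = v"
proof -
  have "is_chart c" using assms smooth_structure_chart by blast
  then have "open (snd c ` fst c)" by (simp add: is_chart_def)
  then have "((\<lambda>z. snd c (chart_inv c z)) has_derivative (\<lambda>v. v)) (at (snd c q))"
    by (rule has_derivative_transform_within_open[OF has_derivative_ident])
      (use assms(3) chart_chart_inv[of _ c] in auto)
  from has_derivative_unique[OF chart_diff_has_derivative[OF assms(1,2,2,3,3)] this]
  show ?thesis by simp
qed

section \<open>Independent families and their transport to all charts\<close>

text \<open>Indexed coefficients make repeated vectors count as dependence and behave well under
  linear maps and perturbation; the next lemma translates to the pair of conditions used for
  sections.\<close>

definition independent_family :: "nat \<Rightarrow> (nat \<Rightarrow> 'e::real_vector) \<Rightarrow> bool" where
  "independent_family k f \<longleftrightarrow> (\<forall>a. (\<Sum>i<k. a i *\<^sub>R f i) = 0 \<longrightarrow> (\<forall>i<k. a i = 0))"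

lemma independent_family_iff:
  fixes f :: "nat \<Rightarrow> 'e::euclidean_space"
  shows "independent_family k f \<longleftrightarrow> inj_on f {..<k} \<and> independent (f ` {..<k})"
proof
  assume f: "independent_family k f"
  have inj: "inj_on f {..<k}"
  proof (rule inj_onI, rule ccontr)
    fix i j assume ij: "i \<in> {..<k}" "j \<in> {..<k}" "f i = f j" "i \<noteq> j"
    define a where "a l = (if l = i then 1 else 0) - (if l = j then 1 else (0::real))" for l
    have "(\<Sum>l<k. a l *\<^sub>R f l) = (\<Sum>l<k. (if l = i then f l else 0) - (if l = j then f l else 0))"
      by (intro sum.cong) (auto simp: a_def)
    also have "\<dots> = 0" using ij by (simp add: sum_subtractf)
    finally have "a i = 0" using f ij(1) by (auto simp: independent_family_def)
    then show False using ij(4) by (simp add: a_def)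
  qed
  moreover have "independent (f ` {..<k})"
    unfolding independent_explicit
  proof (intro conjI allI impI ballI)
    fix a v assume "(\<Sum>v\<in>f ` {..<k}. a v *\<^sub>R v) = 0" and v: "v \<in> f ` {..<k}"
    then have "(\<Sum>i<k. a (f i) *\<^sub>R f i) = 0" using inj by (simp add: sum.reindex)
    then have "\<forall>i<k. a (f i) = 0"
      using f[unfolded independent_family_def, rule_format, of "\<lambda>i. a (f i)"] by blast
    then show "a v = 0" using v by auto
  qed simp
  ultimately show "inj_on f {..<k} \<and> independent (f ` {..<k})" ..
next
  assume f: "inj_on f {..<k} \<and> independent (f ` {..<k})"
  show "independent_family k f"
    unfolding independent_family_def
  proof (intro allI impI)
    fix a i assume s: "(\<Sum>i<k. a i *\<^sub>R f i) = 0" and i: "i < k"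
    define b where "b v = a (inv_into {..<k} f v)" for v
    have "(\<Sum>v\<in>f ` {..<k}. b v *\<^sub>R v) = (\<Sum>i<k. a i *\<^sub>R f i)"
      using f by (simp add: sum.reindex b_def)
    then have "b (f i) = 0" using f s i unfolding independent_explicit by auto
    then show "a i = 0" using f i by (simp add: b_def)
  qed
qed

lemma independent_family_inj_linear:
  assumes "independent_family k f" "linear L" "\<And>v. L v = 0 \<Longrightarrow> v = 0"
  shows "independent_family k (\<lambda>i. L (f i))"
  unfolding independent_family_def
proof (intro allI impI)
  fix a i assume "(\<Sum>i<k. a i *\<^sub>R L (f i)) = 0" and i: "i < k"
  then have "L (\<Sum>i<k. a i *\<^sub>R f i) = 0" by (simp add: linear_sum[OF assms(2)] linear_scale[OF assms(2)])
  then show "a i = 0" using assms(1,3) i by (auto simp: independent_family_def)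
qed

text \<open>Stability of independence: in terms of functionals dual to \<open>f x\<close>, the matrix of \<open>f y\<close> is
  diagonally dominant for \<open>y\<close> near \<open>x\<close>.\<close>

lemma independent_family_eventually:
  fixes f :: "'t::topological_space \<Rightarrow> nat \<Rightarrow> 'e::euclidean_space"
  assumes ind: "independent_family k (f x)"
    and cont: "\<And>i. i < k \<Longrightarrow> ((\<lambda>y. f y i) \<longlongrightarrow> f x i) (nhds x)"
  shows "\<forall>\<^sub>F y in nhds x. independent_family k (f y)"
proof -
  have inj: "inj_on (f x) {..<k}" and indep: "independent (f x ` {..<k})"
    using ind by (auto simp: independent_family_iff)
  have "\<exists>w. \<forall>i<k. w \<bullet> f x i = (if i = j then 1 else 0)" if "j < k" for j
  proof -
    obtain h where h: "linear h" "\<And>v. v \<in> f x ` {..<k} \<Longrightarrow> h v = (if v = f x j then 1 else (0::real))"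
      using linear_independent_extend[OF indep, of "\<lambda>v. if v = f x j then 1 else (0::real)"] by blast
    define w where "w = (\<Sum>b\<in>Basis. h b *\<^sub>R b)"
    have "w \<bullet> v = h v" for v
      using linear_Basis_expand[OF h(1), of v]
      by (simp add: w_def inner_sum_left inner_commute[of v] mult.commute)
    then show ?thesis using h(2) inj that by (intro exI[of _ w]) (auto simp: inj_on_def)
  qed
  then obtain w where w: "\<And>i j. i < k \<Longrightarrow> j < k \<Longrightarrow> w j \<bullet> f x i = (if i = j then 1 else 0)" by metis
  \<comment> \<open>For the largest coefficient \<open>a j\<close> of a vanishing combination one
    gets \<open>\<bar>a j\<bar> \<le> real k * \<epsilon> * \<bar>a j\<bar>\<close>, and
    \<open>real k * \<epsilon> < 1\<close>.\<close>
  define \<epsilon> where "\<epsilon> = 1 / (real k + 1)"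
  have \<epsilon>: "0 < \<epsilon>" by (simp add: \<epsilon>_def)
  have "\<forall>\<^sub>F y in nhds x. \<forall>i\<in>{..<k}. \<forall>j\<in>{..<k}. \<bar>w j \<bullet> f y i - w j \<bullet> f x i\<bar> < \<epsilon>"
  proof (intro eventually_ball_finite finite_lessThan ballI)
    fix i j assume "i \<in> {..<k}"
    then have "((\<lambda>y. w j \<bullet> f y i) \<longlongrightarrow> w j \<bullet> f x i) (nhds x)"
      using cont by (intro tendsto_intros) auto
    from tendstoD[OF this \<epsilon>] show "\<forall>\<^sub>F y in nhds x. \<bar>w j \<bullet> f y i - w j \<bullet> f x i\<bar> < \<epsilon>"
      by (simp add: dist_real_def)
  qed
  then show ?thesis
  proof (rule eventually_mono)
    fix y assume y: "\<forall>i\<in>{..<k}. \<forall>j\<in>{..<k}. \<bar>w j \<bullet> f y i - w j \<bullet> f x i\<bar> < \<epsilon>"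
    show "independent_family k (f y)"
      unfolding independent_family_def
    proof (intro allI impI)
      fix a i assume s: "(\<Sum>i<k. a i *\<^sub>R f y i) = 0" and i: "i < k"
      obtain j where j: "j \<in> {..<k}" "\<And>l. l \<in> {..<k} \<Longrightarrow> \<bar>a l\<bar> \<le> \<bar>a j\<bar>"
      proof -
        define m where "m = Max ((\<lambda>l. \<bar>a l\<bar>) ` {..<k})"
        have "m \<in> (\<lambda>l. \<bar>a l\<bar>) ` {..<k}" unfolding m_def using i by (intro Max_in) auto
        moreover have "\<bar>a l\<bar> \<le> m" if "l \<in> {..<k}" for l unfolding m_def using that by (intro Max_ge) auto
        ultimately show thesis using that by blast
      qed
      have "0 = w j \<bullet> (\<Sum>l<k. a l *\<^sub>R f y l)" using s by simp
      also have "\<dots> = (\<Sum>l<k. a l * (w j \<bullet> f x l)) + (\<Sum>l<k. a l * (w j \<bullet> f y l - w j \<bullet> f x l))"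
        by (simp add: inner_sum_right sum.distrib[symmetric] algebra_simps)
      also have "(\<Sum>l<k. a l * (w j \<bullet> f x l)) = (\<Sum>l<k. if l = j then a l else 0)"
        using w j(1) by (intro sum.cong) auto
      also have "\<dots> = a j" using j(1) by simp
      finally have "\<bar>a j\<bar> = \<bar>\<Sum>l<k. a l * (w j \<bullet> f y l - w j \<bullet> f x l)\<bar>" by simp
      also have "\<dots> \<le> (\<Sum>l<k. \<bar>a j\<bar> * \<epsilon>)"
        using y j by (intro order_trans[OF sum_abs] sum_mono) (auto simp: abs_mult less_imp_le intro!: mult_mono)
      also have "\<dots> = \<bar>a j\<bar> * (real k * \<epsilon>)" by simp
      finally have "\<bar>a j\<bar> * (1 - real k * \<epsilon>) \<le> 0" by (simp add: algebra_simps)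
      moreover have "1 - real k * \<epsilon> = \<epsilon>" by (simp add: \<epsilon>_def field_simps)
      ultimately have "\<bar>a j\<bar> \<le> 0" using \<epsilon> by (simp add: mult_le_0_iff)
      then show "a i = 0" using j(2)[of i] i by simp
    qed
  qed
qed

text \<open>Fields constructed in one chart are pushed to every other by the coordinate differential
  \<open>L\<close>. Horizontality survives because invariance of the cometric gives
  \<open>L (sharp \<eta>) = sharp (adjoint L' \<eta>)\<close> with \<open>L'\<close> the
  differential of the inverse change.\<close>

lemma independent_sections_lift:
  fixes M :: "('a::{t2_space, second_countable_topology}, 'e::euclidean_space) chart set"
  assumes sr: "subriemannian_manifold M g" and c0: "c0 \<in> M" and W: "open W" "W \<subseteq> fst c0"
    and X: "\<And>i. i < k \<Longrightarrow> smooth_on (snd c0 ` W) (X i)"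
    and hor: "\<And>i q. i < k \<Longrightarrow> q \<in> W \<Longrightarrow> X i (snd c0 q) \<in> horizontal g c0 q"
    and ind: "\<And>q. q \<in> W \<Longrightarrow> independent_family k (\<lambda>i. X i (snd c0 q))"
  shows "independent_sections M g W k (\<lambda>i c q. chart_diff c0 c id q (X i (snd c0 q)))"
proof -
  have M: "smooth_structure M" using sr by (simp add: subriemannian_manifold_def)
  note ch = smooth_structure_chart[OF M]
  have vf: "vector_field M W (\<lambda>c q. chart_diff c0 c id q (X i (snd c0 q)))" if i: "i < k" for i
    unfolding vector_field_def
  proof (intro conjI ballI)
    fix c assume c: "c \<in> M"
    have oc: "open (fst c)" "open (fst c0)" using ch[OF c] ch[OF c0] by (simp_all add: is_chart_def)
    have o1: "open (snd c ` (fst c \<inter> W))" using chart_open_image[OF ch[OF c] W(1)] .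
    have o2: "open (snd c0 ` (fst c0 \<inter> fst c))" using chart_open_image[OF ch[OF c0] oc(1)] .
    have oW: "open (snd c0 ` W)" using chart_open_image[OF ch[OF c0] W(1)] W(2) by (simp add: Int_absorb1)
    have s1: "smooth_on (snd c ` (fst c \<inter> W)) (\<lambda>z. snd c0 (chart_inv c z))"
      by (rule smooth_on_subset[OF smooth_transition[OF M c c0]]) (use W(2) in auto)
    have inv: "chart_inv c z \<in> fst c \<inter> W" if "z \<in> snd c ` (fst c \<inter> W)" for z
      using that chart_inv_chart[OF ch[OF c]] by auto
    have s2: "smooth_on (snd c ` (fst c \<inter> W)) (\<lambda>z. X i (snd c0 (chart_inv c z)))"
      by (rule smooth_on_compose[OF X[OF i] s1 o1 oW]) (use inv in auto)
    show "smooth_on (snd c ` (fst c \<inter> W)) (\<lambda>z. chart_diff c0 c id (chart_inv c z) (X i (snd c0 (chart_inv c z))))"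
      unfolding chart_diff_id
      by (rule smooth_on_frechet_derivative_apply[OF smooth_transition[OF M c0 c] s1 s2 o1 o2])
        (use inv W(2) in auto)
  next
    fix c c' q assume "c \<in> M" "c' \<in> M" "q \<in> W \<inter> fst c \<inter> fst c'"
    then show "chart_diff c0 c' id q (X i (snd c0 q)) = chart_diff c c' id q (chart_diff c0 c id q (X i (snd c0 q)))"
      using W(2) by (intro chart_diff_comp[OF M c0]) auto
  qed
  have pt: "(\<forall>i<k. chart_diff c0 c id q (X i (snd c0 q)) \<in> horizontal g c q) \<and>
      independent_family k (\<lambda>i. chart_diff c0 c id q (X i (snd c0 q)))"
    if c: "c \<in> M" and q: "q \<in> W \<inter> fst c" for c q
  proof -
    have q0: "q \<in> fst c0" and qc: "q \<in> fst c" and qW: "q \<in> W" using q W(2) by auto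
    define L where "L = chart_diff c0 c id q"
    define L' where "L' = chart_diff c c0 id q"
    have LL: "L' (L v) = v" for v
      unfolding L_def L'_def
      using chart_diff_comp[OF M c0 c c0 q0 qc q0] chart_diff_self[OF M c0 q0] by simp
    have lin: "linear L" "linear L'"
      unfolding L_def L'_def
      using chart_diff_has_derivative[OF M c0 c q0 qc] chart_diff_has_derivative[OF M c c0 qc q0]
        has_derivative_linear by blast+
    have bc: "bilinear (g c q)" and bc0: "bilinear (g c0 q)"
      and pres: "preserves_cometric M g id q"
      using sr c c0 qc q0 unfolding subriemannian_manifold_def by blast+
    have "L v \<in> horizontal g c q" if v: "v \<in> horizontal g c0 q" for v
    proof -
      obtain \<eta> where \<eta>: "v = sharp g c0 q \<eta>" using v by (auto simp: horizontal_def)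
      have adj: "adjoint L (adjoint L' \<eta>) = \<eta>"
      proof -
        have "w \<bullet> adjoint L (adjoint L' \<eta>) = w \<bullet> \<eta>" for w
          by (simp add: adjoint_works lin LL)
        then show ?thesis by (metis vector_eq_ldot)
      qed
      have "\<omega> \<bullet> L v = \<omega> \<bullet> sharp g c q (adjoint L' \<eta>)" for \<omega>
      proof -
        have "\<omega> \<bullet> L v = adjoint L \<omega> \<bullet> v"
          using adjoint_works[OF lin(1), of v \<omega>] by (simp add: inner_commute)
        also have "\<dots> = g c0 q (adjoint L \<omega>) (adjoint L (adjoint L' \<eta>))"
          unfolding \<eta> adj by (rule sharp_eq(2)[of g c0 q, OF bc0])
        also have "\<dots> = g c q \<omega> (adjoint L' \<eta>)"
          using pres c0 c q0 qc unfolding preserves_cometric_def L_def by simp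
        also have "\<dots> = \<omega> \<bullet> sharp g c q (adjoint L' \<eta>)"
          by (rule sharp_eq(2)[of g c q, OF bc, symmetric])
        finally show ?thesis .
      qed
      then have "L v = sharp g c q (adjoint L' \<eta>)" by (metis vector_eq_ldot)
      then show ?thesis by (simp add: horizontal_def)
    qed
    moreover have "independent_family k (\<lambda>i. L (X i (snd c0 q)))"
    proof (rule independent_family_inj_linear[OF ind[OF qW] lin(1)])
      show "v = 0" if "L v = 0" for v using LL[of v] that linear_0[OF lin(2)] by simp
    qed
    ultimately show ?thesis using hor qW unfolding L_def by blast
  qed
  show ?thesis
    unfolding independent_sections_def
    using vf pt by (auto simp: independent_family_iff)
qed

section \<open>Fields tangent to the coincidence set\<close>

lemma proximal_normal_Int_open:
  assumes "proximal_normal (Z \<inter> U) z \<nu>" "open U" "z \<in> U"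
  shows "proximal_normal Z z \<nu>"
proof -
  obtain r where r: "0 < r" "ball z r \<subseteq> U" using assms(2,3) openE by blast
  obtain c \<rho> where c: "0 < \<rho>" "\<And>y. y \<in> Z \<inter> U \<Longrightarrow> dist y z < \<rho> \<Longrightarrow> \<nu> \<bullet> (y - z) \<le> c * (dist y z)\<^sup>2"
    using assms(1) unfolding proximal_normal_def by blast
  show ?thesis
    unfolding proximal_normal_def
  proof (intro exI conjI ballI impI)
    show "0 < min r \<rho>" using r c by simp
    fix y assume y: "y \<in> Z" "dist y z < min r \<rho>"
    then have "y \<in> U" using r(2) by (auto simp: dist_commute subset_iff)
    then show "\<nu> \<bullet> (y - z) \<le> c * (dist y z)\<^sup>2" using c(2) y by simp
  qed
qed

lemma tangent_field_Int_open: "tangent_field Z X \<Longrightarrow> open U \<Longrightarrow> tangent_field (Z \<inter> U) X"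
  unfolding tangent_field_def using proximal_normal_Int_open by blast

lemma tangent_field_cong: "(\<And>z. z \<in> Z \<Longrightarrow> X z = Y z) \<Longrightarrow> tangent_field Z X \<longleftrightarrow> tangent_field Z Y"
  by (simp add: tangent_field_def)

lemma dim_orthogonal_pair:
  fixes a b :: "'e::euclidean_space"
  assumes "independent {a, b}" "a \<noteq> b" "\<And>v. v \<in> V \<Longrightarrow> a \<bullet> v = 0 \<and> b \<bullet> v = 0"
  shows "dim (span V) + 2 \<le> DIM('e)"
proof -
  have "dim {y \<in> UNIV. \<forall>x\<in>span {a, b}. orthogonal x y} + dim (span {a, b}) = dim (UNIV :: 'e set)"
    by (rule dim_subspace_orthogonal_to_vectors) auto
  moreover have "dim (span {a, b}) = 2"
    using assms(1,2) by (simp add: dim_eq_card_independent)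
  moreover have "dim (span V) \<le> dim {y \<in> UNIV. \<forall>x\<in>span {a, b}. orthogonal x y}"
  proof -
    have "V \<subseteq> {y \<in> UNIV. \<forall>x\<in>span {a, b}. orthogonal x y}"
    proof
      fix v assume "v \<in> V"
      then have "orthogonal v y" if "y \<in> {a, b}" for y
        using assms(3) that by (auto simp: orthogonal_def inner_commute)
      then have "orthogonal v x" if "x \<in> span {a, b}" for x using orthogonal_to_span that by blast
      then show "v \<in> {y \<in> UNIV. \<forall>x\<in>span {a, b}. orthogonal x y}" by (auto simp: orthogonal_commute)
    qed
    then show ?thesis by (simp add: dim_subset)
  qed
  ultimately show ?thesis by simp
qed

text \<open>Smoothness, tangency and annihilation are proved in one induction, since the bracket
  step for the latter two requires smoothness of both fields. Annihilation is asserted on all of the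
  image of \<open>W\<close>, as it has to be differentiated again in later brackets.\<close>

lemma lie_module_tangent:
  fixes M :: "('a::{t2_space, second_countable_topology}, 'e::euclidean_space) chart set"
    and \<phi> :: "'e \<Rightarrow> real"
  assumes M: "smooth_structure M" "c \<in> M" and W: "open W" "W \<subseteq> fst c"
    and \<phi>: "smooth_on (snd c ` W) \<phi>" "\<And>z. z \<in> snd c ` W \<Longrightarrow> \<exists>p. FD \<phi> z p < 0"
    and Z: "closedin (top_of_set (snd c ` W)) Z"
    and Xs: "\<And>X. X \<in> Xs \<Longrightarrow> smooth_on (snd c ` W) (\<lambda>z. X c (chart_inv c z)) \<and>
        tangent_field Z (\<lambda>z. X c (chart_inv c z)) \<and>
        (\<forall>z\<in>snd c ` W. FD \<phi> z (X c (chart_inv c z)) = 0)"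
    and Y: "Y \<in> lie_module M W Xs"
  shows "smooth_on (snd c ` W) (\<lambda>z. Y c (chart_inv c z)) \<and>
        tangent_field Z (\<lambda>z. Y c (chart_inv c z)) \<and>
        (\<forall>z\<in>snd c ` W. FD \<phi> z (Y c (chart_inv c z)) = 0)"
  using Y
proof (induction rule: lie_module.induct)
  case (generator X)
  then show ?case by (rule Xs)
next
  case zero
  have "FD \<phi> z 0 = 0" if "z \<in> snd c ` W" for z
    using linear_0[OF linear_frechet_derivative[OF smooth_on_differentiable[OF \<phi>(1) that]]] .
  then show ?case by (auto simp: tangent_field_def)
next
  case (add X Y)
  have o: "open (snd c ` W)"
    using chart_open_image[OF smooth_structure_chart[OF M] W(1)] W(2) by (simp add: Int_absorb1)
  have "FD \<phi> z (v + w) = FD \<phi> z v + FD \<phi> z w"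
    if "z \<in> snd c ` W" for z v w
    using linear_add[OF linear_frechet_derivative[OF smooth_on_differentiable[OF \<phi>(1) that]]] .
  then show ?case using add.IH smooth_on_add[OF o] by (auto simp: tangent_field_def inner_add_right)
next
  case (scale f X)
  have o: "open (snd c ` W)"
    using chart_open_image[OF smooth_structure_chart[OF M] W(1)] W(2) by (simp add: Int_absorb1)
  have "smooth_on (snd c ` W) (\<lambda>z. f (chart_inv c z))"
    using scale.hyps(1) M(2) W(2) unfolding smooth_function_def by (auto simp: comp_def Int_absorb1)
  moreover have "FD \<phi> z (k *\<^sub>R v) = k *\<^sub>R FD \<phi> z v"
    if "z \<in> snd c ` W" for z v k
    using linear_scale[OF linear_frechet_derivative[OF smooth_on_differentiable[OF \<phi>(1) that]]] .
  ultimately show ?case using scale.IH smooth_on_scaleR[OF o] by (auto simp: tangent_field_def)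
next
  case (bracket X Y)
  define Xc where "Xc z = X c (chart_inv c z)" for z
  define Yc where "Yc z = Y c (chart_inv c z)" for z
  have o: "open (snd c ` W)"
    using chart_open_image[OF smooth_structure_chart[OF M] W(1)] W(2) by (simp add: Int_absorb1)
  have X: "smooth_on (snd c ` W) Xc" "tangent_field Z Xc" "\<And>z. z \<in> snd c ` W \<Longrightarrow> FD \<phi> z (Xc z) = 0"
    and Y: "smooth_on (snd c ` W) Yc" "tangent_field Z Yc" "\<And>z. z \<in> snd c ` W \<Longrightarrow> FD \<phi> z (Yc z) = 0"
    using bracket.IH unfolding Xc_def Yc_def by blast+
  define B where "B z = FD Yc z (Xc z) - FD Xc z (Yc z)" for z
  have eq: "lie_bracket X Y c (chart_inv c z) = B z" if "z \<in> snd c ` W" for z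
  proof -
    have "snd c (chart_inv c z) = z" using that W(2) by (intro chart_chart_inv) auto
    then show ?thesis by (simp add: lie_bracket_def B_def Xc_def[abs_def] Yc_def[abs_def])
  qed
  have "smooth_on (snd c ` W) B"
    unfolding B_def[abs_def]
    using smooth_on_frechet_derivative_apply[OF X(1) smooth_on_ident Y(1) o o]
      smooth_on_frechet_derivative_apply[OF Y(1) smooth_on_ident X(1) o o]
    by (intro smooth_on_minus[OF o]) auto
  then have "smooth_on (snd c ` W) (\<lambda>z. lie_bracket X Y c (chart_inv c z))"
    by (rule smooth_on_cong[OF _ o]) (simp add: eq)
  moreover have "tangent_field Z (\<lambda>z. lie_bracket X Y c (chart_inv c z)) \<longleftrightarrow> tangent_field Z B"
    by (rule tangent_field_cong, rule eq) (use closedin_imp_subset[OF Z] in blast)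
  moreover have "tangent_field Z B"
    unfolding B_def by (rule tangent_field_bracket[OF o Z X(1) Y(1) X(2) Y(2)])
  moreover have "FD \<phi> z (B z) = 0" if "z \<in> snd c ` W" for z
    unfolding B_def by (rule bracket_annihilates[OF o \<phi>(1) X(1) Y(1) X(3) Y(3) \<phi>(2) that])
  ultimately show ?case using eq by simp
qed

context divergence_operator
begin

text \<open>The part of \<open>G \<eta>\<close> annihilated by \<open>d\<phi>\<close>: these fields are sections of \<open>\<xi> \<inter> ker d\<phi>\<close>.\<close>

definition tfield :: "('e \<Rightarrow> real) \<Rightarrow> 'e \<Rightarrow> 'e \<Rightarrow> 'e" where
  "tfield \<phi> \<eta> z = G z (\<eta> - (gm z \<eta> (covec_diff \<phi> z) / gm z (covec_diff \<phi> z) (covec_diff \<phi> z)) *\<^sub>R covec_diff \<phi> z)"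

lemma inner_G: "z \<in> S \<Longrightarrow> w \<bullet> G z v = gm z w v"
  using linear_Basis_expand[of "\<lambda>w. gm z w v" w] bil[of z]
  by (simp add: G_def bilinear_def inner_sum_right mult.commute)

lemma linear_G: "z \<in> S \<Longrightarrow> linear (G z)"
  unfolding G_def using bil[of z]
  by (intro linear_compose_sum ballI linearI) (auto simp: bilinear_radd bilinear_rmul scaleR_add_left)

text \<open>The right-hand side is the symbol for exponent 0, evaluated at \<open>w\<close> and
  \<eta>; this links the fields to the barrier argument.\<close>

lemma inner_tfield:
  assumes "z \<in> S"
  shows "w \<bullet> tfield \<phi> \<eta> z = gm z w \<eta> -
    gm z \<eta> (covec_diff \<phi> z) * gm z w (covec_diff \<phi> z) / gm z (covec_diff \<phi> z) (covec_diff \<phi> z)"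
  by (simp add: tfield_def inner_G[OF assms] bilinear_rsub[OF bil[OF assms]] bilinear_rmul[OF bil[OF assms]])

lemma smooth_tfield:
  assumes "smooth_on S \<phi>" "\<And>z. z \<in> S \<Longrightarrow> 0 < gm z (covec_diff \<phi> z) (covec_diff \<phi> z)"
  shows "smooth_on S (tfield \<phi> \<eta>)"
proof -
  have c: "smooth_on S (\<lambda>z. covec_diff \<phi> z)" using smooth_on_covec_diff[OF open_S assms(1)] by simp
  have nz: "gm z (covec_diff \<phi> z) (covec_diff \<phi> z) \<noteq> 0" if "z \<in> S" for z using assms(2)[OF that] by simp
  show ?thesis
    unfolding tfield_def[abs_def]
    by (intro smooth_G_comp[OF open_S] smooth_on_minus[OF open_S] smooth_on_scaleR[OF open_S]
        smooth_on_divide[OF open_S] smooth_gm_comp[OF open_S] smooth_on_ident smooth_on_const c nz)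
qed

lemma tfield_annihilated:
  assumes "smooth_on S \<phi>" "z \<in> S" "0 < gm z (covec_diff \<phi> z) (covec_diff \<phi> z)"
  shows "FD \<phi> z (tfield \<phi> \<eta> z) = 0"
  using covec_diff_inner[OF smooth_on_differentiable[OF assms(1,2)], of "tfield \<phi> \<eta> z"]
    inner_tfield[OF assms(2), of "covec_diff \<phi> z" \<phi> \<eta>] assms(3) sym[OF assms(2), of \<eta>]
  by simp

text \<open>A normal is a null vector of the symbol, hence of the smaller symbol for exponent 0. For
  a semidefinite form a null vector lies in the kernel, so its product with every
  \<open>tfield\<close> vanishes.\<close>

lemma tangent_tfield:
  assumes \<phi>: "smooth_on S \<phi>" "\<And>z. z \<in> S \<Longrightarrow> 0 < gm z (covec_diff \<phi> z) (covec_diff \<phi> z)"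
    and \<psi>: "smooth_on S \<psi>" and le: "\<And>z. z \<in> S \<Longrightarrow> \<phi> z \<le> \<psi> z"
    and hop_le: "\<And>z. z \<in> S \<Longrightarrow> hop \<psi> z \<le> hop \<phi> z"
  shows "tangent_field {z \<in> S. \<phi> z = \<psi> z} (tfield \<phi> \<eta>)"
  unfolding tangent_field_def
proof (intro ballI allI impI)
  fix z \<nu> assume z: "z \<in> {z \<in> S. \<phi> z = \<psi> z}" and \<nu>: "proximal_normal {z \<in> S. \<phi> z = \<psi> z} z \<nu>"
  then have zS: "z \<in> S" and eq: "\<phi> z = \<psi> z" by auto
  have \<Omega>: "(z, covec_diff \<phi> z) \<in> \<Omega>" using \<phi>(2)[OF zS] zS by (simp add: \<Omega>_def)
  interpret zero: divergence_operator S gm A 0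
    by unfold_locales (use open_S bil sym psd smooth_gm smooth_A A_nz in auto)
  have "(z, covec_diff \<phi> z) \<in> zero.\<Omega>" using \<Omega> by (simp add: \<Omega>_def zero.\<Omega>_def)
  note s0 = zero.symb_props[OF this]
  have "symb z (covec_diff \<phi> z) \<nu> \<nu> = 0"
    by (rule normal_characteristic[OF \<phi> \<psi> le hop_le zS \<nu> eq])
  then have "zero.symb z (covec_diff \<phi> z) \<nu> \<nu> \<le> 0"
    using symb_props(4)[OF \<Omega>, of \<nu>] by (simp add: zero.symb_def power2_eq_square)
  then have "zero.symb z (covec_diff \<phi> z) \<nu> \<nu> = 0" using s0(3)[of \<nu>] by simp
  then have "(zero.symb z (covec_diff \<phi> z) \<nu> \<eta>)\<^sup>2 \<le> 0"
    using psd_Cauchy_Schwarz[OF s0(1) s0(2) s0(3), of \<nu> \<eta>] by simp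
  then have "zero.symb z (covec_diff \<phi> z) \<nu> \<eta> = 0" by simp
  then show "\<nu> \<bullet> tfield \<phi> \<eta> z = 0"
    by (simp add: inner_tfield[OF zS] zero.symb_def mult.commute)
qed

text \<open>On vectors of the range of \<open>G z\<close> already annihilated by
  \<open>d\<phi>\<close> the correction in \<open>tfield\<close> vanishes. The fields thus fill the
  intersection of that range with a hyperplane, which lowers the dimension by at most one.\<close>

lemma independent_tfield_exists:
  assumes z: "z \<in> S" and pos: "0 < gm z (covec_diff \<phi> z) (covec_diff \<phi> z)"
    and k: "k \<le> dim (range (G z)) - 1"
  obtains \<eta> where "independent_family k (\<lambda>i. tfield \<phi> (\<eta> i) z)"
proof -
  define \<xi> where "\<xi> = covec_diff \<phi> z"
  define R where "R = range (\<lambda>\<eta>. tfield \<phi> \<eta> z)"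
  have \<xi>0: "\<xi> \<noteq> 0" using pos bilinear_lzero[OF bil[OF z]] by (auto simp: \<xi>_def)
  have sub: "range (G z) \<inter> {x. \<xi> \<bullet> x = 0} \<subseteq> R"
  proof
    fix v assume v: "v \<in> range (G z) \<inter> {x. \<xi> \<bullet> x = 0}"
    then obtain \<eta> where \<eta>: "v = G z \<eta>" by auto
    then have "gm z \<eta> \<xi> = 0" using v inner_G[OF z, of \<xi> \<eta>] sym[OF z, of \<eta> \<xi>] by simp
    then have "tfield \<phi> \<eta> z = v" by (simp add: tfield_def \<xi>_def \<eta>)
    then show "v \<in> R" by (auto simp: R_def)
  qed
  have sG: "subspace (range (G z))" using linear_G[OF z] linear_subspace_image subspace_UNIV by blast
  have sH: "subspace {x. \<xi> \<bullet> x = 0}" by (rule subspace_hyperplane)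
  have "dim (range (G z) \<inter> {x. \<xi> \<bullet> x = 0}) + DIM('e) \<ge> dim (range (G z)) + (DIM('e) - 1)"
    using dim_sums_Int[OF sG sH] dim_hyperplane[OF \<xi>0]
      dim_subset_UNIV[of "{x + y |x y. x \<in> range (G z) \<and> y \<in> {x. \<xi> \<bullet> x = 0}}"] by linarith
  then have "dim (range (G z)) - 1 \<le> dim (range (G z) \<inter> {x. \<xi> \<bullet> x = 0})"
    using DIM_positive[where 'a='e] by linarith
  also have "\<dots> \<le> dim R" using sub by (rule dim_subset)
  finally have kR: "k \<le> dim R" using k by simp
  obtain B where B: "B \<subseteq> R" "independent B" "card B = dim R"
    using basis_exists[of R] by metis
  obtain B' where B': "B' \<subseteq> B" "card B' = k" "finite B'"
    using kR B(3) obtain_subset_with_card_n[of k B] by metis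
  obtain h where h: "bij_betw h {..<k} B'"
    using ex_bij_betw_nat_finite[OF B'(3)] B'(2) by (metis atLeast0LessThan)
  have "\<exists>\<eta>. h i = tfield \<phi> \<eta> z" if "i < k" for i
    using h that B(1) B'(1) unfolding R_def bij_betw_def by fast
  then obtain \<eta> where \<eta>: "\<And>i. i < k \<Longrightarrow> h i = tfield \<phi> (\<eta> i) z" by metis
  have "independent_family k h"
    using h independent_mono[OF B(2) B'(1)] by (simp add: independent_family_iff bij_betw_def)
  then have "independent_family k (\<lambda>i. tfield \<phi> (\<eta> i) z)"
    using \<eta> by (simp add: independent_family_def)
  then show thesis by (rule that)
qed

end

section \<open>Translation invariance in the distinguished coordinates\<close>

text \<open>In these coordinates \<open>\<Psi> s\<close> is the shift by \<open>(0, s)\<close>,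
  whose differential is the identity. Preservation of the cometric therefore becomes equality of its
  components at \<open>(y, s)\<close> and \<open>(y, 0)\<close>.\<close>

lemma translation_invariant_box:
  fixes M :: "('a::{t2_space, second_countable_topology}, 'b::euclidean_space \<times> real) chart set"
  assumes M: "smooth_structure M"
    and iso: "isometric_translations M g dv \<Psi> \<delta> U p0"
    and coords: "translation_isometric_coordinates M dv \<Psi> \<delta> U p0 S c"
  obtains r es A where "0 < r" "set es = Basis"
    "\<And>q vs. q \<in> fst c \<Longrightarrow> dv c q vs = A q * coord_form es vs"
    "\<And>y s. norm y < r \<Longrightarrow> \<bar>s\<bar> < r \<Longrightarrow> (y, s) \<in> snd c ` fst c"
    "\<And>y s. norm y < r \<Longrightarrow> \<bar>s\<bar> < r \<Longrightarrow> g c (chart_inv c (y, s)) = g c (chart_inv c (y, 0))"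
    "\<And>y s. norm y < r \<Longrightarrow> \<bar>s\<bar> < r \<Longrightarrow> A (chart_inv c (y, s)) = A (chart_inv c (y, 0))"
proof -
  have c: "c \<in> M" "p0 \<in> fst c" "snd c p0 = 0"
    and tr: "\<And>a q. a \<in> {-\<delta><..<\<delta>} \<Longrightarrow> q \<in> U \<inter> fst c \<Longrightarrow> \<Psi> a q \<in> fst c \<Longrightarrow>
        fst (snd c (\<Psi> a q)) = fst (snd c q) \<and> snd (snd c (\<Psi> a q)) = snd (snd c q) + a"
    using coords unfolding translation_isometric_coordinates_def by blast+
  obtain es A where es: "set es = Basis" and dv: "\<And>q vs. q \<in> fst c \<Longrightarrow> dv c q vs = A q * coord_form es vs"
    and A: "\<And>a q. a \<in> {-\<delta><..<\<delta>} \<Longrightarrow> q \<in> U \<inter> fst c \<Longrightarrow> \<Psi> a q \<in> fst c \<Longrightarrow> A (\<Psi> a q) = A q"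
    using coords unfolding translation_isometric_coordinates_def by blast
  have \<delta>: "0 < \<delta>" "open U" "p0 \<in> U" "continuous_on ({-\<delta><..<\<delta>} \<times> U) (\<lambda>(a, q). \<Psi> a q)"
    and \<Psi>0: "\<And>q. q \<in> U \<Longrightarrow> \<Psi> 0 q = q"
    and pres: "\<And>a q. a \<in> {-\<delta><..<\<delta>} \<Longrightarrow> q \<in> U \<Longrightarrow> \<Psi> a q \<in> U \<Longrightarrow> preserves_cometric M g (\<Psi> a) q"
    using iso unfolding isometric_translations_def by blast+
  have ch: "is_chart c" by (rule smooth_structure_chart[OF M c(1)])
  then have of: "open (fst c)" by (simp add: is_chart_def)
  \<comment> \<open>Joint continuity of the flow makes this set open. A product neighbourhood of
    \<open>(0, p0)\<close> inside it gives uniform bounds on time and place for which the flow stays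
    in \<open>U\<close> and in the chart.\<close>
  define P where "P = (\<lambda>(a, q). \<Psi> a q) -` (U \<inter> fst c) \<inter> ({-\<delta><..<\<delta>} \<times> U)"
  have oP: "open ({-\<delta><..<\<delta>} \<times> U)" using \<delta>(2) by (simp add: open_Times)
  have "open P" using \<delta>(2,4) of unfolding P_def continuous_on_open_vimage[OF oP] by blast
  moreover have "(0, p0) \<in> P" using \<delta> c \<Psi>0 by (simp add: P_def)
  ultimately obtain I W where IW: "open I" "open W" "(0, p0) \<in> I \<times> W" "I \<times> W \<subseteq> P"
    by (rule open_prod_elim)
  obtain \<epsilon> where \<epsilon>: "0 < \<epsilon>" "ball 0 \<epsilon> \<subseteq> I" using IW(1,3) openE by blast
  have "open (snd c ` (fst c \<inter> W))" "0 \<in> snd c ` (fst c \<inter> W)"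
    using chart_open_image[OF ch IW(2)] c IW(3) by (auto intro!: image_eqI[of _ _ p0])
  then obtain \<rho> where \<rho>: "0 < \<rho>" "ball 0 \<rho> \<subseteq> snd c ` (fst c \<inter> W)" using openE by blast
  have inv: "chart_inv c z \<in> fst c \<inter> W" "snd c (chart_inv c z) = z" if "z \<in> ball 0 \<rho>" for z
  proof -
    obtain q where "q \<in> fst c \<inter> W" "z = snd c q" using \<rho>(2) \<open>z \<in> ball 0 \<rho>\<close> by blast
    then show "chart_inv c z \<in> fst c \<inter> W" "snd c (chart_inv c z) = z"
      using chart_inv_chart[OF ch] by auto
  qed
  have flow: "a \<in> {-\<delta><..<\<delta>}" "q \<in> U" "\<Psi> a q \<in> U" "\<Psi> a q \<in> fst c" if "\<bar>a\<bar> < \<epsilon>" "q \<in> W" for a q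
  proof -
    have "(a, q) \<in> P" using that \<epsilon>(2) IW(4) by (auto simp: subset_iff)
    then show "a \<in> {-\<delta><..<\<delta>}" "q \<in> U" "\<Psi> a q \<in> U" "\<Psi> a q \<in> fst c" by (auto simp: P_def)
  qed
  have move: "snd c (\<Psi> a (chart_inv c z)) = z + (0, a)" if "\<bar>a\<bar> < \<epsilon>" "z \<in> ball 0 \<rho>" for a z
    using tr[of a "chart_inv c z"] flow[OF that(1), of "chart_inv c z"] inv[OF that(2)]
    by (intro prod_eqI) auto
  define r where "r = min \<epsilon> (\<rho> / 2)"
  have r: "0 < r" using \<epsilon>(1) \<rho>(1) by (simp add: r_def)
  have box: "(y, s) \<in> ball 0 \<rho>" "\<bar>s\<bar> < \<epsilon>" if "norm y < r" "\<bar>s\<bar> < r" for y :: 'b and s :: real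
  proof -
    have "norm (y, s) \<le> norm y + norm s" by (rule norm_Pair_le)
    also have "\<dots> < \<rho>" using that by (simp add: r_def)
    finally show "(y, s) \<in> ball 0 \<rho>" by simp
    show "\<bar>s\<bar> < \<epsilon>" using that by (simp add: r_def)
  qed
  have box0: "(y, 0 :: real) \<in> ball 0 \<rho>" if "norm y < r" for y :: 'b
    by (rule box(1)[OF that]) (use r in simp)
  have to: "\<Psi> s (chart_inv c (y, 0)) = chart_inv c (y, s)" if "norm y < r" "\<bar>s\<bar> < r" for y s
  proof -
    have b: "(y, 0 :: real) \<in> ball 0 \<rho>" "\<bar>s\<bar> < \<epsilon>" using box[OF that] box0[OF that(1)] by blast+
    have "\<Psi> s (chart_inv c (y, 0)) \<in> fst c" using flow(4)[OF b(2)] inv(1)[OF b(1)] by blast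
    from chart_inv_chart[OF ch this] show ?thesis using move[OF b(2,1)] by simp
  qed
  have "g c (chart_inv c (y, s)) = g c (chart_inv c (y, 0))" if ys: "norm y < r" "\<bar>s\<bar> < r" for y s
  proof (intro ext)
    fix \<omega> \<eta>
    define q where "q = chart_inv c (y, 0)"
    define L where "L = chart_diff c c (\<Psi> s) q"
    have b: "(y, 0 :: real) \<in> ball 0 \<rho>" "\<bar>s\<bar> < \<epsilon>" using box[OF ys] box0[OF ys(1)] by blast+
    have q: "q \<in> fst c" "q \<in> W" "snd c q = (y, 0)" using inv[OF b(1)] by (auto simp: q_def)
    have "((\<lambda>z. z + (0, s)) has_derivative (\<lambda>v. v)) (at (y, 0))"
      by (auto intro!: derivative_eq_intros)
    then have "((snd c \<circ> \<Psi> s \<circ> chart_inv c) has_derivative (\<lambda>v. v)) (at (y, 0))"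
      by (rule has_derivative_transform_within_open[OF _ open_ball b(1)]) (simp add: move[OF b(2)])
    then have L: "L = (\<lambda>v. v)"
      unfolding L_def chart_diff_def q(3) by (rule frechet_derivative_at[symmetric])
    have "adjoint L \<omega> = \<omega>" for \<omega>
    proof -
      have "w \<bullet> adjoint L \<omega> = w \<bullet> \<omega>" for w
        using adjoint_works[of L w \<omega>] by (simp add: L linear_id[unfolded id_def])
      then show ?thesis by (metis vector_eq_ldot)
    qed
    moreover have "g c q (adjoint L \<omega>) (adjoint L \<eta>) = g c (\<Psi> s q) \<omega> \<eta>"
      using pres[OF flow(1,2,3)[OF b(2) q(2)]] c(1) q(1) flow(4)[OF b(2) q(2)]
      unfolding preserves_cometric_def L_def by blast
    ultimately show "g c (chart_inv c (y, s)) \<omega> \<eta> = g c (chart_inv c (y, 0)) \<omega> \<eta>"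
      using to[OF ys] by (simp add: q_def)
  qed
  moreover have "A (chart_inv c (y, s)) = A (chart_inv c (y, 0))" if ys: "norm y < r" "\<bar>s\<bar> < r" for y s
  proof -
    have b: "(y, 0 :: real) \<in> ball 0 \<rho>" "\<bar>s\<bar> < \<epsilon>" using box[OF ys] box0[OF ys(1)] by blast+
    have q: "chart_inv c (y, 0) \<in> W" "chart_inv c (y, 0) \<in> fst c" using inv(1)[OF b(1)] by blast+
    have "A (\<Psi> s (chart_inv c (y, 0))) = A (chart_inv c (y, 0))"
      by (rule A) (use flow[OF b(2) q(1)] q(2) in blast)+
    then show ?thesis unfolding to[OF ys] .
  qed
  moreover have "(y, s) \<in> snd c ` fst c" if ys: "norm y < r" "\<bar>s\<bar> < r" for y s
    using box(1)[OF ys] \<rho>(2) by auto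
  ultimately show thesis using that[OF r es dv] by blast
qed

section \<open>The comparison theorem\<close>

lemma smooth_graph_function:
  assumes "smooth_on B u" "open B" "open T" "\<And>z. z \<in> T \<Longrightarrow> fst z \<in> B"
  shows "smooth_on T (graph_function (u :: 'b::euclidean_space \<Rightarrow> real))"
  unfolding graph_function_def[abs_def]
  by (intro smooth_on_minus[OF assms(3)] smooth_on_compose[OF assms(1) _ assms(3,2)]
      smooth_on_linear_map[OF assms(3)] bounded_linear_fst bounded_linear_snd assms(4))

lemma graph_function_has_derivative:
  fixes u :: "'b::euclidean_space \<Rightarrow> real"
  assumes "u differentiable (at (fst z))"
  shows "(graph_function u has_derivative (\<lambda>v. (covec_diff u (fst z), -1) \<bullet> v)) (at z)"
proof -
  have "((\<lambda>z. u (fst z) - snd z) has_derivative (\<lambda>v. FD u (fst z) (fst v) - snd v)) (at z)"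
    using assms unfolding frechet_derivative_works
    by (intro has_derivative_diff has_derivative_snd[OF has_derivative_ident]
        has_derivative_compose[OF has_derivative_fst[OF has_derivative_ident]])
  then show ?thesis
    unfolding graph_function_def[abs_def]
    by (rule has_derivative_eq_rhs) (simp add: fun_eq_iff covec_diff_inner[OF assms] inner_prod_def)
qed

lemma covec_diff_graph_function:
  "u differentiable (at (fst z)) \<Longrightarrow> covec_diff (graph_function u) z = (covec_diff u (fst z), -1)"
  by (rule covec_diff_eqI[OF graph_function_has_derivative])

lemma independent_pair_graph_normal:
  fixes n w :: "'b::euclidean_space"
  assumes "n \<noteq> 0"
  shows "independent {(n, 0 :: real), (w, -1)}" "(n, 0 :: real) \<noteq> (w, -1)"
proof -
  have "(n, 0 :: real) \<notin> span {(w, -1)}" using assms by (auto simp: span_singleton)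
  then show "independent {(n, 0 :: real), (w, -1)}" by (simp add: independent_insert zero_prod_def)
  show "(n, 0 :: real) \<noteq> (w, -1)" by simp
qed

text \<open>The differential of a graph function depends on \<open>y\<close> alone, so the flux is
  invariant under vertical shifts and so is its divergence. This carries the curvature from a graph
  to every height above the same \<open>y\<close>.\<close>

lemma hop_translation_invariant:
  fixes gm :: "'b::euclidean_space \<times> real \<Rightarrow> _" and u :: "'b \<Rightarrow> real"
  assumes op: "divergence_operator S gm A p"
    and gm: "\<And>y s. gm (y, s) = gm (y, 0)" and A: "\<And>y s. A (y, s) = A (y, 0)"
    and u: "smooth_on B u" "open B" "\<And>z. z \<in> S \<Longrightarrow> fst z \<in> B"
    and pos: "\<And>z. z \<in> S \<Longrightarrow> 0 < gm z (covec_diff (graph_function u) z) (covec_diff (graph_function u) z)"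
    and z: "(y, s) \<in> S" "(y, s') \<in> S"
  shows "divergence_operator.hop gm A p (graph_function u) (y, s) =
    divergence_operator.hop gm A p (graph_function u) (y, s')"
proof -
  interpret divergence_operator S gm A p by (rule op)
  define F where "F z = flux (z, covec_diff (graph_function u) z)" for z
  have sm: "smooth_on S (graph_function u)" by (rule smooth_graph_function[OF u(1,2) open_S u(3)])
  have smF: "smooth_on S F"
    unfolding F_def[abs_def]
    by (rule smooth_on_compose[OF smooth_flux _ open_S open_\<Omega>])
      (auto intro!: smooth_on_Pair[OF open_S] smooth_on_ident smooth_on_covec_diff[OF open_S sm] pos simp: \<Omega>_def)
  define d where "d = (0 :: 'b, s' - s)"
  define T where "T = S \<inter> (\<lambda>z. z + d) -` S"
  have oT: "open T" unfolding T_def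
    by (intro open_Int open_S open_vimage continuous_intros)
  have zT: "(y, s) \<in> T" using z by (simp add: T_def d_def)
  have inv: "F (z + d) = F z" if "z \<in> T" for z
  proof -
    have zS: "z \<in> S" "z + d \<in> S" using that by (auto simp: T_def)
    have f: "fst (z + d) = fst z" by (simp add: d_def)
    have "u differentiable at (fst z)" using smooth_on_differentiable[OF u(1)] u(3)[OF zS(1)] by blast
    then have c: "covec_diff (graph_function u) (z + d) = covec_diff (graph_function u) z"
      using covec_diff_graph_function[of u z] covec_diff_graph_function[of u "z + d"] unfolding f by simp
    have g: "gm (z + d) = gm z" "A (z + d) = A z"
      using gm[of "fst z" "snd z"] gm[of "fst z" "snd (z + d)"] A[of "fst z" "snd z"] A[of "fst z" "snd (z + d)"]
      unfolding f[symmetric] by (metis f prod.collapse)+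
    show ?thesis unfolding F_def c by (simp add: flux_def G_def g)
  qed
  have sd: "(y, s) + d = (y, s')" by (simp add: d_def)
  have "((\<lambda>z. z + d) has_derivative (\<lambda>v. v)) (at (y, s))" by (auto intro!: derivative_eq_intros)
  then have "((\<lambda>z. F (z + d)) has_derivative (\<lambda>v. FD F (y, s') v)) (at (y, s))"
    by (rule has_derivative_compose) (use smooth_on_has_derivative[OF smF z(2)] sd in simp)
  then have "(F has_derivative FD F (y, s')) (at (y, s))"
    by (rule has_derivative_transform_within_open[OF _ oT zT]) (rule inv)
  then have "FD F (y, s) = FD F (y, s')"
    by (rule frechet_derivative_at[symmetric])
  moreover have "A (y, s) = A (y, s')" using A[of y s] A[of y s'] by simp
  ultimately show ?thesis unfolding hop_def F_def[abs_def] by simp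
qed

theorem theoremC:
  fixes M :: "('a::{t2_space, second_countable_topology}, (real ^ 'm) \<times> real) chart set"
    and g :: "('a, (real ^ 'm) \<times> real) cometric"
    and dv :: "('a, (real ^ 'm) \<times> real) form_field"
    and \<Psi> :: "real \<Rightarrow> 'a \<Rightarrow> 'a" and \<delta> :: real and U :: "'a set"
    and p0 :: 'a and S :: "'a set" and l :: nat
    and V :: "'a set" and x :: "'a \<Rightarrow> (real ^ 'm) \<times> real"
    and D :: "(real ^ 'm) set" and u v :: "real ^ 'm \<Rightarrow> real" and p :: real
  assumes "subriemannian_manifold M g"
    and "volume_form M dv"
    and "isometric_translations M g dv \<Psi> \<delta> U p0"
    and "hypersurface M S" and "p0 \<in> S"
    and "transversal_translations M \<Psi> U S"
    and "\<forall>\<^sub>F q in nhds p0. \<forall>c\<in>M. q \<in> fst c \<longrightarrow> dim (horizontal g c q) + l = CARD('m) + 1"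
    and "translation_isometric_coordinates M dv \<Psi> \<delta> U p0 S (V, x)"
    and "D = (\<lambda>q. fst (x q)) ` (S \<inter> V)"
    and "nonsingular_graph g (V, x) D u"
    and "nonsingular_graph g (V, x) D v"
    and "\<forall>y\<in>D. u y \<le> v y" and "v 0 = 0" and "u 0 = 0"
    and "0 \<le> p"
    and "\<forall>y\<in>D. graph_p_mean_curvature g dv (V, x) p v y \<le> graph_p_mean_curvature g dv (V, x) p u y"
    and "rank_condition_near M g p0 (CARD('m) - l) CARD('m)"
  shows "\<forall>\<^sub>F y in nhds 0. v y = u y"
proof -
  note sr = assms(1) and vol = assms(2) and coords = assms(8)
  define c0 where "c0 = (V, x)"
  have M: "smooth_structure M" using sr by (simp add: subriemannian_manifold_def)
  have c0: "c0 \<in> M" "p0 \<in> V" "x p0 = 0" and SV: "S \<inter> V = {q \<in> V. snd (x q) = 0}"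
    using coords unfolding translation_isometric_coordinates_def c0_def by auto
  have ch: "is_chart c0" by (rule smooth_structure_chart[OF M c0(1)])
  have oV: "open V" and oX: "open (x ` V)" using ch by (simp_all add: is_chart_def c0_def)
  have c0s: "fst c0 = V" "snd c0 = x" by (simp_all add: c0_def)
  obtain r es A where r: "0 < r" and es: "set es = Basis"
    and dv': "\<And>q vs. q \<in> fst c0 \<Longrightarrow> dv c0 q vs = A q * coord_form es vs"
    and box': "\<And>y s. norm y < r \<Longrightarrow> \<bar>s\<bar> < r \<Longrightarrow> (y, s) \<in> snd c0 ` fst c0"
    and ginv: "\<And>y s. norm y < r \<Longrightarrow> \<bar>s\<bar> < r \<Longrightarrow> g c0 (chart_inv c0 (y, s)) = g c0 (chart_inv c0 (y, 0))"
    and Ainv: "\<And>y s. norm y < r \<Longrightarrow> \<bar>s\<bar> < r \<Longrightarrow> A (chart_inv c0 (y, s)) = A (chart_inv c0 (y, 0))"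
    by (rule translation_invariant_box[OF M assms(3) coords, folded c0_def]) blast
  note dv = dv'[unfolded c0s] and box = box'[unfolded c0s]
  have D: "y \<in> D" if "norm y < r" for y
  proof -
    have "(y, 0) \<in> x ` V" using box[OF that, of 0] r by simp
    then obtain q where "q \<in> V" "x q = (y, 0)" by (metis imageE)
    then show ?thesis unfolding assms(9) SV by force
  qed
  have inv_in: "chart_inv c0 z \<in> V" and x_inv: "x (chart_inv c0 z) = z" if "z \<in> x ` V" for z
    using chart_inv_into[of z c0] chart_chart_inv[of z c0] that by (simp_all add: c0_def)
  define gm where "gm z = g c0 (chart_inv c0 (fst z, 0))" for z :: "(real ^ 'm) \<times> real"
  define Am where "Am z = A (chart_inv c0 (fst z, 0))" for z :: "(real ^ 'm) \<times> real"
  have smu: "smooth_on (ball 0 r) u" and smv: "smooth_on (ball 0 r) v"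
    using assms(10,11) D unfolding nonsingular_graph_def by (auto intro: smooth_on_subset)
  \<comment> \<open>Since both functions vanish at 0, their graphs over a small ball stay within the
    height \<open>r\<close> of the box.\<close>
  have "\<exists>r1>0. r1 \<le> r \<and> (\<forall>y. norm y < r1 \<longrightarrow> \<bar>w y\<bar> < r)" if "smooth_on (ball 0 r) w" "w 0 = 0"
    for w :: "real ^ 'm \<Rightarrow> real"
  proof -
    have "isCont w 0" using smooth_on_continuous[OF that(1)] r
      by (simp add: continuous_on_eq_continuous_at)
    then obtain e where e: "e > 0" "\<And>y. dist y 0 < e \<Longrightarrow> dist (w y) (w 0) < r"
      using r unfolding continuous_at_eps_delta by blast
    then show ?thesis using r that(2) by (intro exI[of _ "min e r"]) (auto simp: dist_norm)
  qed
  from this[OF smu assms(14)] this[OF smv assms(13)] obtain r1 r2 where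
    r12: "0 < r1" "r1 \<le> r" "\<And>y. norm y < r1 \<Longrightarrow> \<bar>u y\<bar> < r" "0 < r2" "\<And>y. norm y < r2 \<Longrightarrow> \<bar>v y\<bar> < r" by blast
  define r' where "r' = min r1 r2"
  have r': "0 < r'" "r' \<le> r" "\<And>y. norm y < r' \<Longrightarrow> \<bar>u y\<bar> < r" "\<And>y. norm y < r' \<Longrightarrow> \<bar>v y\<bar> < r"
    using r12 by (auto simp: r'_def)
  define Q where "Q = (ball 0 r' \<times> ball 0 r :: ((real ^ 'm) \<times> real) set)"
  have Q: "z \<in> Q \<longleftrightarrow> norm (fst z) < r' \<and> \<bar>snd z\<bar> < r" for z by (cases z) (simp add: Q_def)
  have oQ: "open Q" by (simp add: Q_def open_Times)
  have Q0: "0 \<in> Q" using r r' by (simp add: Q)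
  have QX: "Q \<subseteq> x ` V" using box r'(2) by (auto simp: Q_def)
  have Q_flat: "(fst z, 0) \<in> x ` V" if "z \<in> Q" for z using that box[of "fst z" 0] r r'(2) by (simp add: Q)
  have g_gm: "g c0 (chart_inv c0 z) = gm z" and A_Am: "A (chart_inv c0 z) = Am z" if "z \<in> Q" for z
    using that ginv[of "fst z" "snd z"] Ainv[of "fst z" "snd z"] r'(2) by (simp_all add: Q gm_def Am_def)
  have flat: "smooth_on Q (\<lambda>z. (fst z, 0 :: real))"
    by (intro smooth_on_Pair[OF oQ] smooth_on_const smooth_on_linear_map[OF oQ] bounded_linear_fst)
  have gprops: "bilinear (g c0 q)" "g c0 q a b = g c0 q b a" "0 \<le> g c0 q a a" if "q \<in> V" for q a b
    using sr c0(1) that unfolding subriemannian_manifold_def c0s(1)[symmetric] by blast+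
  have "alternating_form DIM((real ^ 'm) \<times> real) (dv c0 q) \<and> (\<exists>vs. dv c0 q vs \<noteq> 0)" if "q \<in> V" for q
    using vol c0(1) that unfolding volume_form_def c0s(1)[symmetric] by blast
  then have alt: "alternating_form DIM((real ^ 'm) \<times> real) (dv c0 q)" and nz: "\<exists>vs. dv c0 q vs \<noteq> 0"
    if "q \<in> V" for q using that by blast+
  have A_nz: "A q \<noteq> 0" if "q \<in> V" for q using nz[OF that] dv[OF that] by auto
  have smA: "smooth_on (x ` V) (\<lambda>z. A (chart_inv c0 z))"
  proof -
    obtain vs where vs: "coord_form es vs \<noteq> 0" using nz[OF c0(2)] dv[OF c0(2)] by auto
    have "smooth_on (x ` V) (\<lambda>z. dv c0 (chart_inv c0 z) vs)"
      using vol c0(1) unfolding volume_form_def c0s[symmetric] by blast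
    from smooth_on_divide[OF oX this smooth_on_const[of _ "coord_form es vs"]] vs
    have "smooth_on (x ` V) (\<lambda>z. dv c0 (chart_inv c0 z) vs / coord_form es vs)" by blast
    then show ?thesis by (rule smooth_on_cong[OF _ oX]) (use vs in \<open>simp add: dv inv_in\<close>)
  qed
  have op: "divergence_operator Q gm Am p"
  proof
    show "smooth_on Q (\<lambda>z. gm z a b)" for a b
    proof -
      have "smooth_on (x ` V) (\<lambda>z. g c0 (chart_inv c0 z) a b)"
        using sr c0(1) unfolding subriemannian_manifold_def c0s[symmetric] by blast
      from smooth_on_compose[OF this flat oQ oX Q_flat] show ?thesis by (simp add: gm_def)
    qed
    show "smooth_on Q Am"
      using smooth_on_compose[OF smA flat oQ oX Q_flat] by (simp add: Am_def[abs_def])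
    show "Am z \<noteq> 0" if "z \<in> Q" for z using A_nz[OF inv_in[OF Q_flat[OF that]]] by (simp add: Am_def)
    show "bilinear (gm z)" "gm z a b = gm z b a" "0 \<le> gm z a a" if "z \<in> Q" for z a b
      using gprops[OF inv_in[OF Q_flat[OF that]]] by (simp_all add: gm_def)
  qed (use oQ assms(15) in auto)
  interpret divergence_operator Q gm Am p by (rule op)
  have fstQ: "fst z \<in> ball 0 r" if "z \<in> Q" for z using that r'(2) by (simp add: Q)
  have sm_graph: "smooth_on Q (graph_function w)" if "smooth_on (ball 0 r) w" for w
    by (rule smooth_graph_function[OF that open_ball oQ fstQ])
  have covec: "covec_diff (graph_function w) z = (covec_diff w (fst z), -1)"
    if "smooth_on (ball 0 r) w" "z \<in> Q" for w z
    by (rule covec_diff_graph_function[OF smooth_on_differentiable[OF that(1) fstQ[OF that(2)]]])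
  \<comment> \<open>Nonsingularity is given on the graph only; invariance in \<open>s\<close>
    spreads it over the whole box.\<close>
  have pos: "0 < gm z (covec_diff (graph_function w) z) (covec_diff (graph_function w) z)"
    if w: "nonsingular_graph g (V, x) D w" "smooth_on (ball 0 r) w" "\<And>y. norm y < r' \<Longrightarrow> \<bar>w y\<bar> < r"
      and z: "z \<in> Q" for w z
  proof -
    have y: "norm (fst z) < r'" "fst z \<in> D" using z D r'(2) by (simp_all add: Q)
    have zw: "(fst z, w (fst z)) \<in> Q" using w(3)[OF y(1)] y(1) by (simp add: Q)
    have "conorm g c0 (chart_inv c0 (fst z, w (fst z))) (covec_diff (graph_function w) (fst z, w (fst z))) \<noteq> 0"
      using w(1) y(2) unfolding nonsingular_graph_def c0_def by blast
    moreover have "gm (fst z, w (fst z)) = gm z" by (simp add: gm_def)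
    ultimately have "gm z (covec_diff (graph_function w) z) (covec_diff (graph_function w) z) \<noteq> 0"
      unfolding conorm_def g_gm[OF zw] covec[OF w(2) zw] covec[OF w(2) z] by simp
    then show ?thesis using psd[OF z, of "covec_diff (graph_function w) z"] by simp
  qed
  have hop_graph: "hop (graph_function w) z = graph_p_mean_curvature g dv c0 p w (fst z)"
    if w: "nonsingular_graph g (V, x) D w" "smooth_on (ball 0 r) w" "\<And>y. norm y < r' \<Longrightarrow> \<bar>w y\<bar> < r"
      and z: "z \<in> Q" for w z
  proof -
    have zw: "(fst z, w (fst z)) \<in> Q" using z w(3)[of "fst z"] by (simp add: Q)
    have "p_mean_curvature g dv c0 p (graph_function w) (fst z, w (fst z)) = hop (graph_function w) (fst z, w (fst z))"
    proof (rule p_mean_curvature_eq_hop[OF oQ order_refl zw sm_graph[OF w(2)] es])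
      show "\<exists>vs. dv c0 (chart_inv c0 (fst z, w (fst z))) vs \<noteq> 0" using nz inv_in zw QX by blast
      show "alternating_form DIM((real ^ 'm) \<times> real) (dv c0 (chart_inv c0 y))" if "y \<in> Q" for y
        using alt inv_in that QX by blast
      show "dv c0 (chart_inv c0 y) vs = Am y * coord_form es vs" if "y \<in> Q" for y vs
        unfolding A_Am[OF that, symmetric] by (rule dv[OF inv_in]) (use that QX in blast)
    qed (use g_gm pos[OF w] in auto)
    also have "\<dots> = hop (graph_function w) (fst z, snd z)"
    proof (rule hop_translation_invariant[OF op _ _ w(2) open_ball fstQ pos[OF w] zw])
      show "(fst z, snd z) \<in> Q" using z by simp
    qed (simp_all add: gm_def Am_def)
    finally show ?thesis by (simp add: graph_p_mean_curvature_def)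
  qed
  define \<phi> where "\<phi> = graph_function u"
  define \<psi> where "\<psi> = graph_function v"
  have sm\<phi>: "smooth_on Q \<phi>" and sm\<psi>: "smooth_on Q \<psi>"
    unfolding \<phi>_def \<psi>_def using sm_graph smu smv by blast+
  have pos\<phi>: "0 < gm z (covec_diff \<phi> z) (covec_diff \<phi> z)" if "z \<in> Q" for z
    unfolding \<phi>_def by (rule pos[OF assms(10) smu r'(3) that])
  have DQ: "fst z \<in> D" if "z \<in> Q" for z using that D r'(2) by (simp add: Q)
  have le: "\<phi> z \<le> \<psi> z" if "z \<in> Q" for z
    using assms(12) DQ[OF that] by (simp add: \<phi>_def \<psi>_def graph_function_def)
  have hop_le: "hop \<psi> z \<le> hop \<phi> z" if "z \<in> Q" for z
  proof -
    have "hop \<psi> z = graph_p_mean_curvature g dv c0 p v (fst z)"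
      unfolding \<psi>_def by (rule hop_graph[OF assms(11) smv r'(4) that])
    moreover have "hop \<phi> z = graph_p_mean_curvature g dv c0 p u (fst z)"
      unfolding \<phi>_def by (rule hop_graph[OF assms(10) smu r'(3) that])
    ultimately show ?thesis using assms(16) DQ[OF that] by (simp add: c0_def)
  qed
  have eq_iff: "\<phi> z = \<psi> z \<longleftrightarrow> u (fst z) = v (fst z)" for z
    by (simp add: \<phi>_def \<psi>_def graph_function_def)
  have tan: "tangent_field {z \<in> Q. \<phi> z = \<psi> z} (tfield \<phi> \<eta>)" for \<eta>
    by (rule tangent_tfield[OF sm\<phi> pos\<phi> sm\<psi> le hop_le])
  define k where "k = CARD('m) - l"
  have inv0: "chart_inv c0 0 = p0" using chart_inv_chart[OF ch, of p0] c0 by (simp add: c0_def)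
  have "dim (horizontal g c0 p0) + l = CARD('m) + 1"
    using eventually_nhds_x_imp_x[OF assms(7)] c0 by (auto simp: c0_def)
  moreover have "horizontal g c0 p0 = range (G 0)"
    using sharp_eq(1)[of g c0 p0, OF gprops(1)[OF c0(2)]] g_gm[OF Q0] inv0
    by (simp add: horizontal_def G_def[abs_def])
  \<comment> \<open>With \<open>dim + l = CARD('m) + 1\<close> the truncated differences
    \<open>dim - 1\<close> and \<open>CARD('m) - l\<close> agree, the case
    \<open>l = CARD('m) + 1\<close> included.\<close>
  ultimately have k: "k \<le> dim (range (G 0)) - 1" by (simp add: k_def)
  obtain \<eta> where \<eta>: "independent_family k (\<lambda>i. tfield \<phi> (\<eta> i) 0)"
    using independent_tfield_exists[OF Q0 pos\<phi>[OF Q0] k] by blast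
  have sm_t: "smooth_on Q (tfield \<phi> e)" for e by (rule smooth_tfield[OF sm\<phi> pos\<phi>])
  have "\<forall>\<^sub>F z in nhds 0. independent_family k (\<lambda>i. tfield \<phi> (\<eta> i) z)"
  proof (rule independent_family_eventually[of k "\<lambda>z i. tfield \<phi> (\<eta> i) z" 0, OF \<eta>])
    fix i
    have "isCont (tfield \<phi> (\<eta> i)) 0"
      using smooth_on_continuous[OF sm_t] oQ Q0 by (simp add: continuous_on_eq_continuous_at)
    then show "((\<lambda>z. tfield \<phi> (\<eta> i) z) \<longlongrightarrow> tfield \<phi> (\<eta> i) 0) (nhds 0)"
      by (simp add: isCont_def tendsto_at_iff_tendsto_nhds)
  qed
  then obtain \<rho>1 where \<rho>1: "0 < \<rho>1" "\<And>z. dist z 0 < \<rho>1 \<Longrightarrow> independent_family k (\<lambda>i. tfield \<phi> (\<eta> i) z)"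
    unfolding eventually_nhds_metric by blast
  obtain N where N: "open N" "p0 \<in> N"
    and rank: "\<forall>W X. open W \<and> W \<subseteq> N \<and> independent_sections M g W k X \<longrightarrow>
      (\<forall>c\<in>M. \<forall>q\<in>W \<inter> fst c. CARD('m) \<le> lie_rank M W (X ` {..<k}) c q)"
    using assms(17)[unfolded rank_condition_near_def, folded k_def] by (elim exE conjE)
  have "open (x ` (V \<inter> N) \<inter> Q \<inter> ball 0 \<rho>1)" "0 \<in> x ` (V \<inter> N) \<inter> Q \<inter> ball 0 \<rho>1"
    using chart_open_image[OF ch N(1)] oQ Q0 \<rho>1(1) N(2) c0 by (auto simp: c0_def intro!: image_eqI[of _ _ p0])
  then obtain \<rho> where \<rho>: "0 < \<rho>" "ball 0 \<rho> \<subseteq> x ` (V \<inter> N) \<inter> Q \<inter> ball 0 \<rho>1" using openE by blast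
  \<comment> \<open>One open set on which the chosen sections stay independent and which lies in the
    neighbourhood of the rank condition; its coordinate image is a ball.\<close>
  define W where "W = V \<inter> x -` ball 0 \<rho>"
  have "continuous_on V x" using ch by (auto simp: is_chart_def c0_def homeomorphism_def)
  then have oW: "open W" unfolding W_def using oV by (simp add: continuous_on_open_vimage Int_commute)
  have xW: "x ` W = ball 0 \<rho>" using \<rho>(2) QX by (auto simp: W_def)
  have WV: "W \<subseteq> V" by (auto simp: W_def)
  have x_in: "q = chart_inv c0 (x q)" if "q \<in> V" for q
    using chart_inv_chart[OF ch, of q] that by (simp add: c0_def)
  have WN: "W \<subseteq> N"
  proof
    fix q assume "q \<in> W"
    then obtain q' where "q' \<in> V \<inter> N" "x q = x q'" "q \<in> V" using \<rho>(2) by (force simp: W_def)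
    then show "q \<in> N" using x_in by (metis IntD1 IntD2)
  qed
  have BQ: "ball 0 \<rho> \<subseteq> Q" using \<rho>(2) by blast
  define X where "X i c q = chart_diff c0 c id q (tfield \<phi> (\<eta> i) (x q))" for i c q
  have sec: "independent_sections M g W k X"
    unfolding X_def[abs_def] c0s(2)[symmetric]
  proof (rule independent_sections_lift[OF sr c0(1) oW], unfold c0s)
    show "W \<subseteq> V" by (rule WV)
    show "smooth_on (x ` W) (tfield \<phi> (\<eta> i))" for i
      unfolding xW by (rule smooth_on_subset[OF sm_t BQ])
  next
    fix i q assume q: "q \<in> W"
    have xq: "x q \<in> Q" and qV: "q \<in> V" using q xW BQ WV by blast+
    have gq: "g c0 q = gm (x q)" using g_gm[OF xq] unfolding x_in[OF qV, symmetric] .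
    have "G (x q) e = sharp g c0 q e" for e
      unfolding G_def gq[symmetric] by (rule sharp_eq(1)[of g c0 q, OF gprops(1)[OF qV], symmetric])
    then show "tfield \<phi> (\<eta> i) (x q) \<in> horizontal g c0 q"
      by (simp add: tfield_def horizontal_def)
  next
    fix q assume "q \<in> W"
    then have "x q \<in> ball 0 \<rho>1" using xW \<rho>(2) by blast
    then show "independent_family k (\<lambda>i. tfield \<phi> (\<eta> i) (x q))" using \<rho>1(2) by (simp add: dist_commute)
  qed
  define Z where "Z = {z \<in> Q. \<phi> z = \<psi> z} \<inter> ball 0 \<rho>"
  have clZ: "closedin (top_of_set (x ` W)) Z"
  proof -
    have "continuous_on (ball 0 \<rho>) (\<lambda>z. \<phi> z - \<psi> z)"
      using smooth_on_continuous[OF smooth_on_minus[OF oQ sm\<phi> sm\<psi>]] BQ by (rule continuous_on_subset)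
    from continuous_closedin_preimage[OF this, of "{0}"]
    have "closedin (top_of_set (ball 0 \<rho>)) (ball 0 \<rho> \<inter> (\<lambda>z. \<phi> z - \<psi> z) -` {0})" by simp
    moreover have "Z = ball 0 \<rho> \<inter> (\<lambda>z. \<phi> z - \<psi> z) -` {0}" using BQ unfolding Z_def by auto
    ultimately show ?thesis unfolding xW by simp
  qed
  have ann: "FD \<phi> z (tfield \<phi> e z) = 0" if "z \<in> Q" for e z
    by (rule tfield_annihilated[OF sm\<phi> that pos\<phi>[OF that]])
  have cov\<phi>: "FD \<phi> z w = (covec_diff u (fst z), -1) \<bullet> w" if "z \<in> Q" for z w
    using covec_diff_inner[OF smooth_on_differentiable[OF sm\<phi> that], of w] covec[OF smu that]
    by (simp add: \<phi>_def)
  have lie: "smooth_on (x ` W) (\<lambda>z. Y c0 (chart_inv c0 z)) \<and>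
        tangent_field Z (\<lambda>z. Y c0 (chart_inv c0 z)) \<and>
        (\<forall>z\<in>x ` W. FD \<phi> z (Y c0 (chart_inv c0 z)) = 0)"
    if Y: "Y \<in> lie_module M W (X ` {..<k})" for Y
    unfolding c0s(2)[symmetric]
  proof (rule lie_module_tangent[OF M c0(1) oW _ _ _ _ _ Y], unfold c0s)
    show "W \<subseteq> V" by (rule WV)
    show "closedin (top_of_set (x ` W)) Z" by (rule clZ)
    show "smooth_on (x ` W) \<phi>" unfolding xW by (rule smooth_on_subset[OF sm\<phi> BQ])
    \<comment> \<open>The translation direction serves as witness: \<phi> has slope -1 along
      it.\<close>
    show "\<exists>w. FD \<phi> z w < 0" if "z \<in> x ` W" for z
      using cov\<phi>[of z "(0, 1)"] that xW BQ by (intro exI[of _ "(0, 1)"]) auto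
    fix Y assume "Y \<in> X ` {..<k}"
    then obtain i where Yi: "Y = X i" by blast
    have Yt: "Y c0 (chart_inv c0 z) = tfield \<phi> (\<eta> i) z" if "z \<in> ball 0 \<rho>" for z
    proof -
      have zV: "z \<in> x ` V" using that BQ QX by blast
      show ?thesis
        using chart_diff_self[OF M c0(1), of "chart_inv c0 z"] inv_in[OF zV] x_inv[OF zV]
        by (simp add: Yi X_def c0_def)
    qed
    have "smooth_on (x ` W) (\<lambda>z. Y c0 (chart_inv c0 z))"
      unfolding xW by (rule smooth_on_cong[OF smooth_on_subset[OF sm_t[of "\<eta> i"] BQ] open_ball]) (simp only: Yt)
    moreover have "tangent_field Z (\<lambda>z. Y c0 (chart_inv c0 z)) \<longleftrightarrow> tangent_field Z (tfield \<phi> (\<eta> i))"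
      by (rule tangent_field_cong, rule Yt) (simp add: Z_def)
    moreover have "tangent_field Z (tfield \<phi> (\<eta> i))"
      unfolding Z_def by (rule tangent_field_Int_open[OF tan open_ball])
    moreover have "FD \<phi> z (Y c0 (chart_inv c0 z)) = 0" if "z \<in> x ` W" for z
    proof -
      have "z \<in> ball 0 \<rho>" using that xW by simp
      then show ?thesis using Yt[of z] ann[of z "\<eta> i"] BQ by auto
    qed
    ultimately show "smooth_on (x ` W) (\<lambda>z. Y c0 (inv_into V x z)) \<and>
        tangent_field Z (\<lambda>z. Y c0 (inv_into V x z)) \<and>
        (\<forall>z\<in>x ` W. FD \<phi> z (Y c0 (inv_into V x z)) = 0)"
      unfolding c0s by blast
  qed
  show ?thesis
  proof (rule ccontr)
    assume "\<not> ?thesis"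
    then have "\<exists>y. dist y 0 < \<rho> / 4 \<and> v y \<noteq> u y" using \<rho>(1) unfolding eventually_nhds_metric
      by (metis divide_pos_pos zero_less_numeral)
    then obtain y1 where y1: "norm y1 < \<rho> / 4" "v y1 \<noteq> u y1" by auto
    \<comment> \<open>The coincidence set projected to the \<open>y\<close> variables. As 0 belongs
      to it and \<open>y1\<close> has norm below \<open>\<rho> / 4\<close>, the nearest point has
      norm below \<open>\<rho> / 2\<close>, so the truncating sphere is avoided.\<close>
    define K where "K = cball 0 (\<rho> / 2) \<inter> (\<lambda>y. u y - v y) -` {0}"
    have norm0: "norm (y, 0 :: real) = norm y" for y :: "real ^ 'm" by (simp add: norm_Pair)
    have sub: "cball 0 (\<rho> / 2) \<subseteq> ball (0 :: real ^ 'm) r"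
    proof
      fix y :: "real ^ 'm" assume "y \<in> cball 0 (\<rho> / 2)"
      then have "(y, 0 :: real) \<in> ball 0 \<rho>" unfolding mem_ball_0 norm0 using \<rho>(1) by simp
      then have "(y, 0 :: real) \<in> Q" using BQ by blast
      from fstQ[OF this] show "y \<in> ball 0 r" by simp
    qed
    have "continuous_on (cball 0 (\<rho> / 2)) (\<lambda>y. u y - v y)"
      using smooth_on_continuous[OF smooth_on_minus[OF open_ball smu smv]] sub by (rule continuous_on_subset)
    then have "closed K" unfolding K_def by (rule continuous_closed_preimage) auto
    moreover have "0 \<in> K" using \<rho>(1) assms(13,14) by (simp add: K_def)
    ultimately obtain y0 where y0: "y0 \<in> K" "infdist y1 K = dist y1 y0"
      using infdist_attains_inf[of K y1] by blast
    have "dist y1 y0 \<le> norm y1" using infdist_le[OF \<open>0 \<in> K\<close>, of y1] y0(2) by simp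
    then have ny0: "norm y0 < \<rho> / 2" using y1(1) norm_triangle_sub[of y0 y1]
      by (simp add: dist_norm norm_minus_commute)
    have uv: "u y0 = v y0" using y0(1) by (simp add: K_def)
    define n where "n = y1 - y0"
    have n: "n \<noteq> 0" using uv y1(2) by (auto simp: n_def)
    have z0: "(y0, 0 :: real) \<in> ball 0 \<rho>" unfolding mem_ball_0 norm0 using ny0 \<rho>(1) by simp
    \<comment> \<open>Projection to \<open>y\<close> does not increase distances and maps nearby
      points of \<open>Z\<close> into \<open>K\<close>. A nearest point in \<open>K\<close> thus
      yields a nearest point in \<open>Z\<close> and a normal with vanishing last component.\<close>
    have "proximal_normal Z (y0, 0 :: real) ((y1, 0) - (y0, 0))"
    proof (rule proximal_normal_nearest)
      show "0 < \<rho> / 2 - norm y0" using ny0 by simp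
      fix z :: "(real ^ 'm) \<times> real" assume z: "z \<in> Z" "dist z (y0, 0) < \<rho> / 2 - norm y0"
      have "dist (fst z) y0 \<le> dist z (y0, 0)" using dist_fst_le[of z "(y0, 0)"] by simp
      then have "norm (fst z) \<le> \<rho> / 2" using z(2) norm_triangle_sub[of "fst z" y0] by (simp add: dist_norm)
      moreover have "u (fst z) = v (fst z)" using z(1) eq_iff by (simp add: Z_def)
      ultimately have "fst z \<in> K" by (simp add: K_def)
      then have "dist y1 y0 \<le> dist y1 (fst z)" using y0(2) infdist_le by metis
      also have "\<dots> \<le> dist (y1, 0) z" using dist_fst_le[of "(y1, 0)" z] by simp
      finally show "dist (y1, 0 :: real) (y0, 0) \<le> dist (y1, 0) z" by (simp add: dist_prod_def)
    qed
    then have pn: "proximal_normal Z (y0, 0) (n, 0)" by (simp add: n_def)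
    have z0Z: "(y0, 0) \<in> Z" using z0 BQ uv eq_iff[of "(y0, 0)"] by (auto simp: Z_def)
    define q0 where "q0 = chart_inv c0 (y0, 0)"
    have "(y0, 0) \<in> x ` W" using z0 xW by simp
    then have q0: "q0 \<in> W" using x_in WV unfolding q0_def by (metis image_iff subset_iff)
    define Vs where "Vs = (\<lambda>Y. Y c0 q0) ` lie_module M W (X ` {..<k})"
    \<comment> \<open>The normal \<open>(n, 0)\<close> and the differential of \<phi> are
      independent and annihilate every value of the Lie module at \<open>q0\<close>, leaving
      dimension at most \<open>CARD('m) - 1\<close>.\<close>
    have "dim (span Vs) + 2 \<le> DIM((real ^ 'm) \<times> real)"
    proof (rule dim_orthogonal_pair[OF independent_pair_graph_normal[OF n, of "covec_diff u y0"]])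
      fix w assume "w \<in> Vs"
      then obtain Y where Y: "Y \<in> lie_module M W (X ` {..<k})" "w = Y c0 (chart_inv c0 (y0, 0))"
        by (auto simp: Vs_def q0_def)
      have "(n, 0) \<bullet> w = 0"
        using lie[OF Y(1)] z0Z pn unfolding tangent_field_def Y(2) by blast
      moreover have "FD \<phi> (y0, 0) w = 0"
        using lie[OF Y(1)] z0 xW unfolding Y(2) by blast
      then have "(covec_diff u y0, -1) \<bullet> w = 0" using cov\<phi>[OF subsetD[OF BQ z0], of w] by simp
      ultimately show "(n, 0) \<bullet> w = 0 \<and> (covec_diff u y0, -1) \<bullet> w = 0" by blast
    qed
    moreover have "CARD('m) \<le> dim (span Vs)"
    proof -
      have "q0 \<in> W \<inter> fst c0" using q0 WV by (auto simp: c0s)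
      then show ?thesis
        using rank[rule_format, OF conjI[OF oW conjI[OF WN sec]] c0(1)] unfolding lie_rank_def Vs_def by blast
    qed
    ultimately show False by simp
  qed
qed

end
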